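(* Given a finite alphabet $\Sigma$ and a context-free grammar $G$ over terminal alphabet $\Sigma$, deciding whether $L(G)\cap E_\Sigma\neq\emptyset$ is in NP (with input size $|G|+|\Sigma|$).
   Context: For a finite alphabet $\Sigma$, a perfect pangram is a string over $\Sigma$ in which each letter of $\Sigma$ occurs exactly once; $E_\Sigma$ is the set of perfect pangrams. $|G|$ is the size of the grammar (total size of its rules). *)

theory Defs
  imports Main
begin

text \<open>The finite terminal alphabet Sigma is taken, without loss of generality, to be
  {0..<s} for some s (letters are numbered). Nonterminals are natural numbers.
  A production is a pair (A, rhs); a grammar is a start symbol together with a finite
  list of productions. Symbols of a sentential form are Inl A (nonterminal) or Inr a
  (terminal).\<close>

type_synonym sym = "nat + nat"
type_synonym prod = "nat \<times> sym list"

definition cfg_step :: "prod list \<Rightarrow> sym list \<Rightarrow> sym list \<Rightarrow> bool" where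
  "cfg_step R u v \<longleftrightarrow>
     (\<exists>\<alpha> \<beta> A rhs. (A, rhs) \<in> set R \<and> u = \<alpha> @ [Inl A] @ \<beta> \<and> v = \<alpha> @ rhs @ \<beta>)"

definition cfg_lang :: "nat \<Rightarrow> prod list \<Rightarrow> nat list set" where
  "cfg_lang S R = {w. (cfg_step R)\<^sup>*\<^sup>* [Inl S] (map Inr w)}"

definition cfg_over :: "nat \<Rightarrow> prod list \<Rightarrow> bool" where
  "cfg_over s R \<longleftrightarrow> (\<forall>(A, rhs) \<in> set R. \<forall>a. Inr a \<in> set rhs \<longrightarrow> a < s)"

definition perfect_pangrams :: "nat \<Rightarrow> nat list set" where
  "perfect_pangrams s = {w. set w \<subseteq> {0..<s} \<and> (\<forall>a<s. count_list w a = 1)}"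

fun bin :: "nat \<Rightarrow> bool list" where
  "bin n = (if n = 0 then [] else odd n # bin (n div 2))"

definition enc_nat :: "nat \<Rightarrow> bool list" where
  "enc_nat n = concat (map (\<lambda>b. [True, b]) (bin n)) @ [False, False]"

definition enc_unary :: "nat \<Rightarrow> bool list" where
  "enc_unary n = replicate n True @ [False]"

definition enc_list :: "('a \<Rightarrow> bool list) \<Rightarrow> 'a list \<Rightarrow> bool list" where
  "enc_list f xs = concat (map (\<lambda>x. True # f x) xs) @ [False]"

fun enc_sym :: "sym \<Rightarrow> bool list" where
  "enc_sym (Inl A) = False # enc_nat A"
| "enc_sym (Inr a) = True # enc_nat a"

fun enc_prod :: "prod \<Rightarrow> bool list" where
  "enc_prod (A, rhs) = enc_nat A @ enc_list enc_sym rhs"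

text \<open>An instance (Sigma = {0..<s}, G = (S, R)). The alphabet size is written in unary,
  so that the encoding length is polynomially related to |G| + |Sigma|.\<close>
definition enc_instance :: "nat \<Rightarrow> nat \<Rightarrow> prod list \<Rightarrow> bool list" where
  "enc_instance s S R = enc_unary s @ enc_nat S @ enc_list enc_prod R"

definition PANGRAM_CFG :: "bool list set" where
  "PANGRAM_CFG = {enc_instance s S R | s S R.
       cfg_over s R \<and> cfg_lang S R \<inter> perfect_pangrams s \<noteq> {}}"

datatype dir = Lt | Rt | Nt

text \<open>A machine is (number of states, number of tape symbols, transition function).
  Start state 0, accepting state 1, rejecting state 2; blank symbol 0.
  A configuration is (state, reversed left part of tape, tape from head position on).\<close>
type_synonym tm = "nat \<times> nat \<times> (nat \<Rightarrow> nat \<Rightarrow> nat \<times> nat \<times> dir)"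
type_synonym config = "nat \<times> nat list \<times> nat list"

definition tm_wf :: "tm \<Rightarrow> bool" where
  "tm_wf M = (case M of (n, k, \<delta>) \<Rightarrow> 3 \<le> n \<and> 4 \<le> k \<and>
      (\<forall>q<n. \<forall>a<k. fst (\<delta> q a) < n \<and> fst (snd (\<delta> q a)) < k))"

definition tm_step :: "tm \<Rightarrow> config \<Rightarrow> config" where
  "tm_step M c = (case M of (n, k, \<delta>) \<Rightarrow> (case c of (q, ls, rs) \<Rightarrow>
     if q = 1 \<or> q = 2 then c else
     (let a = (case rs of [] \<Rightarrow> 0 | x # _ \<Rightarrow> x);
          rs' = tl rs;
          (q', b, d) = \<delta> q a
      in case d of
           Lt \<Rightarrow> (case ls of [] \<Rightarrow> (q', [], b # rs') | x # ls' \<Rightarrow> (q', ls', x # b # rs'))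
         | Rt \<Rightarrow> (q', b # ls, rs')
         | Nt \<Rightarrow> (q', ls, b # rs'))))"

definition tm_run :: "tm \<Rightarrow> nat \<Rightarrow> nat list \<Rightarrow> config" where
  "tm_run M t x = (tm_step M ^^ t) (0, [], x)"

definition decides_in_time :: "tm \<Rightarrow> (nat \<Rightarrow> nat) \<Rightarrow> nat list set \<Rightarrow> bool" where
  "decides_in_time M T L \<longleftrightarrow>
     (\<forall>x. set x \<subseteq> {1, 2, 3} \<longrightarrow>
        (\<exists>t \<le> T (length x). fst (tm_run M t x) \<in> {1, 2} \<and>
            (fst (tm_run M t x) = 1 \<longleftrightarrow> x \<in> L)))"

definition in_P :: "nat list set \<Rightarrow> bool" where
  "in_P L \<longleftrightarrow> (\<exists>M c d. tm_wf M \<and> decides_in_time M (\<lambda>n. c * n ^ d + c) L)"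

definition bit_code :: "bool \<Rightarrow> nat" where
  "bit_code b = (if b then 2 else 1)"

definition in_NP :: "bool list set \<Rightarrow> bool" where
  "in_NP L \<longleftrightarrow> (\<exists>V c d. in_P V \<and>
     (\<forall>x. x \<in> L \<longleftrightarrow>
        (\<exists>y. length y \<le> c * length x ^ d + c \<and> map bit_code x @ [3] @ map bit_code y \<in> V)))"

end

theory Submission
  imports Defs "HOL-Library.Multiset"
begin

text \<open>The certificate is the sequence of nondeterministic choices of a regular program that works on
  finitely many stacks.  The verifier consumes one certificate bit per program step, keeps the residual
  program in its finite control and the stacks on parallel tracks of its tape, so it always halts in
  quadratic time.  Hence it suffices to give such a program that has an accepting run of polynomial
  length exactly on the yes-instances.

  The program checks that the input is well formed, lists nonterminals that derive the empty word (each
  justified by a production whose right-hand side is already listed), and then simulates a leftmost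
  derivation: each step drops a listed nonterminal, expands a production, or crosses a letter off the
  set of letters still to be produced.  Only the multiset of letters matters for a pangram.  Dropping
  nullable nonterminals at once avoids the subtrees of exponential size that yield the empty word, and
  chains of expansions that keep the whole yield can be cut at repetitions, so polynomially many steps
  suffice.\<close>

text \<open>NP is defined by concrete one-tape machines, so the distance from grammars to transition
  tables is covered in layers: bit stacks, stacks of names (bit strings), and the program on names.
  In each layer soundness (\<open>den\<close>) admits every run and ignores time, whereas
  completeness (\<open>exec\<close>) exhibits one run with an upper bound on its cost. Loops may
  stop anywhere; a test placed after a loop discards the runs that stopped at the wrong place. A
  derivation as it stands is no certificate: with rules A_i -> A_(i+1) A_(i+1) and an empty rule for
  A_n, even the empty word has only exponentially long derivations from A_0. Once nullable symbols
  vanish in one step, a node with nonempty yield either hands all of it to one child or divides it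
  into shorter yields and letters. Division is paid for by the length of the word, which is
  \<open>s\<close>, and \<open>s\<close> is written in unary; between divisions a shortest path in a
  finite relation suffices.\<close>

declare bin.simps [simp del]

section \<open>Turing machines over finite state and symbol types\<close>

text \<open>The tape is a total function with a head position. Truncated subtraction lets a left
  move at position 0 stay put, as \<open>tm_step\<close> does when the left part is empty.\<close>

definition astep :: "('q \<Rightarrow> 'g \<Rightarrow> 'q \<times> 'g \<times> dir) \<Rightarrow> 'q set \<Rightarrow>
    'q \<times> nat \<times> (nat \<Rightarrow> 'g) \<Rightarrow> 'q \<times> nat \<times> (nat \<Rightarrow> 'g)" where
  "astep \<delta> H = (\<lambda>(q, p, t). if q \<in> H then (q, p, t) else
     (case \<delta> q (t p) of (q', b, d) \<Rightarrow>
       (q', (case d of Lt \<Rightarrow> p - 1 | Rt \<Rightarrow> p + 1 | Nt \<Rightarrow> p), t(p := b))))"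

definition nth_or_blank :: "nat list \<Rightarrow> nat \<Rightarrow> nat" where
  "nth_or_blank xs j = (if j < length xs then xs ! j else 0)"

lemma nth_or_blank_write:
  "nth_or_blank (us @ b # tl rs) = (nth_or_blank (us @ rs))(length us := b)"
proof
  fix j
  show "nth_or_blank (us @ b # tl rs) j = ((nth_or_blank (us @ rs))(length us := b)) j"
    by (cases rs; cases "j - length us")
       (auto simp: nth_or_blank_def nth_append nth_Cons split: nat.splits)
qed

lemma nth_or_blank_head:
  "nth_or_blank (us @ rs) (length us) = (case rs of [] \<Rightarrow> 0 | x # _ \<Rightarrow> x)"
  by (cases rs) (auto simp: nth_or_blank_def nth_append)

text \<open>States 0, 1, 2 and symbols 0 to 3 have fixed meanings in the machine model, so a
  numbering must be able to start with prescribed elements.\<close>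

lemma finite_enumeration_with_prefix:
  assumes "finite A" "set xs \<subseteq> A" "distinct xs"
  obtains ys where "set (xs @ ys) = A" "distinct (xs @ ys)"
proof -
  obtain ys where "set ys = A - set xs" "distinct ys"
    using finite_distinct_list[of "A - set xs"] assms(1) by auto
  then show thesis using assms that[of ys] by auto
qed

definition sim_config :: "(nat \<Rightarrow> 'q) \<Rightarrow> (nat \<Rightarrow> 'g) \<Rightarrow> nat \<Rightarrow> nat \<Rightarrow> config \<Rightarrow>
    'q \<times> nat \<times> (nat \<Rightarrow> 'g) \<Rightarrow> bool" where
  "sim_config dq dg n k = (\<lambda>(i, ls, rs) (q, p, t). i < n \<and> q = dq i \<and> p = length ls \<and>
     set ls \<subseteq> {..<k} \<and> set rs \<subseteq> {..<k} \<and> t = dg \<circ> nth_or_blank (rev ls @ rs))"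

text \<open>Transfers a machine over arbitrary finite sets to the numbered model. \<open>e\<close>
  picks the symbols that get the numbers 0 to 3: the blank, the two bit codes and the separator.
  List tapes and function tapes are compared through \<open>nth_or_blank\<close>, so cells beyond
  the list count as blank.\<close>

lemma in_P_abstract:
  fixes \<delta> :: "'q \<Rightarrow> 'g \<Rightarrow> 'q \<times> 'g \<times> dir"
  assumes fin: "finite Q" "finite G"
    and states: "{q0, qa, qr} \<subseteq> Q" "distinct [q0, qa, qr]"
    and raw: "e ` {..<4} \<subseteq> G" "inj_on e {..<4::nat}"
    and closed: "\<And>q a q' b d. q \<in> Q \<Longrightarrow> a \<in> G \<Longrightarrow> \<delta> q a = (q', b, d) \<Longrightarrow> q' \<in> Q \<and> b \<in> G"
    and dec: "\<And>x. set x \<subseteq> {1, 2, 3} \<Longrightarrow> \<exists>t \<le> c * length x ^ d + c.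
       fst ((astep \<delta> {qa, qr} ^^ t) (q0, 0, e \<circ> nth_or_blank x)) \<in> {qa, qr} \<and>
       (fst ((astep \<delta> {qa, qr} ^^ t) (q0, 0, e \<circ> nth_or_blank x)) = qa \<longleftrightarrow> x \<in> V)"
  shows "in_P V"
proof -
  obtain qs where qs: "set ([q0, qa, qr] @ qs) = Q" "distinct ([q0, qa, qr] @ qs)"
    using finite_enumeration_with_prefix[OF fin(1), of "[q0, qa, qr]"] states by auto
  define ql where "ql = [q0, qa, qr] @ qs"
  have four: "{..<4::nat} = set [0,1,2,3]" by auto
  have "distinct (map e [0,1,2,3])" 
    using raw(2) unfolding four by (subst distinct_map) simp
  moreover have "set (map e [0,1,2,3]) \<subseteq> G" using raw(1) unfolding four by simp
  ultimately obtain gs where gs: "set (map e [0,1,2,3] @ gs) = G" "distinct (map e [0,1,2,3] @ gs)"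
    using finite_enumeration_with_prefix[OF fin(2)] by blast
  define gl where "gl = map e [0,1,2,3] @ gs"
  have ql: "set ql = Q" "distinct ql" and gl: "set gl = G"
    using qs gs unfolding ql_def gl_def by blast+
  define n where "n = length ql"
  define k where "k = length gl"
  define dq where "dq = (\<lambda>i. ql ! i)"
  define dg where "dg = (\<lambda>i. gl ! i)"
  define fq where "fq = (\<lambda>q. SOME i. i < n \<and> dq i = q)"
  define fg where "fg = (\<lambda>g. SOME i. i < k \<and> dg i = g)"
  have fq: "fq q < n \<and> dq (fq q) = q" if "q \<in> Q" for q
    unfolding fq_def by (rule someI_ex)
      (use that in_set_conv_nth[of q ql] in \<open>auto simp: n_def dq_def ql\<close>)
  have fg: "fg g < k \<and> dg (fg g) = g" if "g \<in> G" for g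
    unfolding fg_def by (rule someI_ex)
      (use that in_set_conv_nth[of g gl] in \<open>auto simp: k_def dg_def gl\<close>)
  have dqQ: "dq i \<in> Q" if "i < n" for i
    using that nth_mem[of i ql] by (simp add: dq_def n_def ql)
  have dgG: "dg i \<in> G" if "i < k" for i
    using that nth_mem[of i gl] by (simp add: dg_def k_def gl)
  have inj: "dq i = dq j \<Longrightarrow> i < n \<Longrightarrow> j < n \<Longrightarrow> i = j" for i j
    using ql(2) by (simp add: dq_def n_def nth_eq_iff_index_eq)
  have n3: "3 \<le> n" and k4: "4 \<le> k" by (auto simp: n_def ql_def k_def gl_def)
  have dq012: "dq 0 = q0" "dq 1 = qa" "dq 2 = qr" by (auto simp: dq_def ql_def)
  have dge: "dg i = e i" if "i < 4" for i
  proof -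
    have "i \<in> set [0,1,2,3]" using that by auto
    then show ?thesis by (auto simp: dg_def gl_def)
  qed
  define M :: tm where
    "M = (n, k, \<lambda>i a. case \<delta> (dq i) (dg a) of (q, b, d) \<Rightarrow> (fq q, fg b, d))"
  have wf: "tm_wf M"
    unfolding tm_wf_def M_def using n3 k4 closed[OF dqQ dgG] fq fg by (auto split: prod.splits)
  have step: "sim_config dq dg n k (tm_step M C) (astep \<delta> {qa, qr} A)"
    if "sim_config dq dg n k C A" for C A
  proof -
    obtain i ls rs where C: "C = (i, ls, rs)" by (cases C) auto
    obtain q p t where "A = (q, p, t)" by (cases A) auto
    with that C have A: "A = (dq i, p, t)" and i: "i < n" and p: "p = length ls"
      and ls: "set ls \<subseteq> {..<k}" and rs: "set rs \<subseteq> {..<k}"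
      and t: "t = dg \<circ> nth_or_blank (rev ls @ rs)"
      by (simp_all add: sim_config_def)
    \<comment> \<open>The numbering is injective, so both machines freeze in the same
      configurations.\<close>
    have halt: "dq i \<in> {qa, qr} \<longleftrightarrow> i = 1 \<or> i = 2"
      using inj[OF _ i, of 1] inj[OF _ i, of 2] dq012 n3 by auto
    show ?thesis
    proof (cases "i = 1 \<or> i = 2")
      case True
      then show ?thesis using that halt unfolding C A by (simp add: tm_step_def astep_def M_def)
    next
      case False
      define a where "a = (case rs of [] \<Rightarrow> 0 | x # _ \<Rightarrow> x)"
      have a: "a < k" using rs k4 by (auto simp: a_def split: list.splits)
      have tp: "t p = dg a"
        using nth_or_blank_head[of "rev ls" rs] by (simp add: t p a_def)
      obtain q' b d where d: "\<delta> (dq i) (dg a) = (q', b, d)" by (cases "\<delta> (dq i) (dg a)") auto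
      have q'b: "q' \<in> Q" "b \<in> G" using closed[OF dqQ[OF i] dgG[OF a] d] by auto
      have t': "t(p := b) = dg \<circ> nth_or_blank (rev ls @ fg b # tl rs)"
        using nth_or_blank_write[of "rev ls" "fg b" rs] fg[OF q'b(2)] by (auto simp: t p)
      have tl: "set (tl rs) \<subseteq> {..<k}" using rs by (cases rs) auto
      show ?thesis
        using False halt fq[OF q'b(1)] fg[OF q'b(2)] ls tl t' d tp p
        unfolding C A tm_step_def astep_def M_def a_def[symmetric]
        by (cases d; cases ls) (auto simp: sim_config_def Let_def a_def[symmetric])
    qed
  qed
  have steps: "sim_config dq dg n k ((tm_step M ^^ t) C) ((astep \<delta> {qa, qr} ^^ t) A)"
    if "sim_config dq dg n k C A" for C A t
    by (induction t) (simp_all add: that step)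
  have init: "sim_config dq dg n k (0, [], x) (q0, 0, e \<circ> nth_or_blank x)" if "set x \<subseteq> {1, 2, 3}" for x
  proof -
    have "nth_or_blank x j \<in> {..<4}" for j
    proof (cases "j < length x")
      case True
      then have "x ! j \<in> {1, 2, 3}" using that by (meson nth_mem subsetD)
      then show ?thesis using True by (auto simp: nth_or_blank_def)
    qed (simp add: nth_or_blank_def)
    then have "dg \<circ> nth_or_blank x = e \<circ> nth_or_blank x" using dge by auto
    moreover have "set x \<subseteq> {..<k}" using that k4 by auto
    ultimately show ?thesis using n3 dq012 by (simp add: sim_config_def)
  qed
  have "decides_in_time M (\<lambda>n. c * n ^ d + c) V"
    unfolding decides_in_time_def
  proof (intro allI impI)
    fix x :: "nat list" assume x: "set x \<subseteq> {1, 2, 3}"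
    from dec[OF x] obtain t where t: "t \<le> c * length x ^ d + c" and
      acc: "fst ((astep \<delta> {qa, qr} ^^ t) (q0, 0, e \<circ> nth_or_blank x)) \<in> {qa, qr}"
       "fst ((astep \<delta> {qa, qr} ^^ t) (q0, 0, e \<circ> nth_or_blank x)) = qa \<longleftrightarrow> x \<in> V" by blast
    obtain i where i: "i = fst (tm_run M t x)" by simp
    have "i < n" "fst ((astep \<delta> {qa, qr} ^^ t) (q0, 0, e \<circ> nth_or_blank x)) = dq i"
      using steps[OF init[OF x], of t] unfolding i tm_run_def sim_config_def by (auto split: prod.splits)
    then have "i \<in> {1, 2} \<and> (i = 1 \<longleftrightarrow> x \<in> V)"
      using acc inj[of i 1] inj[of i 2] dq012 n3 states(2) by auto
    then show "\<exists>t\<le>c * length x ^ d + c. fst (tm_run M t x) \<in> {1, 2} \<and> (fst (tm_run M t x) = 1) = (x \<in> V)"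
      using t i by auto
  qed
  with wf show ?thesis unfolding in_P_def by blast
qed

section \<open>Nondeterministic regular programs\<close>

datatype 'a cmd = Skip | Act 'a | Seq "'a cmd" "'a cmd" | Alt "'a cmd" "'a cmd" | Star "'a cmd"

text \<open>Every step takes a bit, also where there is nothing to choose, so the certificate is as
  long as the run.\<close>

fun cmd_step :: "bool \<Rightarrow> 'a cmd \<Rightarrow> 'a option \<times> 'a cmd" where
  "cmd_step b Skip = (None, Skip)"
| "cmd_step b (Act a) = (Some a, Skip)"
| "cmd_step b (Seq c d) =
     (if c = Skip then (None, d) else (case cmd_step b c of (a, c') \<Rightarrow> (a, Seq c' d)))"
| "cmd_step b (Alt c d) = (None, if b then c else d)"
| "cmd_step b (Star c) = (None, if b then Seq c (Star c) else Skip)"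

text \<open>The analogue of Antimirov's partial derivatives of a regular expression: finitely many
  remainders, although \<open>Star\<close> can be unfolded again and again. They become control
  states of the verifier.\<close>

fun residuals :: "'a cmd \<Rightarrow> 'a cmd set" where
  "residuals Skip = {Skip}"
| "residuals (Act a) = {Act a, Skip}"
| "residuals (Seq c d) = (\<lambda>r. Seq r d) ` residuals c \<union> residuals d"
| "residuals (Alt c d) = {Alt c d} \<union> residuals c \<union> residuals d"
| "residuals (Star c) = {Star c, Skip} \<union> (\<lambda>r. Seq r (Star c)) ` residuals c"

lemma finite_residuals: "finite (residuals c)"
  by (induction c) auto

lemma residuals_self: "c \<in> residuals c"
  by (induction c) auto

lemma residuals_step: "d \<in> residuals c \<Longrightarrow> snd (cmd_step b d) \<in> residuals c"
proof (induction c arbitrary: d)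
  case (Seq c1 c2)
  then show ?case by (auto simp: residuals_self split: prod.split if_splits) (metis image_eqI snd_conv)
next
  case (Star c)
  then show ?case by (auto simp: residuals_self split: prod.split if_splits) (metis image_eqI snd_conv)+
qed (auto simp: residuals_self split: if_splits)

fun den :: "('a \<Rightarrow> 's \<Rightarrow> 's \<Rightarrow> bool) \<Rightarrow> 'a cmd \<Rightarrow> 's \<Rightarrow> 's \<Rightarrow> bool" where
  "den A Skip = (=)"
| "den A (Act a) = A a"
| "den A (Seq c d) = den A c OO den A d"
| "den A (Alt c d) = sup (den A c) (den A d)"
| "den A (Star c) = (den A c)\<^sup>*\<^sup>*"

text \<open>The number bounds the work from above.  It counts control steps, and the cost of actions as
  given by the semantics of the actions.\<close>

inductive exec :: "('a \<Rightarrow> 's \<Rightarrow> nat \<Rightarrow> 's \<Rightarrow> bool) \<Rightarrow> 'a cmd \<Rightarrow> 's \<Rightarrow> nat \<Rightarrow> 's \<Rightarrow> bool"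
  for A :: "'a \<Rightarrow> 's \<Rightarrow> nat \<Rightarrow> 's \<Rightarrow> bool" where
  exec_Skip: "exec A Skip s n s"
| exec_Act: "A a s m s' \<Longrightarrow> m \<le> n \<Longrightarrow> exec A (Act a) s n s'"
| exec_Seq: "exec A c s m s' \<Longrightarrow> exec A d s' n s'' \<Longrightarrow> m + n + 1 \<le> k \<Longrightarrow> exec A (Seq c d) s k s''"
| exec_Alt1: "exec A c s n s' \<Longrightarrow> n + 1 \<le> k \<Longrightarrow> exec A (Alt c d) s k s'"
| exec_Alt2: "exec A d s n s' \<Longrightarrow> n + 1 \<le> k \<Longrightarrow> exec A (Alt c d) s k s'"
| exec_Star0: "1 \<le> k \<Longrightarrow> exec A (Star c) s k s"
| exec_Star1: "exec A c s m s' \<Longrightarrow> exec A (Star c) s' n s'' \<Longrightarrow> m + n + 2 \<le> k \<Longrightarrow> exec A (Star c) s k s''"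

lemma exec_mono: "exec A c s n s' \<Longrightarrow> n \<le> m \<Longrightarrow> exec A c s m s'"
  by (cases rule: exec.cases, assumption) (auto intro: exec.intros)

fun opt_act :: "('a \<Rightarrow> 's \<Rightarrow> 's \<Rightarrow> bool) \<Rightarrow> 'a option \<Rightarrow> 's \<Rightarrow> 's \<Rightarrow> bool" where
  "opt_act A None = (=)"
| "opt_act A (Some a) = A a"

definition small :: "('a \<Rightarrow> 's \<Rightarrow> 's \<Rightarrow> bool) \<Rightarrow> 'a cmd \<times> 's \<Rightarrow> 'a cmd \<times> 's \<Rightarrow> bool" where
  "small A = (\<lambda>(c, s) (c', s'). \<exists>b a. cmd_step b c = (a, c') \<and> opt_act A a s s')"

lemma small_den: "cmd_step b c = (a, c') \<Longrightarrow> opt_act A a s s' \<Longrightarrow> den A c' s' s'' \<Longrightarrow> den A c s s''"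
proof (induction c arbitrary: a c' s s' s'')
  case (Seq c1 c2)
  then show ?case by (fastforce split: if_splits prod.splits)
next
  case (Star c)
  then show ?case by (auto split: if_splits)
qed (auto split: if_splits)

text \<open>The count may drop because idle steps from \<open>Skip\<close> to \<open>Skip\<close>
  have no counterpart: \<open>Seq Skip d\<close> moves on to \<open>d\<close>.\<close>

lemma smalls_Seq:
  assumes "(small A ^^ n) (c, s) (c', s')" "Skip \<noteq> c \<or> True"
  shows "\<exists>m\<le>n. (small A ^^ m) (Seq c d, s) (Seq c' d, s')"
  using assms
proof (induction n arbitrary: c s)
  case 0
  then show ?case by auto
next
  case (Suc n)
  then obtain c1 s1 where 1: "small A (c, s) (c1, s1)" and "(small A ^^ n) (c1, s1) (c', s')"
    by (metis relpowp_Suc_E2 surj_pair)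
  with Suc.IH obtain m where m: "m \<le> n" "(small A ^^ m) (Seq c1 d, s1) (Seq c' d, s')" by blast
  show ?case
  proof (cases "c = Skip")
    case True
    with 1 have "c1 = Skip" "s1 = s" by (auto simp: small_def)
    with m True show ?thesis using le_SucI by blast
  next
    case False
    from 1 obtain b a where "cmd_step b c = (a, c1)" "opt_act A a s s1"
      by (auto simp: small_def)
    then have "cmd_step b (Seq c d) = (a, Seq c1 d) \<and> opt_act A a s s1" using False by simp
    then have "small A (Seq c d, s) (Seq c1 d, s1)" unfolding small_def by blast
    with m show ?thesis by (meson Suc_le_mono relpowp_Suc_I2)
  qed
qed

lemma small_simps:
  "small A (Act a, s) (Skip, s') \<longleftrightarrow> A a s s'"
  "small A (Seq Skip d, s) (d, s)"
  "small A (Alt c d, s) (c, s)"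
  "small A (Alt c d, s) (d, s)"
  "small A (Star c, s) (Skip, s)"
  "small A (Star c, s) (Seq c (Star c), s)"
  unfolding small_def by (auto intro: exI[of _ True] exI[of _ False])

lemma smalls_Seq_Skip:
  assumes "(small A ^^ n) (c, s) (Skip, s')" "(small A ^^ m) (d, s') e"
  shows "\<exists>k\<le>n + m + 1. (small A ^^ k) (Seq c d, s) e"
proof -
  obtain n' where n': "n' \<le> n" "(small A ^^ n') (Seq c d, s) (Seq Skip d, s')"
    using smalls_Seq[OF assms(1)] by blast
  have "(small A ^^ (n' + Suc m)) (Seq c d, s) e"
    using n'(2) relpowp_Suc_I2[OF small_simps(2) assms(2)] unfolding relpowp_add by (rule relcomppI)
  then show ?thesis using n'(1) by (intro exI[of _ "n' + Suc m"]) simp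
qed

text \<open>The control costs in \<open>exec\<close> are step counts: 1 for leaving the finished
  first part of a \<open>Seq\<close>, 1 for the choice in an \<open>Alt\<close>, 2 for a round of
  \<open>Star\<close> (unfolding it and leaving the body).\<close>

lemma exec_smalls:
  assumes "exec A c s n s'" and A: "\<And>a s m s'. A a s m s' \<Longrightarrow> 1 \<le> m \<and> B a s s'"
  shows "\<exists>m\<le>n. (small B ^^ m) (c, s) (Skip, s')"
  using assms(1)
proof (induction rule: exec.induct)
  case (exec_Skip s n)
  then show ?case by (auto intro: exI[of _ 0])
next
  case (exec_Act a s m s' n)
  with A[OF exec_Act(1)] show ?case by (intro exI[of _ 1]) (auto simp: small_simps OO_def)
next
  case (exec_Seq c s m s' d n s'' k)
  then obtain m' n' where le: "m' \<le> m" "n' \<le> n"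
    and "(small B ^^ m') (c, s) (Skip, s')" "(small B ^^ n') (d, s') (Skip, s'')"
    by blast
  from smalls_Seq_Skip[OF this(3,4)] obtain l where
    "l \<le> m' + n' + 1" "(small B ^^ l) (Seq c d, s) (Skip, s'')" by blast
  then show ?case using le exec_Seq.hyps by (intro exI[of _ l]) simp
next
  case (exec_Alt1 c s n s' k d)
  then obtain m where "m \<le> n" "(small B ^^ m) (c, s) (Skip, s')" by blast
  then show ?case using exec_Alt1.hyps relpowp_Suc_I2[of "small B", OF small_simps(3)[of B]] by (intro exI[of _ "Suc m"]) simp
next
  case (exec_Alt2 d s n s' k c)
  then obtain m where "m \<le> n" "(small B ^^ m) (d, s) (Skip, s')" by blast
  then show ?case using exec_Alt2.hyps relpowp_Suc_I2[of "small B", OF small_simps(4)[of B]] by (intro exI[of _ "Suc m"]) simp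
next
  case (exec_Star0 k c s)
  then show ?case by (intro exI[of _ 1]) (auto simp: small_simps OO_def)
next
  case (exec_Star1 c s m s' n s'' k)
  then obtain m' n' where le: "m' \<le> m" "n' \<le> n"
    and "(small B ^^ m') (c, s) (Skip, s')" "(small B ^^ n') (Star c, s') (Skip, s'')"
    by blast
  from smalls_Seq_Skip[OF this(3,4)] obtain l where
    l: "l \<le> m' + n' + 1" "(small B ^^ l) (Seq c (Star c), s) (Skip, s'')" by blast
  from relpowp_Suc_I2[OF small_simps(6) l(2)] show ?case
    using l(1) le exec_Star1.hyps by (intro exI[of _ "Suc l"]) simp
qed

lemma smalls_den: "(small A ^^ n) (c, s) (Skip, s') \<Longrightarrow> den A c s s'"
proof (induction n arbitrary: c s)
  case (Suc n)
  then obtain c1 s1 where "small A (c, s) (c1, s1)" "(small A ^^ n) (c1, s1) (Skip, s')"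
    by (metis relpowp_Suc_E2 surj_pair)
  with Suc.IH[OF this(2)] show ?case by (auto simp: small_def intro: small_den)
qed auto

section \<open>Stack actions and runs driven by a certificate\<close>

datatype ('k, 'x) act = Push 'k 'x | Pop 'k 'x | Empty 'k

fun app :: "('k, 'x) act \<Rightarrow> ('k \<Rightarrow> 'x list) \<Rightarrow> ('k \<Rightarrow> 'x list) \<Rightarrow> bool" where
  "app (Push k x) s s' \<longleftrightarrow> s' = s(k := x # s k)"
| "app (Pop k x) s s' \<longleftrightarrow> (\<exists>r. s k = x # r \<and> s' = s(k := r))"
| "app (Empty k) s s' \<longleftrightarrow> s k = [] \<and> s' = s"

text \<open>The word consists of tape symbols and not of bits, so that a second separator 3 is
  possible; it makes the run fail.\<close>

fun run :: "('k, 'x) act cmd \<Rightarrow> ('k \<Rightarrow> 'x list) \<Rightarrow> nat list \<Rightarrow> bool" where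
  "run c s [] \<longleftrightarrow> c = Skip"
| "run c s (i # w) \<longleftrightarrow> i \<in> {1, 2} \<and> (case cmd_step (i = 2) c of (a, c') \<Rightarrow>
     \<exists>s'. opt_act app a s s' \<and> run c' s' w)"

lemma run_imp_smalls: "run c s w \<Longrightarrow> \<exists>s'. (small app ^^ length w) (c, s) (Skip, s')"
proof (induction w arbitrary: c s)
  case (Cons i w)
  then obtain a c' s1 s' where "cmd_step (i = 2) c = (a, c')" "opt_act app a s s1"
    "(small app ^^ length w) (c', s1) (Skip, s')" by (force split: prod.splits)
  then show ?case unfolding length_Cons
    by (intro exI[of _ s'] relpowp_Suc_I2[of _ _ "(c', s1)"]) (auto simp: small_def)
qed auto

lemma smalls_imp_run:
  "(small app ^^ n) (c, s) (Skip, s') \<Longrightarrow> \<exists>y. length y = n \<and> run c s (map bit_code y)"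
proof (induction n arbitrary: c s)
  case (Suc n)
  then obtain c1 s1 where 1: "small app (c, s) (c1, s1)" "(small app ^^ n) (c1, s1) (Skip, s')"
    by (metis relpowp_Suc_E2 surj_pair)
  from 1(1) obtain b a where "cmd_step b c = (a, c1)" "opt_act app a s s1" by (auto simp: small_def)
  moreover from Suc.IH[OF 1(2)] obtain y where "length y = n" "run c1 s1 (map bit_code y)" by blast
  moreover have "bit_code b \<in> {1, 2}" "(bit_code b = 2) = b" by (simp_all add: bit_code_def)
  ultimately show ?case by (intro exI[of _ "b # y"]) auto
qed auto

section \<open>Running stack programs on a Turing machine\<close>

text \<open>A cell holds a mark for the left end, the tape symbol (4 once it has been consumed) and
  one entry per stack. The bottoms of all stacks lie at the left end.\<close>

type_synonym ('k, 'x) cell = "bool \<times> nat \<times> ('k \<Rightarrow> 'x option)"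

text \<open>A round consists of \<open>Fetch\<close> (right to the next certificate symbol),
  \<open>Return\<close> (left to the mark) and \<open>Do\<close> (right along a track, then act).
  \<open>Take\<close> completes a pop.\<close>

datatype ('k, 'x) mstate = Start | Load | Acc | Rej
  | Fetch "('k, 'x) act cmd"
  | Return "('k, 'x) act option" "('k, 'x) act cmd"
  | Do "('k, 'x) act option" "('k, 'x) act cmd"
  | Take 'k 'x "('k, 'x) act cmd"

text \<open>The input becomes a stack in place: the bit in cell j is entry j of the track, so the
  last bit is on top.\<close>

definition load :: "'k \<Rightarrow> (bool \<Rightarrow> 'x) \<Rightarrow> ('k, 'x) act cmd \<Rightarrow> bool \<Rightarrow> nat \<Rightarrow> ('k \<Rightarrow> 'x option) \<Rightarrow>
    ('k, 'x) mstate \<times> ('k, 'x) cell \<times> dir" where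
  "load k0 em c0 h i f =
     (if i \<in> {1, 2} then (Load, (h, 4, f(k0 := Some (em (i = 2)))), Rt)
      else if i = 3 then (Return None c0, (h, 4, f), Nt)
      else (Rej, (h, i, f), Nt))"

text \<open>A pop looks for the first free entry of its track; the top lies one cell to the left. A
  free entry at the mark means that the stack is empty.\<close>

fun do_act :: "('k, 'x) act option \<Rightarrow> ('k, 'x) act cmd \<Rightarrow> bool \<Rightarrow> nat \<Rightarrow> ('k \<Rightarrow> 'x option) \<Rightarrow>
    ('k, 'x) mstate \<times> ('k, 'x) cell \<times> dir" where
  "do_act None c h i f = (Fetch c, (h, i, f), Nt)"
| "do_act (Some (Empty k)) c h i f = (if f k = None then Fetch c else Rej, (h, i, f), Nt)"
| "do_act (Some (Push k x)) c h i f =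
     (if f k = None then (Return None c, (h, i, f(k := Some x)), Nt)
      else (Do (Some (Push k x)) c, (h, i, f), Rt))"
| "do_act (Some (Pop k x)) c h i f =
     (if f k \<noteq> None then (Do (Some (Pop k x)) c, (h, i, f), Rt)
      else if h then (Rej, (h, i, f), Nt) else (Take k x c, (h, i, f), Lt))"

fun mdelta :: "'k \<Rightarrow> (bool \<Rightarrow> 'x) \<Rightarrow> ('k, 'x) act cmd \<Rightarrow> ('k, 'x) mstate \<Rightarrow> ('k, 'x) cell \<Rightarrow>
    ('k, 'x) mstate \<times> ('k, 'x) cell \<times> dir" where
  "mdelta k0 em c0 Start (h, i, f) = load k0 em c0 True i f"
| "mdelta k0 em c0 Load (h, i, f) = load k0 em c0 h i f"
| "mdelta k0 em c0 (Fetch c) (h, i, f) =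
     (if i = 4 then (Fetch c, (h, i, f), Rt)
      else if i \<in> {1, 2} then (case cmd_step (i = 2) c of (a, c') \<Rightarrow> (Return a c', (h, 4, f), Nt))
      else (if i = 0 \<and> c = Skip then Acc else Rej, (h, i, f), Nt))"
| "mdelta k0 em c0 (Return a c) (h, i, f) =
     (if h then (Do a c, (h, i, f), Nt) else (Return a c, (h, i, f), Lt))"
| "mdelta k0 em c0 (Do a c) (h, i, f) = do_act a c h i f"
| "mdelta k0 em c0 (Take k x c) (h, i, f) =
     (if f k = Some x then (Return None c, (h, i, f(k := None)), Nt) else (Rej, (h, i, f), Nt))"
| "mdelta k0 em c0 q (h, i, f) = (q, (h, i, f), Nt)"

text \<open>The type \<open>mstate\<close> is infinite because of the programs that it carries; the
  states built from residuals and actions of \<open>c0\<close> are finitely many and closed under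
  \<open>mdelta\<close>.\<close>

definition mstates :: "('k, 'x) act cmd \<Rightarrow> ('k, 'x) mstate set" where
  "mstates c0 = {q. case q of Fetch c \<Rightarrow> c \<in> residuals c0 | Take k x c \<Rightarrow> c \<in> residuals c0
     | Return a c \<Rightarrow> c \<in> residuals c0 \<and> a \<in> insert None (Some ` set_cmd c0)
     | Do a c \<Rightarrow> c \<in> residuals c0 \<and> a \<in> insert None (Some ` set_cmd c0) | _ \<Rightarrow> True}"

lemma cmd_step_act: "fst (cmd_step b d) \<in> insert None (Some ` set_cmd d)"
  by (induction d) (auto split: prod.splits)

lemma residuals_set_cmd: "d \<in> residuals c \<Longrightarrow> set_cmd d \<subseteq> set_cmd c"
  by (induction c arbitrary: d) fastforce+

lemma finite_set_cmd: "finite (set_cmd c)"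
  by (induction c) auto

lemma finite_mstates:
  "finite (mstates (c0 :: ('k::finite, 'x::finite) act cmd))"
proof (rule finite_subset)
  let ?C = "residuals c0" and ?A = "insert None (Some ` set_cmd c0)"
  show "mstates c0 \<subseteq> {Start, Load, Acc, Rej} \<union> Fetch ` ?C \<union> case_prod Return ` (?A \<times> ?C)
    \<union> case_prod Do ` (?A \<times> ?C) \<union> (\<lambda>(k, x, c). Take k x c) ` (UNIV \<times> UNIV \<times> ?C)"
  proof
    fix q assume "q \<in> mstates c0"
    then show "q \<in> {Start, Load, Acc, Rej} \<union> Fetch ` ?C \<union> case_prod Return ` (?A \<times> ?C)
      \<union> case_prod Do ` (?A \<times> ?C) \<union> (\<lambda>(k, x, c). Take k x c) ` (UNIV \<times> UNIV \<times> ?C)"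
      by (cases q) (force simp: mstates_def image_iff)+
  qed
qed (auto simp: finite_residuals finite_set_cmd)

lemma mdelta_closed:
  assumes "q \<in> mstates c0" "g \<in> UNIV \<times> {..<5} \<times> UNIV" "mdelta k0 em c0 q g = (q', g', d)"
  shows "q' \<in> mstates c0 \<and> g' \<in> UNIV \<times> {..<5} \<times> UNIV"
proof -
  obtain h i f where g: "g = (h, i, f)" by (cases g) auto
  show ?thesis
  proof (cases q)
    case (Do a c)
    then show ?thesis using assms unfolding g
      by (cases "(a, c, h, i, f)" rule: do_act.cases) (auto simp: mstates_def split: if_splits)
  next
    case (Fetch c)
    then have "c \<in> residuals c0" using assms(1) by (simp add: mstates_def)
    then show ?thesis
      using cmd_step_act[of "i = 2" c] residuals_set_cmd[of c c0] residuals_step[of c c0 "i = 2"] assms Fetch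
      unfolding g by (cases "cmd_step (i = 2) c") (auto simp: mstates_def split: if_splits)
  qed (use assms g in \<open>auto simp: mstates_def load_def residuals_self split: if_splits\<close>)
qed

section \<open>Timed reachability and the correctness of one round\<close>

definition reaches :: "('c \<Rightarrow> 'c) \<Rightarrow> nat \<Rightarrow> 'c \<Rightarrow> 'c \<Rightarrow> bool" where
  "reaches f t C D \<longleftrightarrow> (\<exists>n\<le>t. (f ^^ n) C = D)"

lemma reaches_trans: "reaches f a C D \<Longrightarrow> reaches f b D E \<Longrightarrow> reaches f (a + b) C E"
  unfolding reaches_def by (metis (no_types, lifting) add.commute add_mono comp_apply funpow_add)

lemma reaches_mono: "reaches f a C D \<Longrightarrow> a \<le> b \<Longrightarrow> reaches f b C D"
  unfolding reaches_def using le_trans by blast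

lemma reaches_step: "f C = D \<Longrightarrow> reaches f 1 C D"
  unfolding reaches_def by (intro exI[of _ 1]) auto

lemma reaches_refl: "reaches f t C C"
  unfolding reaches_def by (intro exI[of _ 0]) auto

context
  fixes k0 :: 'k and em :: "bool \<Rightarrow> 'x" and c0 :: "('k, 'x) act cmd"
begin

abbreviation ms where "ms \<equiv> astep (mdelta k0 em c0) {Acc, Rej}"

lemma scan_right:
  assumes "q \<notin> {Acc, Rej}" "\<And>j. p \<le> j \<Longrightarrow> j < p + n \<Longrightarrow> mdelta k0 em c0 q (t j) = (q, t j, Rt)"
  shows "reaches ms n (q, p, t) (q, p + n, t)"
  using assms(2)
proof (induction n)
  case 0
  then show ?case by (simp add: reaches_refl)
next
  case (Suc n)
  have "reaches ms 1 (q, p + n, t) (q, p + Suc n, t)"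
    using Suc.prems[of "p + n"] assms(1) by (intro reaches_step) (simp add: astep_def)
  with Suc show ?case using reaches_trans[of ms n _ _ 1] by simp
qed

lemma scan_left:
  assumes "q \<notin> {Acc, Rej}" "\<And>j. 0 < j \<Longrightarrow> mdelta k0 em c0 q (t j) = (q, t j, Lt)"
  shows "reaches ms p (q, p, t) (q, 0, t)"
proof (induction p)
  case 0
  then show ?case by (simp add: reaches_refl)
next
  case (Suc p)
  have "reaches ms 1 (q, Suc p, t) (q, p, t)"
    using assms(2)[of "Suc p"] assms(1) by (intro reaches_step) (simp add: astep_def)
  with Suc show ?case using reaches_trans[of ms 1 _ _ p] by simp
qed

definition track :: "'x list \<Rightarrow> nat \<Rightarrow> 'x option" where
  "track s j = (if j < length s then Some (rev s ! j) else None)"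

lemma track_Cons: "track (x # s) = (track s)(length s := Some x)"
  by (auto simp: track_def fun_eq_iff nth_append)

text \<open>After loading, \<open>m\<close> counts the consumed symbols of the whole word
  \<open>w\<close>, that is, of the input, the separator and the certificate.\<close>

definition tape :: "('k \<Rightarrow> 'x list) \<Rightarrow> nat list \<Rightarrow> nat \<Rightarrow> nat \<Rightarrow> ('k, 'x) cell" where
  "tape s w m = (\<lambda>j. (j = 0, if j < m then 4 else nth_or_blank w j, \<lambda>k. track (s k) j))"

lemma tape_push:
  "(tape s w m)(length (s k) := (length (s k) = 0, if length (s k) < m then 4 else nth_or_blank w (length (s k)),
     (\<lambda>k'. track (s k') (length (s k)))(k := Some x))) = tape (s(k := x # s k)) w m"
  by (auto simp: tape_def fun_eq_iff track_Cons)

lemma tape_pop: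
  assumes "s k = x # r"
  shows "(tape s w m)(length r := (length r = 0, if length r < m then 4 else nth_or_blank w (length r),
     (\<lambda>k'. track (s k') (length r))(k := None))) = tape (s(k := r)) w m"
  using assms by (auto simp: tape_def fun_eq_iff track_Cons track_def nth_append)

lemma return_home: "reaches ms (p + 1) (Return a c, p, tape s w m) (Do a c, 0, tape s w m)"
proof (rule reaches_trans)
  show "reaches ms p (Return a c, p, tape s w m) (Return a c, 0, tape s w m)"
    by (rule scan_left) (auto simp: tape_def)
  show "reaches ms 1 (Return a c, 0, tape s w m) (Do a c, 0, tape s w m)"
    by (rule reaches_step) (simp add: astep_def tape_def fun_eq_iff)
qed

lemma do_None: "reaches ms 1 (Do None c, 0, tape s w m) (Fetch c, 0, tape s w m)"
  by (rule reaches_step) (simp add: astep_def tape_def fun_eq_iff)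

lemma return_fetch: "reaches ms (p + 2) (Return None c, p, tape s w m) (Fetch c, 0, tape s w m)"
  using reaches_trans[OF return_home do_None] by simp

lemma do_scan:
  assumes "a = Push k x \<or> a = Pop k x"
  shows "reaches ms (length (s k)) (Do (Some a) c, 0, tape s w m) (Do (Some a) c, length (s k), tape s w m)"
  using scan_right[of "Do (Some a) c" 0 "length (s k)" "tape s w m"] assms
  by (auto simp: tape_def track_def)

text \<open>The head travels at most \<open>m\<close> cells out to the top of a stack and as many
  back; the 4 covers the action itself and the change of state at the mark.\<close>

lemma do_act_correct:
  assumes "\<And>k. length (s k) \<le> m"
  shows "(\<exists>s'. opt_act app a s s' \<and> reaches ms (2 * m + 4) (Do a c, 0, tape s w m) (Fetch c, 0, tape s' w m))
    \<or> ((\<nexists>s'. opt_act app a s s') \<and> (\<exists>C. reaches ms (2 * m + 4) (Do a c, 0, tape s w m) (Rej, C)))"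
proof (cases a)
  case None
  then show ?thesis using reaches_mono[OF do_None, of "2 * m + 4"] by auto
next
  case (Some b)
  show ?thesis
  proof (cases b)
    case (Empty k)
    have "reaches ms 1 (Do a c, 0, tape s w m) (if s k = [] then Fetch c else Rej, 0, tape s w m)"
      by (rule reaches_step) (auto simp: astep_def tape_def fun_eq_iff Some Empty track_def)
    from reaches_mono[OF this, of "2 * m + 4"] show ?thesis by (auto simp: Some Empty split: if_splits)
  next
    case (Push k x)
    let ?l = "length (s k)"
    have "reaches ms 1 (Do a c, ?l, tape s w m) (Return None c, ?l, tape (s(k := x # s k)) w m)"
      by (rule reaches_step, subst tape_push[symmetric])
        (simp add: astep_def Some Push track_def tape_def[of s])
    from reaches_trans[OF reaches_trans[OF do_scan this[unfolded Some]] return_fetch]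
    have "reaches ms (?l + 1 + (?l + 2)) (Do a c, 0, tape s w m) (Fetch c, 0, tape (s(k := x # s k)) w m)"
      using Push Some by blast
    from reaches_mono[OF this, of "2 * m + 4"] show ?thesis
      using assms[of k] by (auto simp: Some Push)
  next
    case (Pop k x)
    let ?l = "length (s k)"
    have scan: "reaches ms ?l (Do a c, 0, tape s w m) (Do a c, ?l, tape s w m)"
      using do_scan[of b k x s c w m] Pop Some by blast
    show ?thesis
    proof (cases "s k")
      case Nil
      have "reaches ms 1 (Do a c, ?l, tape s w m) (Rej, ?l, tape s w m)"
        by (rule reaches_step) (auto simp: astep_def tape_def fun_eq_iff Some Pop track_def Nil)
      from reaches_mono[OF reaches_trans[OF scan this], of "2 * m + 4"] assms[of k]
      show ?thesis using Nil by (auto simp: Some Pop)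
    next
      case (Cons y r)
      have 1: "reaches ms 1 (Do a c, ?l, tape s w m) (Take k x c, length r, tape s w m)"
        by (rule reaches_step) (auto simp: astep_def tape_def fun_eq_iff Some Pop track_def Cons)
      show ?thesis
      proof (cases "x = y")
        case True
        have "reaches ms 1 (Take k x c, length r, tape s w m) (Return None c, length r, tape (s(k := r)) w m)"
          by (rule reaches_step, subst tape_pop[symmetric, of s k x])
            (auto simp: astep_def tape_def[of s] Cons True track_def nth_append)
        from reaches_trans[OF reaches_trans[OF reaches_trans[OF scan 1] this] return_fetch]
        have "reaches ms (2 * m + 4) (Do a c, 0, tape s w m) (Fetch c, 0, tape (s(k := r)) w m)"
          by (rule reaches_mono) (use assms[of k] Cons in auto)
        then show ?thesis using Cons True by (auto simp: Some Pop)
      next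
        case False
        have "reaches ms 1 (Take k x c, length r, tape s w m) (Rej, length r, tape s w m)"
          by (rule reaches_step)
            (use False in \<open>auto simp: astep_def tape_def Cons track_def nth_append fun_eq_iff\<close>)
        from reaches_trans[OF reaches_trans[OF scan 1] this]
        have "reaches ms (2 * m + 4) (Do a c, 0, tape s w m) (Rej, length r, tape s w m)"
          by (rule reaches_mono) (use assms[of k] Cons in auto)
        then show ?thesis using Cons False by (auto simp: Some Pop)
      qed
    qed
  qed
qed

text \<open>A step consumes one symbol and pushes at most one entry, which preserves the invariant
  that no stack is longer than the consumed part of the word.\<close>

lemma app_length:
  assumes "opt_act app a s s'" and m: "\<And>k. length (s k) \<le> m"
  shows "length (s' k) \<le> Suc m"
proof (cases a)
  case None
  then show ?thesis using assms(1) m[of k] by simp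
next
  case (Some b)
  have "length r \<le> Suc m" if "s k' = x # r" for k' x r using m[of k'] that by simp
  then show ?thesis using assms(1) Some m by (cases b) (auto simp: le_SucI)
qed

lemma fetch_scan: "reaches ms m (Fetch c, 0, tape s w m) (Fetch c, m, tape s w m)"
  using scan_right[of "Fetch c" 0 m "tape s w m"] by (auto simp: tape_def)

text \<open>Since stacks never outgrow the consumed part, each round takes linear time. There is one
  round for every remaining symbol and a last one that finds the end of the word.\<close>

lemma run_correct:
  assumes "\<And>k. length (s k) \<le> m" "m \<le> length w" "set w \<subseteq> {1, 2, 3}"
  shows "\<exists>C. reaches ms ((4 * length w + 10) * (length w + 1 - m)) (Fetch c, 0, tape s w m)
     (if run c s (drop m w) then Acc else Rej, C)"
  using assms
proof (induction "length w - m" arbitrary: m s c)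
  case 0
  then have m: "m = length w" by simp
  have "reaches ms 1 (Fetch c, m, tape s w m) (if c = Skip then Acc else Rej, m, tape s w m)"
    by (rule reaches_step) (auto simp: astep_def tape_def fun_eq_iff m nth_or_blank_def)
  from reaches_mono[OF reaches_trans[OF fetch_scan this], of "4 * length w + 10"]
  show ?case by (cases "c = Skip") (auto simp: m)
next
  case (Suc n)
  then have m: "m < length w" by linarith
  define i where "i = w ! m"
  have d: "drop m w = i # drop (Suc m) w" unfolding i_def using m by (simp add: Cons_nth_drop_Suc)
  have "i \<in> set w" unfolding i_def using m by simp
  with Suc.prems(3) have i: "i \<in> {1, 2, 3}" by blast
  show ?case
  proof (cases "i = 3")
    case True
    have "reaches ms 1 (Fetch c, m, tape s w m) (Rej, m, tape s w m)"
      by (rule reaches_step) (use True m in \<open>auto simp: astep_def tape_def fun_eq_iff nth_or_blank_def i_def\<close>)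
    from reaches_trans[OF fetch_scan this]
    have "reaches ms ((4 * length w + 10) * (length w + 1 - m)) (Fetch c, 0, tape s w m) (Rej, m, tape s w m)"
      by (rule reaches_mono) (use m in \<open>simp add: Suc_diff_le\<close>)
    then show ?thesis by (auto simp: d True)
  next
    case False
    obtain a c' where ac: "cmd_step (i = 2) c = (a, c')" by fastforce
    have t: "(tape s w m)(m := (m = 0, 4, \<lambda>k. track (s k) m)) = tape s w (Suc m)"
      by (auto simp: tape_def fun_eq_iff)
    have 1: "reaches ms 1 (Fetch c, m, tape s w m) (Return a c', m, tape s w (Suc m))"
      by (rule reaches_step, subst t[symmetric])
        (use False i m ac in \<open>auto simp: astep_def tape_def[of s w m] nth_or_blank_def i_def[symmetric]\<close>)
    note ret = reaches_trans[OF reaches_trans[OF fetch_scan 1] return_home]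
    have le: "length (s k) \<le> Suc m" for k using Suc.prems(1)[of k] by simp
    have T: "(4 * length w + 10) * (length w + 1 - m) = 4 * length w + 10 + (4 * length w + 10) * (length w + 1 - Suc m)"
      using m by (simp add: Suc_diff_le)
    \<comment> \<open>One round: out to cell \<open>m\<close>, one step there, back to the mark,
      then an action with stacks of length at most \<open>Suc m\<close>.\<close>
    have T1: "m + 1 + (m + 1) + (2 * Suc m + 4) \<le> 4 * length w + 10" using m by simp
    consider s' where "opt_act app a s s'"
        "reaches ms (2 * Suc m + 4) (Do a c', 0, tape s w (Suc m)) (Fetch c', 0, tape s' w (Suc m))"
      | C where "\<nexists>s'. opt_act app a s s'"
        "reaches ms (2 * Suc m + 4) (Do a c', 0, tape s w (Suc m)) (Rej, C)"
      using do_act_correct[of s "Suc m" a c' w, OF le] by blast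
    then show ?thesis
    proof cases
      case 1
      have l: "length (s' k) \<le> Suc m" for k using app_length[OF 1(1) Suc.prems(1)] .
      \<comment> \<open>Actions are partial functions, so the successor that the machine computed is
        the only one with which \<open>run\<close> can continue.\<close>
      have uniq: "s'' = s'" if "opt_act app a s s''" for s''
        using that 1(1) by (cases a; cases "the a") auto
      have "\<exists>C. reaches ms ((4 * length w + 10) * (length w + 1 - Suc m)) (Fetch c', 0, tape s' w (Suc m))
          (if run c' s' (drop (Suc m) w) then Acc else Rej, C)"
        by (rule Suc.hyps(1)) (use Suc.hyps(2) l m Suc.prems(3) in auto)
      then obtain C where C: "reaches ms ((4 * length w + 10) * (length w + 1 - Suc m)) (Fetch c', 0, tape s' w (Suc m))
          (if run c' s' (drop (Suc m) w) then Acc else Rej, C)" by blast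
      have "run c s (drop m w) = run c' s' (drop (Suc m) w)"
      proof -
        have "run c s (drop m w) \<longleftrightarrow> (\<exists>s''. opt_act app a s s'' \<and> run c' s'' (drop (Suc m) w))"
          using ac False i unfolding d by auto
        then show ?thesis using uniq 1(1) by blast
      qed
      with reaches_trans[OF reaches_mono[OF reaches_trans[OF ret 1(2)] T1] C] T
      show ?thesis by (intro exI[of _ C]) simp
    next
      case 2
      have "\<not> run c s (drop m w)" using 2(1) ac unfolding d by auto
      moreover have "reaches ms ((4 * length w + 10) * (length w + 1 - m)) (Fetch c, 0, tape s w m) (Rej, C)"
        by (rule reaches_mono[OF reaches_trans[OF ret 2(2)]]) (use T T1 in linarith)
      ultimately show ?thesis by (intro exI[of _ C]) simp
    qed
  qed
qed

section \<open>Loading the input, and the accepted language\<close>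

definition init_stacks :: "bool list \<Rightarrow> 'k \<Rightarrow> 'x list" where
  "init_stacks u = (\<lambda>_. [])(k0 := rev (map em u))"

definition raw_cell :: "nat \<Rightarrow> ('k, 'x) cell" where
  "raw_cell i = (False, i, \<lambda>_. None)"

definition raw_tape :: "nat list \<Rightarrow> nat \<Rightarrow> ('k, 'x) cell" where
  "raw_tape w = raw_cell \<circ> nth_or_blank w"

lemma init_stacks_snoc: "(\<lambda>k. track (init_stacks (u @ [b]) k) j) =
  (if j = length u then (\<lambda>k. track (init_stacks u k) j)(k0 := Some (em b)) else (\<lambda>k. track (init_stacks u k) j))"
  by (auto simp: init_stacks_def fun_eq_iff track_def nth_append rev_nth)

text \<open>The left-end mark is set by the first move, so the untouched tape is a case of its
  own.\<close>

definition loaded :: "nat list \<Rightarrow> bool list \<Rightarrow> ('k, 'x) mstate \<times> nat \<times> (nat \<Rightarrow> ('k, 'x) cell)" where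
  "loaded w u =
     (if u = [] then (Start, 0, raw_tape w) else (Load, length u, tape (init_stacks u) w (length u)))"

lemma load_phase:
  assumes "w = map bit_code u @ v"
  shows "reaches ms (length u) (Start, 0, raw_tape w)
     (loaded w u)"
  using assms
proof (induction u arbitrary: v rule: rev_induct)
  case Nil
  show ?case by (simp only: loaded_def list.size refl if_True reaches_refl)
next
  case (snoc b u)
  have IH: "reaches ms (length u) (Start, 0, raw_tape w)
     (loaded w u)"
    by (rule snoc.IH[of "bit_code b # v"]) (use snoc.prems in simp)
  have wu: "nth_or_blank w (length u) = bit_code b"
    using snoc.prems by (simp add: nth_or_blank_def nth_append)
  have b: "bit_code b \<in> {1, 2}" "(bit_code b = 2) = b" by (simp_all add: bit_code_def)
  have "reaches ms 1 (loaded w u)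
     (Load, length (u @ [b]), tape (init_stacks (u @ [b])) w (length (u @ [b])))"
    by (rule reaches_step) (use wu b in \<open>auto simp: astep_def raw_tape_def raw_cell_def load_def loaded_def tape_def fun_eq_iff init_stacks_snoc;
       auto simp: init_stacks_def track_def\<close>)
  from reaches_trans[OF IH this] show ?case by (simp add: loaded_def)
qed

definition accepted :: "nat list set" where
  "accepted = {map bit_code u @ 3 # y | u y. run c0 (init_stacks u) y}"

lemma accepted_iff: "map bit_code u @ 3 # y \<in> accepted \<longleftrightarrow> run c0 (init_stacks u) y"
proof
  assume "map bit_code u @ 3 # y \<in> accepted"
  then obtain u' y' where eq: "map bit_code u @ 3 # y = map bit_code u' @ 3 # y'" and r: "run c0 (init_stacks u') y'"
    unfolding accepted_def by blast
  \<comment> \<open>Bit codes are 1 and 2, so the first 3 is the separator and the word splits in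
    only one way.\<close>
  have "takeWhile (\<lambda>i. i \<noteq> 3) (map bit_code v @ 3 # z) = map bit_code v"
    "dropWhile (\<lambda>i. i \<noteq> 3) (map bit_code v @ 3 # z) = 3 # z" for v z
    by (induction v) (auto simp: bit_code_def)
  from this[of u y] this[of u' y'] eq have "map bit_code u = map bit_code u' \<and> y = y'" by simp
  moreover have "inj bit_code" by (auto simp: inj_def bit_code_def split: if_splits)
  ultimately show "run c0 (init_stacks u) y" using r by (simp add: inj_map_eq_map)
qed (auto simp: accepted_def)

lemma machine_decides:
  assumes "set w \<subseteq> {1, 2, 3}"
  shows "\<exists>C. reaches ms ((4 * length w + 10) * (length w + 1) + 2 * length w + 5)
    (Start, 0, raw_tape w) (if w \<in> accepted then Acc else Rej, C)"
proof -
  define u where "u = map (\<lambda>i. i = 2) (takeWhile (\<lambda>i. i \<noteq> 3) w)"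
  have "map bit_code u = takeWhile (\<lambda>i. i \<noteq> 3) w"
    using assms unfolding u_def map_map
    by (intro map_idI) (auto simp: bit_code_def dest!: set_takeWhileD)
  then obtain v where v: "w = map bit_code u @ v" "v = [] \<or> (\<exists>y. v = 3 # y)"
    by (metis (mono_tags, lifting) list.collapse hd_dropWhile takeWhile_dropWhile_id)
  note load = load_phase[OF v(1)]
  from v(2) show ?thesis
  proof (elim disjE exE)
    assume "v = []"
    have "3 \<notin> set w" using v(1) \<open>v = []\<close> by (auto simp: bit_code_def)
    then have "w \<notin> accepted" by (auto simp: accepted_def)
    \<comment> \<open>Without a separator the head reaches the blank behind the word, and
      \<open>load\<close> rejects there.\<close>
    have "reaches ms 1 (loaded w u)
       (Rej, if u = [] then (0, tape (init_stacks u) w 0) else (length u, tape (init_stacks u) w (length u)))"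
      by (rule reaches_step) (use v(1) \<open>v = []\<close> in \<open>auto simp: astep_def raw_tape_def raw_cell_def load_def loaded_def tape_def fun_eq_iff nth_or_blank_def;
        auto simp: init_stacks_def track_def\<close>)
    then show ?thesis unfolding if_not_P[OF \<open>w \<notin> accepted\<close>]
      by (intro exI) (rule reaches_mono[OF reaches_trans[OF load]], assumption, use v(1) in simp)
  next
    fix y assume y: "v = 3 # y"
    have w3: "nth_or_blank w (length u) = 3" using v(1) y by (simp add: nth_or_blank_def nth_append)
    have 1: "reaches ms 1 (loaded w u)
     (Return None c0, length u, tape (init_stacks u) w (Suc (length u)))"
      by (rule reaches_step) (use w3 in \<open>auto simp: astep_def raw_tape_def raw_cell_def load_def loaded_def tape_def fun_eq_iff;
        auto simp: init_stacks_def track_def\<close>)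
    have "length (init_stacks u k) \<le> Suc (length u)" for k by (simp add: init_stacks_def)
    moreover have "drop (Suc (length u)) w = y" "Suc (length u) \<le> length w" using v(1) y by simp_all
    ultimately obtain C where "reaches ms ((4 * length w + 10) * (length w + 1 - Suc (length u)))
       (Fetch c0, 0, tape (init_stacks u) w (Suc (length u))) (if run c0 (init_stacks u) y then Acc else Rej, C)"
      using run_correct[of "init_stacks u" "Suc (length u)" w c0] assms by metis
    from reaches_trans[OF reaches_trans[OF reaches_trans[OF load 1] return_fetch] this]
    have "reaches ms ((4 * length w + 10) * (length w + 1) + 2 * length w + 5)
      (Start, 0, raw_tape w) (if run c0 (init_stacks u) y then Acc else Rej, C)"
    proof (rule reaches_mono)
      have "(4 * length w + 10) * (length w + 1 - Suc (length u)) \<le> (4 * length w + 10) * (length w + 1)"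
        by (intro mult_le_mono) auto
      then show "length u + 1 + (length u + 2) + (4 * length w + 10) * (length w + 1 - Suc (length u))
        \<le> (4 * length w + 10) * (length w + 1) + 2 * length w + 5" using v(1) by simp
    qed
    moreover have "run c0 (init_stacks u) y \<longleftrightarrow> w \<in> accepted" using accepted_iff[of u y] v(1) y by simp
    ultimately show ?thesis by (intro exI) simp
  qed
qed

end

lemma accepted_in_P:
  fixes c0 :: "('k::finite, 'x::finite) act cmd"
  shows "in_P (accepted k0 em c0)"
proof (rule in_P_abstract[where Q = "mstates c0" and G = "UNIV \<times> {..<5} \<times> UNIV" and e = raw_cell
      and \<delta> = "mdelta k0 em c0" and ?q0.0 = Start and qa = Acc and qr = Rej and c = 30 and d = 2])
  show "finite (mstates c0)" by (rule finite_mstates)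
  show "finite (UNIV \<times> {..<5} \<times> UNIV :: ('k, 'x) cell set)" by simp
  let ?V = "accepted k0 em c0"
  fix w :: "nat list" assume w: "set w \<subseteq> {1, 2, 3}"
  obtain C where C: "reaches (ms k0 em c0) ((4 * length w + 10) * (length w + 1) + 2 * length w + 5)
    (Start, 0, raw_tape w) (if w \<in> ?V then Acc else Rej, C)"
    using machine_decides[OF w, where ?k0.0 = k0 and em = em and ?c0.0 = c0]
    by blast
  have "(4 * length w + 10) * (length w + 1) = 4 * (length w * length w) + 14 * length w + 10"
    by (simp add: algebra_simps)
  \<comment> \<open>The left side is 4 n^2 + 16 n + 15 for n = \<open>length w\<close>, and n is at
    most n^2.\<close>
  then have "(4 * length w + 10) * (length w + 1) + 2 * length w + 5 \<le> 30 * length w ^ 2 + 30"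
    unfolding power2_eq_square using le_square[of "length w"] by linarith
  from reaches_mono[OF C this] obtain t where "t \<le> 30 * length w ^ 2 + 30"
    "(ms k0 em c0 ^^ t) (Start, 0, raw_tape w)
      = (if w \<in> ?V then Acc else Rej, C)" unfolding reaches_def by blast
  then show "\<exists>t\<le>30 * length w ^ 2 + 30.
      fst ((ms k0 em c0 ^^ t) (Start, 0, raw_cell \<circ> nth_or_blank w)) \<in> {Acc, Rej} \<and>
      (fst ((ms k0 em c0 ^^ t) (Start, 0, raw_cell \<circ> nth_or_blank w)) = Acc \<longleftrightarrow>
        w \<in> ?V)"
    by (intro exI[of _ t]) (auto simp: raw_tape_def)
next
  fix q a q' b d assume "q \<in> mstates c0" "a \<in> UNIV \<times> {..<5} \<times> UNIV" "mdelta k0 em c0 q a = (q', b, d)"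
  then show "q' \<in> mstates c0 \<and> b \<in> UNIV \<times> {..<5} \<times> UNIV" by (rule mdelta_closed)
qed (auto simp: mstates_def raw_cell_def inj_on_def)

text \<open>Interface of the machine layer. The certificate is the bit sequence of a cheap run; its
  length is bounded by the cost in \<open>exec\<close>.\<close>

theorem in_NP_stack_program:
  fixes c0 :: "('k::finite, 'x::finite) act cmd"
  assumes sound: "\<And>x s'. den app c0 (init_stacks k0 em x) s' \<Longrightarrow> x \<in> L"
    and complete: "\<And>x. x \<in> L \<Longrightarrow> \<exists>n s'. n \<le> c * length x ^ d + c \<and>
      exec (\<lambda>a s m s'. 1 \<le> m \<and> app a s s') c0 (init_stacks k0 em x) n s'"
  shows "in_NP L"
proof -
  have "x \<in> L \<longleftrightarrow> (\<exists>y. length y \<le> c * length x ^ d + c \<and> map bit_code x @ [3] @ map bit_code y \<in> accepted k0 em c0)" for x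
  proof
    assume "x \<in> L"
    from complete[OF this] obtain n s' where n: "n \<le> c * length x ^ d + c"
      and e: "exec (\<lambda>a s m s'. 1 \<le> m \<and> app a s s') c0 (init_stacks k0 em x) n s'" by blast
    from exec_smalls[OF e] obtain m where "m \<le> n" "(small app ^^ m) (c0, init_stacks k0 em x) (Skip, s')" by blast
    from smalls_imp_run[OF this(2)] obtain y where
      "length y = m" "run c0 (init_stacks k0 em x) (map bit_code y)" by blast
    with \<open>m \<le> n\<close> n have "length y \<le> c * length x ^ d + c" "run c0 (init_stacks k0 em x) (map bit_code y)"
      by simp_all
    then show "\<exists>y. length y \<le> c * length x ^ d + c \<and> map bit_code x @ [3] @ map bit_code y \<in> accepted k0 em c0"
      by (intro exI[of _ y]) (simp add: accepted_iff)
  next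
    assume "\<exists>y. length y \<le> c * length x ^ d + c \<and> map bit_code x @ [3] @ map bit_code y \<in> accepted k0 em c0"
    then obtain y where "run c0 (init_stacks k0 em x) (map bit_code y)"
      by (auto simp: accepted_iff)
    from run_imp_smalls[OF this] show "x \<in> L" by (auto dest!: smalls_den intro: sound)
  qed
  then show ?thesis unfolding in_NP_def
    by (intro exI[of _ "accepted k0 em c0"] exI conjI accepted_in_P allI)
qed

section \<open>Programs on stacks of names\<close>

fun seqs :: "'a cmd list \<Rightarrow> 'a cmd" where
  "seqs [] = Skip"
| "seqs (c # cs) = Seq c (seqs cs)"

fun bind :: "('a \<Rightarrow> 'b cmd) \<Rightarrow> 'a cmd \<Rightarrow> 'b cmd" where
  "bind f Skip = Skip"
| "bind f (Act a) = f a"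
| "bind f (Seq c d) = Seq (bind f c) (bind f d)"
| "bind f (Alt c d) = Alt (bind f c) (bind f d)"
| "bind f (Star c) = Star (bind f c)"

text \<open>\<open>e\<close> represents states of the upper layer. The program for an action may
  pass through states that represent nothing, but has to end in one that does; the control structure
  is the same on both sides.\<close>

lemma den_bind:
  assumes "\<And>a s r. a \<in> set_cmd c \<Longrightarrow> den A (f a) (e s) r \<Longrightarrow> \<exists>s'. r = e s' \<and> B a s s'"
    and "den A (bind f c) (e s) r"
  shows "\<exists>s'. r = e s' \<and> den B c s s'"
  using assms
proof (induction c arbitrary: s r)
  case (Seq c d)
  from Seq.prems(2) obtain q where q: "den A (bind f c) (e s) q" "den A (bind f d) q r" by auto
  from Seq.IH(1)[OF Seq.prems(1) q(1)] obtain s1 where s1: "q = e s1" "den B c s s1" by auto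
  from Seq.IH(2)[OF Seq.prems(1)] q(2) s1(1) obtain s2 where "r = e s2" "den B d s1 s2" by auto
  with s1 show ?case by auto
next
  case (Alt c d)
  from Alt.prems(2) have "den A (bind f c) (e s) r \<or> den A (bind f d) (e s) r" by simp
  then show ?case
  proof
    assume "den A (bind f c) (e s) r"
    from Alt.IH(1)[OF Alt.prems(1) this] show ?thesis by auto
  next
    assume "den A (bind f d) (e s) r"
    from Alt.IH(2)[OF Alt.prems(1) this] show ?thesis by auto
  qed
next
  case (Star c)
  from Star.prems(2) have "(den A (bind f c))\<^sup>*\<^sup>* (e s) r" by simp
  then have "\<exists>s'. r = e s' \<and> (den B c)\<^sup>*\<^sup>* s s'"
  proof (induction rule: rtranclp_induct)
    case (step q r)
    then obtain s1 where s1: "q = e s1" "(den B c)\<^sup>*\<^sup>* s s1" by auto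
    from Star.IH[OF Star.prems(1)] step(2) s1(1) obtain s2 where "r = e s2" "den B c s1 s2" by auto
    with s1 show ?case by (auto intro: rtranclp.rtrancl_into_rtrancl)
  qed auto
  then show ?case by simp
qed auto

text \<open>A run of cost n that starts with size b stays within size b + n, so a unit of cost
  expands to at most K (b + n + 1). The factor 2 n + 1, in place of n, leaves room for control
  steps.\<close>

definition bind_cost :: "nat \<Rightarrow> nat \<Rightarrow> nat \<Rightarrow> nat" where
  "bind_cost K b n = K * (b + n + 1) * (2 * n + 1)"

lemma bind_cost_mono: "b \<le> b' \<Longrightarrow> n \<le> n' \<Longrightarrow> bind_cost K b n \<le> bind_cost K b' n'"
  unfolding bind_cost_def by (intro mult_le_mono) auto

text \<open>\<open>j\<close> is 1 for a round of \<open>Star\<close>, whose control cost is 2, and 0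
  otherwise. After extracting the common factor this is (2m + 1) + (2n + 1) + (1 + j) \<le> 2k +
  1.\<close>

lemma bind_cost_add:
  assumes "m + n + 1 \<le> k" "1 \<le> K" "j = 0 \<or> m + n + 2 \<le> k" "j \<le> 1"
  shows "bind_cost K b m + bind_cost K (b + m) n + 1 + j \<le> bind_cost K b k"
proof -
  let ?Q = "K * (b + k + 1)"
  have "bind_cost K b m \<le> ?Q * (2 * m + 1)" "bind_cost K (b + m) n \<le> ?Q * (2 * n + 1)"
    unfolding bind_cost_def using assms(1) by (intro mult_le_mono; simp)+
  moreover have "1 \<le> ?Q" using assms(2) by simp
  then have "1 + j \<le> ?Q * (1 + j)" by (metis mult_1 mult_le_mono1)
  ultimately have "bind_cost K b m + bind_cost K (b + m) n + 1 + j \<le> ?Q * (2 * m + 1 + (2 * n + 1) + (1 + j))"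
    by (simp only: add_mult_distrib2)
  also have "\<dots> \<le> ?Q * (2 * k + 1)"
    using assms by (intro mult_le_mono) auto
  finally show ?thesis by (simp add: bind_cost_def)
qed

text \<open>The size bound \<open>bnd\<close> is carried along because the cost of an expanded
  action depends on the current size, which grows by at most the cost spent so far.\<close>

lemma exec_bind:
  assumes act: "\<And>a s m s' b. a \<in> set_cmd c \<Longrightarrow> B a s m s' \<Longrightarrow> bnd b s \<Longrightarrow>
      bnd (b + m) s' \<and> exec A (f a) (e s) (bind_cost K b m) (e s')"
    and K: "1 \<le> K"
    and mono: "\<And>b b' s. bnd b s \<Longrightarrow> b \<le> b' \<Longrightarrow> bnd b' s"
    and ex: "exec B c s n s'" and "bnd b s"
  shows "bnd (b + n) s' \<and> exec A (bind f c) (e s) (bind_cost K b n) (e s')"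
  using ex act \<open>bnd b s\<close>
proof (induction arbitrary: b rule: exec.induct)
  case (exec_Skip s n)
  then show ?case using mono by (auto intro: exec.exec_Skip)
next
  case (exec_Act a s m s' n)
  from exec_Act.prems(1)[OF _ exec_Act.hyps(1) exec_Act.prems(2)] exec_Act.hyps(2)
  show ?case using mono[of "b + m" s' "b + n"] exec_mono bind_cost_mono[of b b m n K] by auto
next
  case (exec_Seq c s m s' d n s'' k)
  note 1 = exec_Seq.IH(1)[OF exec_Seq.prems(1) exec_Seq.prems(2), simplified]
  note 2 = exec_Seq.IH(2)[OF exec_Seq.prems(1), of "b + m", simplified]
  show ?case using 1 2 exec_Seq.hyps(3) mono[of "b + m + n" s'' "b + k"]
      bind_cost_add[OF exec_Seq.hyps(3) K, of 0 b] by (auto intro: exec.exec_Seq)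
next
  case (exec_Alt1 c s n s' k d)
  note 1 = exec_Alt1.IH[OF exec_Alt1.prems(1) exec_Alt1.prems(2), simplified]
  show ?case using 1 exec_Alt1.hyps(2) mono[of "b + n" s' "b + k"]
      bind_cost_add[of n 0 k K 0 b] K by (auto intro!: exec.exec_Alt1)
next
  case (exec_Alt2 d s n s' k c)
  note 1 = exec_Alt2.IH[OF exec_Alt2.prems(1) exec_Alt2.prems(2), simplified]
  show ?case using 1 exec_Alt2.hyps(2) mono[of "b + n" s' "b + k"]
      bind_cost_add[of n 0 k K 0 b] K by (auto intro!: exec.exec_Alt2)
next
  case (exec_Star0 k c s)
  have "1 \<le> bind_cost K b k" using K by (simp add: bind_cost_def)
  then show ?case using exec_Star0 mono[of b s "b + k"] by (auto intro: exec.exec_Star0)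
next
  case (exec_Star1 c s m s' n s'' k)
  note 1 = exec_Star1.IH(1)[OF exec_Star1.prems(1) exec_Star1.prems(2), simplified]
  note 2 = exec_Star1.IH(2)[OF exec_Star1.prems(1), of "b + m", simplified]
  show ?case using 1 2 exec_Star1.hyps(3) mono[of "b + m + n" s'' "b + k"]
      bind_cost_add[of m n k K 1 b] K by (auto intro: exec.exec_Star1)
qed

abbreviation appc :: "('k, 'x) act \<Rightarrow> ('k \<Rightarrow> 'x list) \<Rightarrow> nat \<Rightarrow> ('k \<Rightarrow> 'x list) \<Rightarrow> bool" where
  "appc \<equiv> \<lambda>a s m s'. 1 \<le> m \<and> app a s s'"

section \<open>Moving bits between groups of stacks\<close>

definition pop_all :: "'x \<Rightarrow> 'k list \<Rightarrow> ('k, 'x) act cmd" where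
  "pop_all x ks = seqs (map (\<lambda>k. Act (Pop k x)) ks)"

definition push_all :: "'x \<Rightarrow> 'k list \<Rightarrow> ('k, 'x) act cmd" where
  "push_all x ks = seqs (map (\<lambda>k. Act (Push k x)) ks)"

definition popped :: "'k list \<Rightarrow> ('k \<Rightarrow> 'x list) \<Rightarrow> 'k \<Rightarrow> 'x list" where
  "popped ks s = (\<lambda>k. if k \<in> set ks then tl (s k) else s k)"

definition pushed :: "'x \<Rightarrow> 'k list \<Rightarrow> ('k \<Rightarrow> 'x list) \<Rightarrow> 'k \<Rightarrow> 'x list" where
  "pushed x ks s = (\<lambda>k. if k \<in> set ks then x # s k else s k)"

lemma popped_Cons: "popped (k # ks) s = popped ks (s(k := tl (s k)))" if "k \<notin> set ks"
  using that by (auto simp: popped_def)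

lemma pushed_Cons: "pushed x (k # ks) s = pushed x ks (s(k := x # s k))" if "k \<notin> set ks"
  using that by (auto simp: pushed_def)

lemma den_pop_all:
  "distinct ks \<Longrightarrow> den app (pop_all x ks) s s' \<longleftrightarrow> (\<forall>k \<in> set ks. \<exists>r. s k = x # r) \<and> s' = popped ks s"
proof (induction ks arbitrary: s)
  case (Cons k ks)
  then show ?case
    by (auto simp: pop_all_def popped_Cons OO_def) (auto simp: popped_def split: if_splits)
qed (auto simp: pop_all_def popped_def)

lemma den_push_all:
  "distinct ks \<Longrightarrow> den app (push_all x ks) s s' \<longleftrightarrow> s' = pushed x ks s"
proof (induction ks arbitrary: s)
  case (Cons k ks)
  then show ?case by (simp add: push_all_def pushed_Cons OO_def)
qed (auto simp: push_all_def pushed_def)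

lemma exec_pop_all:
  "distinct ks \<Longrightarrow> \<forall>k \<in> set ks. \<exists>r. s k = x # r \<Longrightarrow> exec appc (pop_all x ks) s (2 * length ks) (popped ks s)"
proof (induction ks arbitrary: s)
  case (Cons k ks)
  have "exec appc (Act (Pop k x)) s 1 (s(k := tl (s k)))"
    using Cons.prems(2) by (intro exec_Act[of _ _ _ 1]) auto
  moreover have "exec appc (pop_all x ks) (s(k := tl (s k))) (2 * length ks) (popped ks (s(k := tl (s k))))"
    using Cons.prems by (intro Cons.IH) auto
  ultimately show ?case using Cons.prems(1)
    by (auto simp: popped_Cons pop_all_def intro: exec_Seq)
qed (auto simp: pop_all_def popped_def intro: exec_Skip)

lemma exec_push_all:
  "distinct ks \<Longrightarrow> exec appc (push_all x ks) s (2 * length ks) (pushed x ks s)"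
proof (induction ks arbitrary: s)
  case (Cons k ks)
  have "exec appc (Act (Push k x)) s 1 (s(k := x # s k))"
    by (intro exec_Act[of _ _ _ 1]) auto
  moreover have "exec appc (push_all x ks) (s(k := x # s k)) (2 * length ks) (pushed x ks (s(k := x # s k)))"
    using Cons.prems by (intro Cons.IH) auto
  ultimately show ?case using Cons.prems(1)
    by (auto simp: pushed_Cons push_all_def intro: exec_Seq)
qed (auto simp: push_all_def pushed_def intro: exec_Skip)

text \<open>The same bit leaves all stacks of \<open>ks\<close> in each round, so this compares
  their contents while copying them to all of \<open>ls\<close>. The order of the bits is
  reversed.\<close>

definition move_bits :: "'k list \<Rightarrow> 'k list \<Rightarrow> ('k, bool option) act cmd" where
  "move_bits ks ls = Star (Alt (Seq (pop_all (Some True) ks) (push_all (Some True) ls))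
     (Seq (pop_all (Some False) ks) (push_all (Some False) ls)))"

definition move_bit :: "'k \<Rightarrow> 'k \<Rightarrow> ('k, bool option) act cmd" where
  "move_bit k l = Alt (Seq (Act (Pop k (Some True))) (Act (Push l (Some True))))
     (Seq (Act (Pop k (Some False))) (Act (Push l (Some False))))"

definition has_prefix :: "'x list \<Rightarrow> 'k list \<Rightarrow> ('k \<Rightarrow> 'x list) \<Rightarrow> bool" where
  "has_prefix xs ks s \<longleftrightarrow> (\<forall>k \<in> set ks. \<exists>r. s k = xs @ r)"

definition moved :: "'x list \<Rightarrow> 'k list \<Rightarrow> 'k list \<Rightarrow> ('k \<Rightarrow> 'x list) \<Rightarrow> 'k \<Rightarrow> 'x list" where
  "moved xs ks ls s = (\<lambda>k. if k \<in> set ks then drop (length xs) (s k)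
     else if k \<in> set ls then rev xs @ s k else s k)"

lemma moved_Cons:
  assumes "set ks \<inter> set ls = {}"
  shows "moved (x # xs) ks ls s = moved xs ks ls (pushed x ls (popped ks s))"
  using assms by (auto simp: moved_def pushed_def popped_def fun_eq_iff drop_Suc)

lemma has_prefix_Cons:
  assumes "set ks \<inter> set ls = {}"
  shows "has_prefix (x # xs) ks s \<longleftrightarrow>
    (\<forall>k \<in> set ks. \<exists>r. s k = x # r) \<and> has_prefix xs ks (pushed x ls (popped ks s))"
  using assms unfolding has_prefix_def pushed_def popped_def by fastforce

lemma den_move_bits:
  assumes "distinct ks" "distinct ls" "set ks \<inter> set ls = {}"
  shows "den app (move_bits ks ls) s s' \<Longrightarrow>
    \<exists>bs. has_prefix (map Some bs) ks s \<and> s' = moved (map Some bs) ks ls s"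
  unfolding move_bits_def den.simps
proof (induction rule: converse_rtranclp_induct)
  case base
  show ?case by (rule exI[of _ "[]"]) (simp add: has_prefix_def moved_def fun_eq_iff)
next
  case (step s q)
  then obtain b where "\<forall>k \<in> set ks. \<exists>r. s k = Some b # r" "q = pushed (Some b) ls (popped ks s)"
    using assms by (auto simp: den_pop_all den_push_all)
  moreover from step obtain bs where "has_prefix (map Some bs) ks q" "s' = moved (map Some bs) ks ls q" by blast
  ultimately show ?case using assms(3)
    by (intro exI[of _ "b # bs"]) (simp add: moved_Cons has_prefix_Cons[of _ ls])
qed

lemma exec_move_bits:
  assumes "distinct ks" "distinct ls" "set ks \<inter> set ls = {}"
  shows "has_prefix (map Some bs) ks s \<Longrightarrow>
    exec appc (move_bits ks ls) s (length bs * (2 * length ks + 2 * length ls + 4) + 1) (moved (map Some bs) ks ls s)"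
proof (induction bs arbitrary: s)
  case Nil
  have "moved [] ks ls s = s" by (simp add: moved_def fun_eq_iff)
  then show ?case by (simp add: move_bits_def exec_Star0)
next
  case (Cons b bs)
  let ?q = "pushed (Some b) ls (popped ks s)"
  have p: "\<forall>k \<in> set ks. \<exists>r. s k = Some b # r" "has_prefix (map Some bs) ks ?q"
    using Cons.prems has_prefix_Cons[OF assms(3), of "Some b" "map Some bs" s] by simp_all
  have "exec appc (Seq (pop_all (Some b) ks) (push_all (Some b) ls)) s (2 * length ks + 2 * length ls + 1) ?q"
    by (rule exec_Seq[OF exec_pop_all[OF assms(1) p(1)] exec_push_all[OF assms(2)]]) simp
  then have "exec appc (Alt (Seq (pop_all (Some True) ks) (push_all (Some True) ls))
     (Seq (pop_all (Some False) ks) (push_all (Some False) ls))) s (2 * length ks + 2 * length ls + 2) ?q"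
    by (cases b) (auto intro: exec_Alt1 exec_Alt2)
  from exec_Star1[OF this Cons.IH[OF p(2), unfolded move_bits_def]]
  show ?case using assms(3) by (simp add: moved_Cons move_bits_def)
qed


section \<open>Name actions and their implementation\<close>

datatype 'k name_act = Rd bool | RdEnd | RdName bool 'k | Names "'k list" "'k list"
  | PushE 'k | PopE 'k | IsEmp 'k | PushZ 'k | Inc 'k

type_synonym 'k name_state = "bool list \<times> ('k \<Rightarrow> bool list list)"

fun bsucc :: "bool list \<Rightarrow> bool list" where
  "bsucc [] = [True]"
| "bsucc (False # bs) = True # bs"
| "bsucc (True # bs) = False # bsucc bs"

text \<open>\<open>Names\<close> is a move, a copy, a deletion or an equality test, depending on its
  lists. The empty name of \<open>PushE\<close> and \<open>PopE\<close> will be a separator;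
  \<open>PushZ\<close> pushes the numeral 0 with the tag True, because \<open>bin 0\<close> is
  empty.\<close>

fun sem :: "'k name_act \<Rightarrow> 'k name_state \<Rightarrow> 'k name_state \<Rightarrow> bool" where
  "sem (Rd b) (i, t) s' \<longleftrightarrow> (\<exists>r. i = b # r \<and> s' = (r, t))"
| "sem RdEnd (i, t) s' \<longleftrightarrow> i = [] \<and> s' = (i, t)"
| "sem (RdName b k) (i, t) s' \<longleftrightarrow> (\<exists>n r. i = enc_nat n @ r \<and> s' = (r, t(k := (b # bin n) # t k)))"
| "sem (Names ks ls) (i, t) s' \<longleftrightarrow>
     (\<exists>n. (\<forall>k \<in> set ks. \<exists>r. t k = n # r) \<and> s' = (i, pushed n ls (popped ks t)))"
| "sem (PushE k) (i, t) s' \<longleftrightarrow> s' = (i, t(k := [] # t k))"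
| "sem (PopE k) (i, t) s' \<longleftrightarrow> (\<exists>r. t k = [] # r \<and> s' = (i, t(k := r)))"
| "sem (IsEmp k) (i, t) s' \<longleftrightarrow> t k = [] \<and> s' = (i, t)"
| "sem (PushZ k) (i, t) s' \<longleftrightarrow> s' = (i, t(k := [True] # t k))"
| "sem (Inc k) (i, t) s' \<longleftrightarrow> (\<exists>bs r. t k = (True # bs) # r \<and> s' = (i, t(k := (True # bsucc bs) # r)))"

text \<open>Only \<open>Names\<close> can involve arbitrarily many stacks, so its cost has to grow
  with their number.\<close>

fun weight :: "'k name_act \<Rightarrow> nat" where
  "weight (Names ks ls) = length ks + length ls + 1"
| "weight _ = 1"

definition semc :: "'k name_act \<Rightarrow> 'k name_state \<Rightarrow> nat \<Rightarrow> 'k name_state \<Rightarrow> bool" where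
  "semc a s m s' \<longleftrightarrow> sem a s s' \<and> weight a \<le> m"

text \<open>With empty \<open>ks\<close>, \<open>Names\<close> could push a guessed name of any
  length, which would break the size bound.\<close>

fun name_act_wf :: "'k name_act \<Rightarrow> bool" where
  "name_act_wf (Names ks ls) \<longleftrightarrow> ks \<noteq> [] \<and> distinct ks \<and> distinct ls"
| "name_act_wf _ \<longleftrightarrow> True"

text \<open>A name is stored on a stack as its bits followed by the symbol \<^term>\<open>None\<close>.  The stack
  \<^term>\<open>Inr True\<close> holds the unread input, and \<^term>\<open>Inr False\<close> is scratch space that is
  empty between two actions.\<close>

definition enc_name :: "bool list \<Rightarrow> bool option list" where
  "enc_name n = map Some n @ [None]"

definition enc_names :: "bool list list \<Rightarrow> bool option list" where
  "enc_names ns = concat (map enc_name ns)"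

definition enc_state :: "'k name_state \<Rightarrow> 'k + bool \<Rightarrow> bool option list" where
  "enc_state s = (\<lambda>j. case j of Inl k \<Rightarrow> enc_names (snd s k)
     | Inr b \<Rightarrow> if b then map Some (fst s) else [])"

lemma enc_names_simps [simp]:
  "enc_names [] = []" "enc_names (n # ns) = map Some n @ None # enc_names ns"
  by (simp_all add: enc_names_def enc_name_def)

lemma enc_state_simps [simp]:
  "enc_state (i, t) (Inl k) = enc_names (t k)"
  "enc_state (i, t) (Inr True) = map Some i" "enc_state (i, t) (Inr False) = []"
  by (simp_all add: enc_state_def)

lemma name_split: "map Some a @ None # r = map Some b @ None # q \<longleftrightarrow> a = b \<and> r = q"
proof (induction a arbitrary: b)
  case Nil
  then show ?case by (cases b) auto
next
  case (Cons x a)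
  then show ?case by (cases b) auto
qed

lemma enc_names_split:
  "enc_names ns = map Some a @ None # r \<longleftrightarrow> (\<exists>ms. ns = a # ms \<and> r = enc_names ms)"
  by (cases ns) (auto simp: name_split)

lemma enc_state_eqI:
  assumes "\<And>k. f (Inl k) = enc_names (t k)" "f (Inr True) = map Some i" "f (Inr False) = []"
  shows "f = enc_state (i, t)"
proof
  fix j show "f j = enc_state (i, t) j" using assms by (cases j) (auto simp: enc_state_def)
qed

text \<open>Names pass through the scratch stack, which reverses them, and a second
  \<open>move_bits\<close> restores their order; the test \<open>Empty\<close> forces it to finish.
  \<open>RdName\<close> checks that the most significant bit, which is on top of the scratch stack,
  is True, because only canonical numerals occur in encodings. In \<open>Inc\<close> the carry ends
  at a zero or at the end mark, which is put back.\<close>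

fun impl :: "'k name_act \<Rightarrow> ('k + bool, bool option) act cmd" where
  "impl (Rd b) = Act (Pop (Inr True) (Some b))"
| "impl RdEnd = Act (Empty (Inr True))"
| "impl (RdName b k) = seqs [
     Act (Push (Inl k) None),
     Star (Seq (Act (Pop (Inr True) (Some True))) (move_bit (Inr True) (Inr False))),
     Alt (Act (Empty (Inr False)))
       (Seq (Act (Pop (Inr False) (Some True))) (Act (Push (Inr False) (Some True)))),
     Act (Pop (Inr True) (Some False)), Act (Pop (Inr True) (Some False)),
     move_bits [Inr False] [Inl k], Act (Empty (Inr False)), Act (Push (Inl k) (Some b))]"
| "impl (Names ks ls) = seqs [
     move_bits (map Inl ks) [Inr False], pop_all None (map Inl ks), push_all None (map Inl ls),
     move_bits [Inr False] (map Inl ls), Act (Empty (Inr False))]"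
| "impl (PushE k) = Act (Push (Inl k) None)"
| "impl (PopE k) = Act (Pop (Inl k) None)"
| "impl (IsEmp k) = Act (Empty (Inl k))"
| "impl (PushZ k) = seqs [Act (Push (Inl k) None), Act (Push (Inl k) (Some True))]"
| "impl (Inc k) = seqs [
     Act (Pop (Inl k) (Some True)),
     Star (Seq (Act (Pop (Inl k) (Some True))) (Act (Push (Inr False) (Some False)))),
     Alt (Act (Pop (Inl k) (Some False))) (seqs [Act (Pop (Inl k) None), Act (Push (Inl k) None)]),
     Act (Push (Inr False) (Some True)),
     move_bits [Inr False] [Inl k], Act (Empty (Inr False)), Act (Push (Inl k) (Some True))]"

section \<open>Binary numerals and the loops on bits\<close>

lemma bin_0: "bin 0 = []"
  by (simp add: bin.simps)

lemma bin_Nil_iff: "bin n = [] \<longleftrightarrow> n = 0"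
  by (subst bin.simps) simp

lemma bin_double: "bin (2 * n) = (if n = 0 then [] else False # bin n)" "bin (2 * n + 1) = True # bin n"
  by (subst bin.simps; simp)+

lemma bin_bsucc: "bsucc (bin n) = bin (Suc n)"
proof (induction n rule: less_induct)
  case (less n)
  consider m where "n = 2 * m" | m where "n = 2 * m + 1" by (metis oddE evenE)
  then show ?case
  proof cases
    case 1
    then show ?thesis using bin_double[of m] bin_double(2)[of 0] by (auto simp: bin_0)
  next
    case 2
    then have "bsucc (bin m) = bin (Suc m)" by (intro less) simp
    moreover have "Suc n = 2 * Suc m" using 2 by simp
    ultimately show ?thesis using 2 bin_double(2)[of m] bin_double(1)[of "Suc m"] by simp
  qed
qed

text \<open>The least significant bit comes first, so the condition forbids leading zeros. It lets
  the program recognize \<open>enc_nat\<close> without knowing the number.\<close>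

lemma bin_canonical: "(\<exists>n. bs = bin n) \<longleftrightarrow> bs = [] \<or> last bs"
proof
  assume "bs = [] \<or> last bs"
  then show "\<exists>n. bs = bin n"
  proof (induction bs)
    case Nil
    show ?case by (intro exI[of _ 0]) (simp add: bin_0)
  next
    case (Cons b bs)
    then obtain n where n: "bs = bin n" by (auto split: if_splits)
    show ?case
    proof (cases b)
      case True
      then show ?thesis using n bin_double(2)[of n] by metis
    next
      case False
      have "n \<noteq> 0"
      proof
        assume "n = 0"
        with n have "bs = []" by (simp add: bin_0)
        with Cons.prems False show False by simp
      qed
      then show ?thesis using n bin_double(1)[of n] False by metis
    qed
  qed
next
  have "bin n = [] \<or> last (bin n)" for n
  proof (induction n rule: less_induct)
    case (less n)
    consider "n = 0" | m where "n = 2 * m" "m \<noteq> 0" | m where "n = 2 * m + 1" by (metis oddE evenE mult_0_right)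
    then show ?case
    proof cases
      case 1
      then show ?thesis by (simp add: bin_0)
    next
      case 2
      then show ?thesis using less[of m] bin_double(1)[of m] by (simp add: bin_Nil_iff)
    next
      case 3
      then show ?thesis using less[of m] bin_double(2)[of m] by auto
    qed
  qed
  then show "\<exists>n. bs = bin n \<Longrightarrow> bs = [] \<or> last bs" by blast
qed

lemma bsucc_run:
  "bsucc (replicate j True @ False # bs) = replicate j False @ True # bs"
  "bsucc (replicate j True) = replicate j False @ [True]"
  by (induction j) auto

lemma length_bsucc: "length (bsucc bs) \<le> Suc (length bs)"
  by (induction bs rule: bsucc.induct) auto

lemma den_move_bit:
  "den app (move_bit k l) s s' \<longleftrightarrow> (\<exists>b r. s k = Some b # r \<and> s' = (s(k := r))(l := Some b # (s(k := r)) l))"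
  by (auto simp: move_bit_def OO_def ex_bool_eq)

lemma den_read_pairs:
  assumes "k \<noteq> l"
  shows "den app (Star (Seq (Act (Pop k (Some True))) (move_bit k l))) s s' \<Longrightarrow>
    \<exists>bs r. s k = map Some (concat (map (\<lambda>b. [True, b]) bs)) @ r \<and> s' = s(k := r, l := rev (map Some bs) @ s l)"
  unfolding den.simps
proof (induction rule: converse_rtranclp_induct)
  case base
  show ?case by (intro exI[of _ "[]"] exI[of _ "s' k"]) auto
next
  case (step s q)
  from step(1) obtain b r where "s k = Some True # Some b # r" "q = s(k := r, l := Some b # s l)"
    using assms by (auto simp: OO_def den_move_bit)
  moreover from step obtain bs r' where "q k = map Some (concat (map (\<lambda>b. [True, b]) bs)) @ r'"
    "s' = q(k := r', l := rev (map Some bs) @ q l)" by blast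
  ultimately show ?case using assms
    by (intro exI[of _ "b # bs"] exI[of _ r']) (auto simp: fun_eq_iff)
qed

lemma den_carry:
  assumes "k \<noteq> l"
  shows "den app (Star (Seq (Act (Pop k (Some True))) (Act (Push l (Some False))))) s s' \<Longrightarrow>
    \<exists>j r. s k = replicate j (Some True) @ r \<and> s' = s(k := r, l := replicate j (Some False) @ s l)"
  unfolding den.simps
proof (induction rule: converse_rtranclp_induct)
  case base
  show ?case by (intro exI[of _ 0] exI[of _ "s' k"]) auto
next
  case (step s q)
  from step(1) obtain r where "s k = Some True # r" "q = s(k := r, l := Some False # s l)"
    using assms by (auto simp: OO_def)
  moreover from step obtain j r' where "q k = replicate j (Some True) @ r'"
    "s' = q(k := r', l := replicate j (Some False) @ q l)" by blast
  ultimately show ?case using assms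
    by (intro exI[of _ "Suc j"] exI[of _ r']) (auto simp: fun_eq_iff replicate_app_Cons_same)
qed

text \<open>The premise \<open>s' t = []\<close> is what the \<open>Empty\<close> test after the
  loop provides; it turns the guessed length into a complete transfer.\<close>

lemma den_unload:
  assumes "distinct ls" "t \<notin> set ls" "den app (move_bits [t] ls) s s'" "s' t = []"
    and "s t = rev (map Some bs)"
  shows "s' = (\<lambda>k. if k = t then [] else if k \<in> set ls then map Some bs @ s k else s k)"
proof -
  obtain cs where cs: "has_prefix (map Some cs) [t] s" "s' = moved (map Some cs) [t] ls s"
    using den_move_bits[of "[t]" ls s s'] assms by auto
  from cs(1) obtain q where q: "s t = map Some cs @ q" by (auto simp: has_prefix_def)
  moreover have "q = []" using q assms(4) cs(2) by (simp add: moved_def)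
  ultimately have "rev (map Some bs) = map Some cs" using assms(5) by simp
  then have "map Some bs = rev (map Some cs)" by (metis rev_rev_ident)
  then show ?thesis using cs(2) assms(4) by (auto simp: moved_def fun_eq_iff)
qed

lemma map_Some_split: "map Some i = map Some a @ r \<longleftrightarrow> (\<exists>j. i = a @ j \<and> r = map Some j)"
  by (auto simp: map_eq_append_conv inj_map_eq_map)

lemma den_Seq_iff: "den A (Seq c d) s r \<longleftrightarrow> (\<exists>q. den A c s q \<and> den A d q r)"
  by (auto simp: OO_def)

lemma den_Alt_iff: "den A (Alt c d) s r \<longleftrightarrow> den A c s r \<or> den A d s r"
  by simp

lemma impl_sound:
  assumes "name_act_wf a" "den app (impl a) (enc_state s) r"
  shows "\<exists>s'. r = enc_state s' \<and> sem a s s'"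
proof -
  obtain i t where s: "s = (i, t)" by (cases s)
  show ?thesis
  proof (cases a)
    case (Rd b)
    then have "r = enc_state (tl i, t) \<and> i = b # tl i"
      using assms(2) s by (auto intro!: enc_state_eqI)
    then show ?thesis using Rd s by (metis sem.simps(1))
  next
    case RdEnd
    then show ?thesis using assms(2) s by auto
  next
    case (PushE k)
    then have "r = enc_state (i, t(k := [] # t k))"
      using assms(2) s by (auto intro!: enc_state_eqI)
    then show ?thesis using PushE s by auto
  next
    case (PopE k)
    then obtain q where q: "t k = [] # q" "r = (enc_state s)(Inl k := enc_names q)"
      using assms(2) s enc_names_split[of "t k" "[]"] by auto
    then have "r = enc_state (i, t(k := q))" using s by (auto intro!: enc_state_eqI)
    then show ?thesis using PopE s q by auto
  next
    case (IsEmp k)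
    then show ?thesis using assms(2) s by (cases "t k") auto
  next
    case (PushZ k)
    then have "r = enc_state (i, t(k := [True] # t k))"
      using assms(2) s by (auto simp: OO_def intro!: enc_state_eqI)
    then show ?thesis using PushZ s by auto
  next
    case (Names ks ls)
    let ?ks = "map Inl ks :: ('a + bool) list" and ?ls = "map Inl ls :: ('a + bool) list"
    have d: "distinct ?ks" "distinct ?ls" "Inr False \<notin> set ?ks" "Inr False \<notin> set ?ls"
      using assms(1) Names by (auto simp: distinct_map)
    obtain s1 s2 s3 where 1: "den app (move_bits ?ks [Inr False]) (enc_state s) s1"
      and 2: "den app (pop_all None ?ks) s1 s2" and 3: "den app (push_all None ?ls) s2 s3"
      and 4: "den app (move_bits [Inr False] ?ls) s3 r" and 5: "r (Inr False) = []"
      using assms(2) Names by (auto simp: OO_def)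
    obtain n where n: "has_prefix (map Some n) ?ks (enc_state s)"
      "s1 = moved (map Some n) ?ks [Inr False] (enc_state s)"
      using den_move_bits[OF d(1) _ _ 1] d by auto
    have s2: "\<forall>k \<in> set ks. \<exists>q. s1 (Inl k) = None # q" "s2 = popped ?ks s1"
      using 2 d by (auto simp: den_pop_all)
    have s3: "s3 = pushed None ?ls s2" using 3 d by (simp add: den_push_all)
    \<comment> \<open>The loop took the same bits from every stack of \<open>ks\<close>, and each of
      them then shows the end mark; hence a complete name was taken, the same one
      everywhere.\<close>
    have t: "\<exists>ms. t k = n # ms" if "k \<in> set ks" for k
    proof -
      have "\<exists>p. enc_names (t k) = map Some n @ p" using n(1) that by (simp add: has_prefix_def s)
      then obtain p where p: "enc_names (t k) = map Some n @ p" by blast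
      then have "s1 (Inl k) = p" using n(2) that s by (auto simp: moved_def)
      with s2(1) that p obtain q where "enc_names (t k) = map Some n @ None # q" by auto
      then show ?thesis by (auto simp: enc_names_split)
    qed
    have "s3 (Inr False) = rev (map Some n)"
      using d by (auto simp: s3 s2(2) n(2) pushed_def popped_def moved_def s)
    note r = den_unload[OF d(2) d(4) 4 5 this]
    have s2': "s2 (Inl k) = enc_names (popped ks t k)" for k
      using t[of k] by (auto simp: s2(2) n(2) popped_def moved_def s image_iff)
    have "r = enc_state (i, pushed n ls (popped ks t))"
    proof (rule enc_state_eqI)
      show "r (Inl k) = enc_names (pushed n ls (popped ks t) k)" for k
        by (auto simp: r s3 pushed_def s2' image_iff)
      show "r (Inr True) = map Some i" 
        by (auto simp: r s3 s2(2) n(2) pushed_def popped_def moved_def s)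
    qed (rule 5)
    moreover have "sem a s (i, pushed n ls (popped ks t))"
      unfolding Names s sem.simps using t by blast
    ultimately show ?thesis by blast
  next
    case (RdName b k)
    let ?X = "Inr True :: 'a + bool" and ?T = "Inr False :: 'a + bool"
    let ?s0 = "(enc_state s)(Inl k := None # enc_names (t k))"
    obtain s0 s1 s1' s1'' s2 r1 r1' where 0: "den app (Act (Push (Inl k) None)) (enc_state s) s0"
      and 1: "den app (Star (Seq (Act (Pop ?X (Some True))) (move_bit ?X ?T))) s0 s1"
      and can: "den app (Alt (Act (Empty ?T)) (Seq (Act (Pop ?T (Some True))) (Act (Push ?T (Some True))))) s1 s1'"
      and 2: "den app (Act (Pop ?X (Some False))) s1' s1''" "den app (Act (Pop ?X (Some False))) s1'' s2"
      and 3: "den app (move_bits [?T] [Inl k]) s2 r1" and 4: "den app (Act (Empty ?T)) r1 r1'"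
      and r: "den app (Act (Push (Inl k) (Some b))) r1' r"
      using assms(2) unfolding RdName impl.simps seqs.simps den_Seq_iff den.simps(1) by blast
    have s0: "s0 = ?s0" using 0 s by simp
    note 1 = 1[unfolded s0]
    have can: "s1 ?T = [] \<or> (\<exists>q. s1 ?T = Some True # q)" and "s1' = s1"
      using can by (auto simp: OO_def)
    then have 2: "\<exists>q. s1 ?X = Some False # Some False # q \<and> s2 = s1(?X := q)"
      using 2 by auto
    have 3: "den app (move_bits [?T] [Inl k]) s2 r1" "r1 ?T = []"
      and r: "r = r1(Inl k := Some b # r1 (Inl k))"
      using 3 4 r by auto
    obtain bs p where bs: "?s0 ?X = map Some (concat (map (\<lambda>b. [True, b]) bs)) @ p"
      "s1 = ?s0(?X := p, ?T := rev (map Some bs) @ ?s0 ?T)"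
      using den_read_pairs[OF _ 1] by auto
    \<comment> \<open>The scratch stack holds the bits in reverse, so the test on its top concerns
      the last bit.\<close>
    have "bs = [] \<or> last bs"
      using can s by (cases bs rule: rev_cases) (auto simp: bs(2))
    then obtain n where n: "bs = bin n" using bin_canonical by metis
    obtain q where q: "p = Some False # Some False # q" "s2 = s1(?X := q)" using 2 bs(2) by auto
    obtain j where j: "i = concat (map (\<lambda>b. [True, b]) bs) @ j" "p = map Some j"
      using bs(1) s by (auto simp: map_Some_split)
    then obtain j' where j': "i = enc_nat n @ j'" "q = map Some j'"
      using q(1) n by (auto simp: enc_nat_def)
    have "s2 ?T = rev (map Some bs)" using s by (simp add: q(2) bs(2))
    from den_unload[OF _ _ 3 this] have r1: "r1 = (\<lambda>k'. if k' = ?T then [] else if k' \<in> set [Inl k] then map Some bs @ s2 k' else s2 k')" by simp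
    have "r = enc_state (j', t(k := (b # bin n) # t k))"
      by (rule enc_state_eqI) (auto simp: r r1 q(2) bs(2) s n j')
    then show ?thesis using RdName s j' by auto
  next
    case (Inc k)
    let ?T = "Inr False :: 'a + bool" and ?k = "Inl k :: 'a + bool"
    have "\<exists>q. enc_state s ?k = Some True # q"
      using assms(2) unfolding Inc impl.simps seqs.simps den_Seq_iff den.simps(2) app.simps by blast
    then obtain q where q: "enc_names (t k) = Some True # q" using s by auto
    then obtain bs ms where t: "t k = (True # bs) # ms" "q = map Some bs @ None # enc_names ms"
      by (cases "t k"; cases "hd (t k)") auto
    let ?s0 = "(enc_state s)(?k := q)"
    obtain s0 s1 s1' s2 r1 r1' where 0: "den app (Act (Pop ?k (Some True))) (enc_state s) s0"
      and 1: "den app (Star (Seq (Act (Pop ?k (Some True))) (Act (Push ?T (Some False))))) s0 s1"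
      and alt: "den app (Act (Pop ?k (Some False))) s1 s1' \<or>
        den app (seqs [Act (Pop ?k None), Act (Push ?k None)]) s1 s1'"
      and push: "den app (Act (Push ?T (Some True))) s1' s2"
      and 3: "den app (move_bits [?T] [?k]) s2 r1" and 4: "den app (Act (Empty ?T)) r1 r1'"
      and r: "den app (Act (Push ?k (Some True))) r1' r"
      using assms(2) unfolding Inc impl.simps seqs.simps den_Seq_iff den_Alt_iff den.simps(1) by blast
    have s0: "s0 = ?s0" using 0 s q by auto
    note 1 = 1[unfolded s0]
    have 2: "(\<exists>p. s1 ?k = Some False # p \<and> s2 = s1(?k := p, ?T := Some True # s1 ?T)) \<or>
        (\<exists>p. s1 ?k = None # p \<and> s2 = s1(?k := None # p, ?T := Some True # s1 ?T))"
      using alt push by (auto simp: OO_def)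
    have 3: "den app (move_bits [?T] [?k]) s2 r1" "r1 ?T = []"
      and r: "r = r1(?k := Some True # r1 ?k)"
      using 3 4 r by auto
    obtain j p where j: "?s0 ?k = replicate j (Some True) @ p"
      "s1 = ?s0(?k := p, ?T := replicate j (Some False) @ ?s0 ?T)"
      using den_carry[OF _ 1] by auto
    \<comment> \<open>The end mark is not a bit, so the carry loop cannot run past the end of the
      name.\<close>
    have "\<exists>b2. bs = replicate j True @ b2 \<and> p = map Some b2 @ None # enc_names ms"
      using j(1) t(2)
    proof (induction j arbitrary: bs q)
      case (Suc j)
      then obtain bs' where "bs = True # bs'" by (cases bs) auto
      with Suc show ?case by auto
    qed auto
    then obtain b2 where b2: "bs = replicate j True @ b2" "p = map Some b2 @ None # enc_names ms" by blast
    obtain b3 where b3: "s2 = s1(?k := map Some b3 @ None # enc_names ms, ?T := Some True # s1 ?T)"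
      "bsucc bs = replicate j False @ True # b3"
    proof (cases b2)
      case Nil
      then show ?thesis using that[of "[]"] 2 b2 j(2) bsucc_run(2)[of j] by auto
    next
      case (Cons b b3)
      then show ?thesis using that[of b3] 2 b2 j(2) bsucc_run(1)[of j b3] by auto
    qed
    have "s2 ?T = rev (map Some (replicate j False @ [True]))" using s by (simp add: b3 j(2))
    from den_unload[OF _ _ 3 this] have r1: "r1 = (\<lambda>k'. if k' = ?T then [] else if k' \<in> set [?k] then map Some (replicate j False @ [True]) @ s2 k' else s2 k')" by simp
    have "r = enc_state (i, t(k := (True # bsucc bs) # ms))"
      by (rule enc_state_eqI) (auto simp: r r1 b3 j(2) s)
    then show ?thesis using Inc s t by auto
  qed
qed

lemma exec_SeqI: "exec A c s m s' \<Longrightarrow> exec A d s' n s'' \<Longrightarrow> exec A (Seq c d) s (m + n + 1) s''"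
  by (rule exec_Seq) auto

lemma exec_app: "app a s s' \<Longrightarrow> exec appc (Act a) s 1 s'"
  by (rule exec_Act) auto

lemma exec_unload:
  assumes "distinct ls" "t \<notin> set ls" "s t = rev (map Some bs)"
  shows "exec appc (move_bits [t] ls) s (length bs * (2 * length ls + 6) + 1)
    (\<lambda>k. if k = t then [] else if k \<in> set ls then map Some bs @ s k else s k)"
proof -
  have "has_prefix (map Some (rev bs)) [t] s" using assms(3) by (simp add: has_prefix_def rev_map)
  from exec_move_bits[OF _ assms(1) _ this] assms(2)
  have "exec appc (move_bits [t] ls) s (length bs * (2 * length ls + 6) + 1) (moved (map Some (rev bs)) [t] ls s)"
    by (simp add: algebra_simps)
  moreover have "moved (map Some (rev bs)) [t] ls s =
    (\<lambda>k. if k = t then [] else if k \<in> set ls then map Some bs @ s k else s k)"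
    using assms(3) by (simp add: moved_def fun_eq_iff rev_map[symmetric])
  ultimately show ?thesis by simp
qed

lemma exec_read_pairs:
  assumes "k \<noteq> l"
  shows "s k = map Some (concat (map (\<lambda>b. [True, b]) bs)) @ r \<Longrightarrow>
    exec appc (Star (Seq (Act (Pop k (Some True))) (move_bit k l))) s (8 * length bs + 1)
      (s(k := r, l := rev (map Some bs) @ s l))"
proof (induction bs arbitrary: s)
  case Nil
  then have "s(k := r, l := rev (map Some []) @ s l) = s" by (simp add: fun_eq_iff)
  then show ?case using exec_Star0[of 1] by (metis list.size(3) mult_0_right add_0 order_refl)
next
  case (Cons b bs)
  define q where "q = map Some (concat (map (\<lambda>b. [True, b]) bs)) @ r"
  have k: "s k = Some True # Some b # q" using Cons.prems by (simp add: q_def)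
  have 1: "exec appc (Act (Pop k (Some True))) s 1 (s(k := Some b # q))"
    using k by (intro exec_app) simp
  have "exec appc (Seq (Act (Pop k (Some b))) (Act (Push l (Some b)))) (s(k := Some b # q)) (1 + 1 + 1) (s(k := q, l := Some b # s l))"
    using assms by (intro exec_SeqI[of _ _ _ _ "s(k := q)"] exec_app) (auto simp: fun_eq_iff)
  then have 2: "exec appc (move_bit k l) (s(k := Some b # q)) 4 (s(k := q, l := Some b # s l))"
    unfolding move_bit_def by (cases b) (auto intro: exec_Alt1 exec_Alt2)
  let ?s = "s(k := q, l := Some b # s l)"
  have 3: "?s k = map Some (concat (map (\<lambda>b. [True, b]) bs)) @ r" using assms by (simp add: q_def)
  have "?s(k := r, l := rev (map Some bs) @ ?s l) = s(k := r, l := rev (map Some (b # bs)) @ s l)"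
    by (simp add: fun_eq_iff)
  note 4 = exec_Star1[OF exec_SeqI[OF 1 2] Cons.IH[of ?s, OF 3], unfolded this]
  show ?case by (rule 4) simp
qed

lemma exec_carry:
  assumes "k \<noteq> l"
  shows "s k = replicate j (Some True) @ r \<Longrightarrow>
    exec appc (Star (Seq (Act (Pop k (Some True))) (Act (Push l (Some False))))) s (5 * j + 1)
      (s(k := r, l := replicate j (Some False) @ s l))"
proof (induction j arbitrary: s)
  case 0
  then have "s(k := r, l := replicate 0 (Some False) @ s l) = s" by (simp add: fun_eq_iff)
  then show ?case using exec_Star0[of 1] by (metis mult_0_right add_0 order_refl)
next
  case (Suc j)
  define q where "q = replicate j (Some True) @ r"
  have k: "s k = Some True # q" using Suc.prems by (simp add: q_def)
  have "exec appc (Seq (Act (Pop k (Some True))) (Act (Push l (Some False)))) s (1 + 1 + 1) (s(k := q, l := Some False # s l))"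
    using assms k by (intro exec_SeqI[of _ _ _ _ "s(k := q)"] exec_app) (auto simp: fun_eq_iff)
  note 1 = this
  let ?s = "s(k := q, l := Some False # s l)"
  have 2: "?s k = replicate j (Some True) @ r" using assms by (simp add: q_def)
  have "?s(k := r, l := replicate j (Some False) @ ?s l) = s(k := r, l := replicate (Suc j) (Some False) @ s l)"
    by (simp add: fun_eq_iff replicate_app_Cons_same)
  note 3 = exec_Star1[OF 1 Suc.IH[of ?s, OF 2], unfolded this]
  show ?case by (rule 3) simp
qed

text \<open>This bounds the lengths of names and not their number: an action touches only the names
  on top, so its cost depends on lengths alone.\<close>

fun bounded :: "nat \<Rightarrow> 'k name_state \<Rightarrow> bool" where
  "bounded b (i, t) \<longleftrightarrow> length i \<le> b \<and> (\<forall>k. \<forall>n \<in> set (t k). length n \<le> b)"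

lemma bounded_mono: "bounded b s \<Longrightarrow> b \<le> b' \<Longrightarrow> bounded b' s"
  by (cases s) (use le_trans in fastforce)

lemma length_enc_nat: "length (enc_nat n) = 2 * length (bin n) + 2"
proof -
  have "length (concat (map (\<lambda>b. [True, b]) bs)) = 2 * length bs" for bs :: "bool list"
    by (induction bs) auto
  then show ?thesis by (simp add: enc_nat_def)
qed

lemma bounded_sem:
  assumes "sem a s s'" "name_act_wf a" "bounded b s"
  shows "bounded (b + 1) s'"
proof -
  obtain i t where s: "s = (i, t)" by (cases s)
  have t: "length n \<le> b" if "n \<in> set (t k)" for n k using assms(3) that s by auto
  have i: "length i \<le> b" using assms(3) s by simp
  show ?thesis
  proof (cases a)
    case (Names ks ls)
    then obtain n where n: "\<forall>k \<in> set ks. \<exists>r. t k = n # r" "s' = (i, pushed n ls (popped ks t))"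
      using assms(1) s by auto
    obtain k where "k \<in> set ks" using assms(2) Names by (cases ks) auto
    with n(1) have "length n \<le> b" using t[of n k] by fastforce
    moreover have "m \<in> set xs" if "m \<in> set (tl xs)" for m and xs :: "bool list list"
      using that by (cases xs) auto
    then have "length m \<le> b" if "m \<in> set (popped ks t k)" for m k
      using that t by (auto simp: popped_def split: if_splits)
    ultimately show ?thesis using i unfolding n(2) by (auto simp: pushed_def le_SucI)
  next
    case (RdName c k)
    then obtain n r where n: "i = enc_nat n @ r" "s' = (r, t(k := (c # bin n) # t k))"
      using assms(1) s by auto
    then have "length (bin n) \<le> b" "length r \<le> b" using i by (auto simp: length_enc_nat)
    then show ?thesis using n(2) t by (auto simp: le_SucI)
  next
    case (Inc k)
    then obtain bs r where n: "t k = (True # bs) # r" "s' = (i, t(k := (True # bsucc bs) # r))"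
      using assms(1) s by auto
    then have "Suc (length bs) \<le> b" using t[of "True # bs" k] by simp
    then have "length (bsucc bs) \<le> b" using length_bsucc[of bs] by simp
    moreover have "length m \<le> Suc b" if "m \<in> set r" for m using t[of m k] n(1) that by (simp add: le_SucI)
    ultimately show ?thesis using n(2) t i by (auto simp: le_SucI)
  next
    case (PopE k)
    then obtain r where n: "t k = [] # r" "s' = (i, t(k := r))" using assms(1) s by auto
    then have "length m \<le> Suc b" if "m \<in> set r" for m using t[of m k] that by (simp add: le_SucI)
    then show ?thesis using n(2) t i by (auto simp: le_SucI)
  qed (use assms(1) s t i in \<open>auto simp: le_SucI\<close>)
qed

lemma bind_cost_ge: "1 \<le> m \<Longrightarrow> n \<le> 40 * (b + 1) * m \<Longrightarrow> n \<le> bind_cost 40 b m"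
  unfolding bind_cost_def by (erule le_trans) (intro mult_le_mono; simp)

lemma bind_cost_ge_40:
  assumes "1 \<le> m" "n \<le> 40 * (b + 1)" shows "n \<le> bind_cost 40 b m"
proof -
  have "40 * (b + 1) * 1 \<le> 40 * (b + 1) * m" using assms(1) by (intro mult_le_mono) auto
  then show ?thesis using assms by (intro bind_cost_ge) linarith+
qed

text \<open>The constant 40 dominates 13 j + 35 for \<open>Inc\<close>, 16 l + 30 for
  \<open>RdName\<close> with a numeral of l bits, and 14 b m plus smaller terms for
  \<open>Names\<close>.\<close>

lemma impl_exec:
  assumes wf: "name_act_wf a" and sem: "sem a s s'" and m: "weight a \<le> m" and bd: "bounded b s"
  shows "exec appc (impl a) (enc_state s) (bind_cost 40 b m) (enc_state s')"
proof -
  obtain i t where s: "s = (i, t)" by (cases s)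
  have m1: "1 \<le> m" using m by (cases a) auto
  have one: "exec appc (Act c) (enc_state s) (bind_cost 40 b m) (enc_state s')"
    if "app c (enc_state s) (enc_state s')" for c
    by (rule exec_mono[OF exec_app[OF that] bind_cost_ge]) (use m1 in auto)
  show ?thesis
  proof (cases a)
    case (Rd c)
    then obtain r where r: "i = c # r" "s' = (r, t)" using sem s by auto
    have "(enc_state s)(Inr True := map Some r) = enc_state s'"
      unfolding r(2) by (rule enc_state_eqI) (auto simp: s)
    from this[symmetric] r s have "app (Pop (Inr True) (Some c)) (enc_state s) (enc_state s')" by auto
    from one[OF this] Rd show ?thesis by simp
  next
    case RdEnd
    with sem s one[of "Empty (Inr True)"] show ?thesis by simp
  next
    case (PushE k)
    then have s': "s' = (i, t(k := [] # t k))" using sem s by simp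
    have "enc_state s' = (enc_state s)(Inl k := None # enc_state s (Inl k))"
      unfolding s' by (rule enc_state_eqI[symmetric]) (auto simp: s)
    then have "app (Push (Inl k) None) (enc_state s) (enc_state s')" by simp
    from one[OF this] PushE show ?thesis by simp
  next
    case (PopE k)
    then obtain r where r: "t k = [] # r" "s' = (i, t(k := r))" using sem s by auto
    have "(enc_state s)(Inl k := enc_names r) = enc_state s'"
      unfolding r(2) by (rule enc_state_eqI) (auto simp: s)
    from this[symmetric] r s have "app (Pop (Inl k) None) (enc_state s) (enc_state s')" by auto
    from one[OF this] PopE show ?thesis by simp
  next
    case (IsEmp k)
    with sem s one[of "Empty (Inl k)"] show ?thesis by simp
  next
    case (PushZ k)
    then have s': "s' = (i, t(k := [True] # t k))" using sem s by simp
    have "enc_state s' = (enc_state s)(Inl k := Some True # None # enc_state s (Inl k))"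
      unfolding s' by (rule enc_state_eqI[symmetric]) (auto simp: s)
    then have "exec appc (impl a) (enc_state s) (1 + (1 + 0 + 1) + 1) (enc_state s')"
      unfolding PushZ impl.simps seqs.simps
      by (intro exec_SeqI[of _ _ _ _ "(enc_state s)(Inl k := None # enc_state s (Inl k))"]
          exec_SeqI[of _ _ _ _ "enc_state s'"] exec_app exec_Skip) auto
    then show ?thesis by (rule exec_mono[OF _ bind_cost_ge_40[OF m1]]) simp
  next
    case (Names ks ls)
    let ?ks = "map Inl ks :: ('a + bool) list" and ?ls = "map Inl ls :: ('a + bool) list"
    have d: "distinct ?ks" "distinct ?ls" "Inr False \<notin> set ?ks" "Inr False \<notin> set ?ls"
      using wf Names by (auto simp: distinct_map)
    obtain n where n: "\<forall>k \<in> set ks. \<exists>r. t k = n # r" "s' = (i, pushed n ls (popped ks t))"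
      using sem s Names by auto
    define s1 where "s1 = moved (map Some n) ?ks [Inr False] (enc_state s)"
    define s2 where "s2 = popped ?ks s1"
    define s3 where "s3 = pushed None ?ls s2"
    have "has_prefix (map Some n) ?ks (enc_state s)"
      using n(1) s by (fastforce simp: has_prefix_def)
    from exec_move_bits[OF d(1) _ _ this, of "[Inr False]"] d
    have 1: "exec appc (move_bits ?ks [Inr False]) (enc_state s) (length n * (2 * length ks + 6) + 1) s1"
      by (simp add: s1_def algebra_simps)
    have "\<forall>k \<in> set ?ks. \<exists>r. s1 k = None # r"
      using n(1) by (fastforce simp: s1_def moved_def s)
    from exec_pop_all[OF d(1) this]
    have 2: "exec appc (pop_all None ?ks) s1 (2 * length ks) s2" by (simp add: s2_def)
    from exec_push_all[OF d(2)]
    have 3: "exec appc (push_all None ?ls) s2 (2 * length ls) s3" by (simp add: s3_def)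
    have "s3 (Inr False) = rev (map Some n)"
      using d by (auto simp: s3_def s2_def s1_def pushed_def popped_def moved_def s)
    from exec_unload[of ?ls "Inr False" s3 n, OF d(2) d(4) this]
    have 4: "exec appc (move_bits [Inr False] ?ls) s3 (length n * (2 * length ls + 6) + 1)
      (\<lambda>k. if k = Inr False then [] else if k \<in> set ?ls then map Some n @ s3 k else s3 k)" by simp
    have "s2 (Inl k) = enc_names (popped ks t k)" for k
      using n(1) by (fastforce simp: s2_def s1_def popped_def moved_def s image_iff)
    then have e: "(\<lambda>k. if k = Inr False then [] else if k \<in> set ?ls then map Some n @ s3 k else s3 k) = enc_state s'"
      unfolding n(2) by (intro enc_state_eqI)
        (auto simp: s3_def s2_def s1_def pushed_def popped_def moved_def s image_iff)
    have 5: "exec appc (Act (Empty (Inr False))) (enc_state s') 1 (enc_state s')"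
      by (rule exec_app) (simp add: n(2))
    have "length n \<le> b"
    proof -
      obtain k where "k \<in> set ks" using wf Names by (cases ks) auto
      with n(1) have "n \<in> set (t k)" by fastforce
      then show ?thesis using bd s by auto
    qed
    show ?thesis unfolding Names impl.simps seqs.simps
    proof (rule exec_mono)
      show "exec appc (Seq (move_bits ?ks [Inr False]) (Seq (pop_all None ?ks) (Seq (push_all None ?ls)
        (Seq (move_bits [Inr False] ?ls) (Seq (Act (Empty (Inr False))) Skip))))) (enc_state s)
        (length n * (2 * length ks + 6) + 1 + (2 * length ks + (2 * length ls +
          (length n * (2 * length ls + 6) + 1 + (1 + 0 + 1) + 1) + 1) + 1) + 1) (enc_state s')"
        by (intro exec_SeqI[OF 1] exec_SeqI[OF 2] exec_SeqI[OF 3] exec_SeqI[OF 4[unfolded e]]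
            exec_SeqI[OF 5] exec_Skip)
      have "length n * (2 * length ks + 6) + length n * (2 * length ls + 6) = length n * (2 * length ks + 2 * length ls + 12)"
        by (simp add: algebra_simps)
      also have "\<dots> \<le> b * (14 * m)"
        using m Names \<open>length n \<le> b\<close> by (intro mult_le_mono) auto
      finally have "length n * (2 * length ks + 6) + length n * (2 * length ls + 6) \<le> 14 * (b * m)" by simp
      then show "length n * (2 * length ks + 6) + 1 + (2 * length ks + (2 * length ls +
          (length n * (2 * length ls + 6) + 1 + (1 + 0 + 1) + 1) + 1) + 1) + 1 \<le> bind_cost 40 b m"
        using m Names by (intro bind_cost_ge m1) (simp add: algebra_simps)
    qed
  next
    case (RdName c k)
    let ?X = "Inr True :: 'a + bool" and ?T = "Inr False :: 'a + bool"
    obtain n r where n: "i = enc_nat n @ r" "s' = (r, t(k := (c # bin n) # t k))" using sem s RdName by auto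
    define s0 where "s0 = (enc_state s)(Inl k := None # enc_names (t k))"
    define p where "p = Some False # Some False # map Some r"
    define s1 where "s1 = s0(?X := p, ?T := rev (map Some (bin n)))"
    define s2 where "s2 = s1(?X := map Some r)"
    define s3 where "s3 = (\<lambda>j. if j = ?T then [] else if j \<in> set [Inl k] then map Some (bin n) @ s2 j else s2 j)"
    have 0: "exec appc (Act (Push (Inl k) None)) (enc_state s) 1 s0"
      by (rule exec_app) (simp add: s0_def s)
    have "s0 ?X = map Some (concat (map (\<lambda>b. [True, b]) (bin n))) @ p"
      using n(1) by (simp add: s0_def s p_def enc_nat_def)
    from exec_read_pairs[of ?X ?T s0 "bin n" p, OF _ this]
    have 1: "exec appc (Star (Seq (Act (Pop ?X (Some True))) (move_bit ?X ?T))) s0 (8 * length (bin n) + 1) s1"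
      by (simp add: s1_def s0_def s)
    have 2: "exec appc (Alt (Act (Empty ?T)) (Seq (Act (Pop ?T (Some True))) (Act (Push ?T (Some True))))) s1 4 s1"
    proof (cases "bin n" rule: rev_cases)
      case Nil
      then have "exec appc (Act (Empty ?T)) s1 1 s1" by (intro exec_app) (simp add: s1_def)
      then show ?thesis by (rule exec_Alt1) simp
    next
      case (snoc bs x)
      then have x using bin_canonical[of "bin n"] by fastforce
      then have q: "s1 ?T = Some True # rev (map Some bs)" using snoc by (simp add: s1_def)
      have "exec appc (Seq (Act (Pop ?T (Some True))) (Act (Push ?T (Some True)))) s1 (1 + 1 + 1) s1"
        using q by (intro exec_SeqI[of _ _ _ _ "s1(?T := rev (map Some bs))"] exec_app) (auto simp: fun_eq_iff)
      then show ?thesis by (rule exec_Alt2) simp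
    qed
    have 3: "exec appc (Act (Pop ?X (Some False))) s1 1 (s1(?X := tl p))"
      by (rule exec_app) (simp add: s1_def p_def)
    have 4: "exec appc (Act (Pop ?X (Some False))) (s1(?X := tl p)) 1 s2"
      by (rule exec_app) (simp add: s2_def p_def)
    have 5: "exec appc (move_bits [?T] [Inl k]) s2 (length (bin n) * 8 + 1) s3"
      using exec_unload[of "[Inl k]" ?T s2 "bin n"] by (simp add: s3_def s2_def s1_def)
    have 6: "exec appc (Act (Empty ?T)) s3 1 s3"
      by (rule exec_app) (simp add: s3_def)
    have e: "s3(Inl k := Some c # s3 (Inl k)) = enc_state s'"
      unfolding n(2) by (rule enc_state_eqI) (auto simp: s3_def s2_def s1_def s0_def s)
    have 7: "exec appc (Act (Push (Inl k) (Some c))) s3 1 (enc_state s')"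
      by (rule exec_app) (simp add: e[symmetric])
    have "length (bin n) \<le> b" using bd s n(1) by (simp add: length_enc_nat)
    then have "16 * length (bin n) + 30 \<le> 40 * (b + 1)" by simp
    note le = bind_cost_ge_40[OF m1 this]
    show ?thesis unfolding RdName impl.simps seqs.simps
      by (rule exec_mono[OF _ le], rule exec_mono, rule exec_SeqI[OF 0 exec_SeqI[OF 1 exec_SeqI[OF 2 exec_SeqI[OF 3
        exec_SeqI[OF 4 exec_SeqI[OF 5 exec_SeqI[OF 6 exec_SeqI[OF 7 exec_Skip[of _ _ 0]]]]]]]]]) simp
  next
    case (Inc k)
    let ?T = "Inr False :: 'a + bool" and ?k = "Inl k :: 'a + bool"
    obtain bs r where n: "t k = (True # bs) # r" "s' = (i, t(k := (True # bsucc bs) # r))" using sem s Inc by auto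
    \<comment> \<open>The bits are split at the first zero, if there is one: the carry runs through
      \<open>j\<close> ones, and \<open>b3\<close> is the part that it leaves unchanged.\<close>
    obtain j b2 b3 where j: "bs = replicate j True @ b2" "bsucc bs = replicate j False @ True # b3"
      "b2 = [] \<and> b3 = [] \<or> b2 = False # b3"
    proof -
      have "\<exists>j b2. bs = replicate j True @ b2 \<and> (b2 = [] \<or> hd b2 = False)"
      proof (induction bs)
        case (Cons x bs)
        then obtain j b2 where j: "bs = replicate j True @ b2" "b2 = [] \<or> hd b2 = False" by blast
        show ?case
        proof (cases x)
          case True
          with j show ?thesis by (intro exI[of _ "Suc j"] exI[of _ b2]) simp
        next
          case False
          then show ?thesis by (intro exI[of _ 0] exI[of _ "x # bs"]) simp
        qed
      qed auto
      then obtain j b2 where "bs = replicate j True @ b2" "b2 = [] \<or> hd b2 = False" by blast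
      then show ?thesis using that[of j b2 "tl b2"] bsucc_run by (cases b2) auto
    qed
    define p where "p = map Some b2 @ None # enc_names r"
    define p' where "p' = map Some b3 @ None # enc_names r"
    define s0 where "s0 = (enc_state s)(?k := map Some bs @ None # enc_names r)"
    define s1 where "s1 = s0(?k := p, ?T := replicate j (Some False))"
    define s2 where "s2 = s1(?k := p', ?T := Some True # replicate j (Some False))"
    define s3 where "s3 = (\<lambda>l. if l = ?T then [] else if l \<in> set [?k] then map Some (replicate j False @ [True]) @ s2 l else s2 l)"
    have 0: "exec appc (Act (Pop ?k (Some True))) (enc_state s) 1 s0"
      by (rule exec_app) (simp add: s0_def s n)
    have "s0 ?k = replicate j (Some True) @ p" by (simp add: s0_def p_def j(1))
    from exec_carry[of ?k ?T s0 j p, OF _ this]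
    have 1: "exec appc (Star (Seq (Act (Pop ?k (Some True))) (Act (Push ?T (Some False))))) s0 (5 * j + 1) s1"
      by (simp add: s1_def s0_def s)
    have 2: "exec appc (Alt (Act (Pop ?k (Some False))) (seqs [Act (Pop ?k None), Act (Push ?k None)])) s1 5 (s1(?k := p'))"
      using j(3)
    proof
      assume "b2 = False # b3"
      then have "exec appc (Act (Pop ?k (Some False))) s1 1 (s1(?k := p'))"
        by (intro exec_app) (simp add: s1_def p_def p'_def)
      then show ?thesis by (rule exec_Alt1) simp
    next
      assume "b2 = [] \<and> b3 = []"
      then have "exec appc (seqs [Act (Pop ?k None), Act (Push ?k None)]) s1 (1 + (1 + 0 + 1) + 1) (s1(?k := p'))"
        unfolding seqs.simps by (intro exec_SeqI[of _ _ _ _ "s1(?k := enc_names r)"]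
            exec_SeqI[of _ _ _ _ "s1(?k := p')"] exec_app exec_Skip) (simp_all add: s1_def p_def p'_def)
      then show ?thesis by (rule exec_Alt2) simp
    qed
    have 3: "exec appc (Act (Push ?T (Some True))) (s1(?k := p')) 1 s2"
      by (rule exec_app) (simp add: s2_def s1_def)
    have "s2 ?T = rev (map Some (replicate j False @ [True]))" by (simp add: s2_def)
    from exec_unload[of "[?k]" ?T s2 "replicate j False @ [True]", OF _ _ this]
    have 5: "exec appc (move_bits [?T] [?k]) s2 ((j + 1) * 8 + 1) s3" by (simp add: s3_def)
    have 6: "exec appc (Act (Empty ?T)) s3 1 s3"
      by (rule exec_app) (simp add: s3_def)
    have e: "s3(?k := Some True # s3 ?k) = enc_state s'"
      unfolding n(2) by (rule enc_state_eqI) (auto simp: s3_def s2_def s1_def s0_def s p'_def j(2))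
    have 7: "exec appc (Act (Push ?k (Some True))) s3 1 (enc_state s')"
      by (rule exec_app) (simp add: e[symmetric])
    have "(True # bs) \<in> set (t k)" using n(1) by simp
    then have "length (True # bs) \<le> b" using bd unfolding s bounded.simps by blast
    then have "j \<le> b" by (simp add: j(1))
    then have "13 * j + 35 \<le> 40 * (b + 1)" by simp
    note le = bind_cost_ge_40[OF m1 this]
    show ?thesis unfolding Inc impl.simps seqs.simps
      by (rule exec_mono[OF _ le], rule exec_mono, rule exec_SeqI[OF 0 exec_SeqI[OF 1
        exec_SeqI[OF 2[unfolded seqs.simps] exec_SeqI[OF 3
        exec_SeqI[OF 5 exec_SeqI[OF 6 exec_SeqI[OF 7 exec_Skip[of _ _ 0]]]]]]]]) simp
  qed
qed


lemma exec_impl: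
  assumes "exec semc c s n s'" "\<forall>a \<in> set_cmd c. name_act_wf a" "bounded b s"
  shows "exec appc (bind impl c) (enc_state s) (bind_cost 40 b n) (enc_state s')"
proof -
  have "bounded (b + m) s' \<and> exec appc (impl a) (enc_state s) (bind_cost 40 b m) (enc_state s')"
    if "a \<in> set_cmd c" "semc a s m s'" "bounded b s" for a s m s' b
  proof -
    have "1 \<le> m" using that(2) by (cases a) (auto simp: semc_def)
    then show ?thesis
      using that assms(2) bounded_sem[of a s s' b] impl_exec[of a s s' m b] bounded_mono[of "b + 1" s' "b + m"]
      by (auto simp: semc_def)
  qed
  from exec_bind[of c semc bounded appc impl enc_state 40, OF this _ bounded_mono assms(1,3)]
  show ?thesis by auto
qed

text \<open>The machine loads its input in reverse onto the scratch stack.\<close>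

definition with_input :: "('k + bool, bool option) act cmd \<Rightarrow> ('k + bool, bool option) act cmd" where
  "with_input c = Seq (move_bits [Inr False] [Inr True]) (Seq (Act (Empty (Inr False))) c)"

lemma init_enc_state:
  "(\<lambda>k. if k = Inr False then [] else if k \<in> set [Inr True] then map Some x @ init_stacks (Inr False) Some x k
     else init_stacks (Inr False) Some x k) = enc_state (x, \<lambda>_. [])"
  by (rule enc_state_eqI) (auto simp: init_stacks_def)

text \<open>Bounds in \<open>in_NP\<close> have the form c n^d + c, where n may be 0; this absorbs a
  power of n + 1.\<close>

lemma poly_le:
  fixes n c d :: nat
  shows "c * (n + 1) ^ d \<le> c * 2 ^ d * n ^ d + c * 2 ^ d"
proof (cases "n = 0")
  case False
  then have "(n + 1) ^ d \<le> (2 * n) ^ d" by (intro power_mono) auto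
  then have "c * (n + 1) ^ d \<le> c * (2 * n) ^ d" by (rule mult_le_mono2)
  also have "\<dots> = c * 2 ^ d * n ^ d" by (simp add: power_mult_distrib)
  finally show ?thesis by (rule trans_le_add1)
qed (simp add: trans_le_add2)

theorem in_NP_name_program:
  fixes c :: "'k::finite name_act cmd"
  assumes wf: "\<forall>a \<in> set_cmd c. name_act_wf a"
    and sound: "\<And>x s'. den sem c (x, \<lambda>_. []) s' \<Longrightarrow> x \<in> L"
    and complete: "\<And>x. x \<in> L \<Longrightarrow> \<exists>n s'. n \<le> C * (length x + 1) ^ D \<and> exec semc c (x, \<lambda>_. []) n s'"
  shows "in_NP L"
proof (rule in_NP_stack_program[where em = Some and ?k0.0 = "Inr False" and ?c0.0 = "with_input (bind impl c)"])
  fix x s' assume "den app (with_input (bind impl c)) (init_stacks (Inr False) Some x) s'"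
  then obtain q where 1: "den app (move_bits [Inr False] [Inr True]) (init_stacks (Inr False) Some x) q"
    "q (Inr False) = []" and 2: "den app (bind impl c) q s'"
    unfolding with_input_def den_Seq_iff by auto
  have "q = (\<lambda>k. if k = Inr False then [] else if k \<in> set [Inr True] then map Some x @ init_stacks (Inr False) Some x k
     else init_stacks (Inr False) Some x k)"
    by (rule den_unload[OF _ _ 1]) (simp_all add: init_stacks_def)
  then have "q = enc_state (x, \<lambda>_. [])" unfolding init_enc_state .
  with den_bind[of c app impl enc_state sem, OF impl_sound] 2 wf show "x \<in> L" using sound by blast
next
  fix x assume "x \<in> L"
  from complete[OF this] obtain n s' where n: "n \<le> C * (length x + 1) ^ D" "exec semc c (x, \<lambda>_. []) n s'" by blast
  define P where "P = length x + 1"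
  \<comment> \<open>\<open>Q\<close> bounds |x| + n + 1, so both factors of \<open>bind_cost\<close>
    are linear in \<open>Q\<close>. The total is quadratic in \<open>Q\<close>, which gives the
    degree 2 D + 2.\<close>
  define Q where "Q = (C + 1) * P ^ (D + 1)"
  have "bounded (length x) (x, \<lambda>_. [])" by simp
  from exec_impl[OF n(2) wf this]
  have 3: "exec appc (bind impl c) (enc_state (x, \<lambda>_. [])) (bind_cost 40 (length x) n) (enc_state s')" .
  have 1: "exec appc (move_bits [Inr False] [Inr True]) (init_stacks (Inr False) Some x) (length x * 8 + 1) (enc_state (x, \<lambda>_. []))"
    using exec_unload[of "[Inr True]" "Inr False" "init_stacks (Inr False) Some x" x]
    by (simp only: init_enc_state) (simp add: init_stacks_def rev_map)
  have 2: "exec appc (Act (Empty (Inr False))) (enc_state (x, \<lambda>_. [])) 1 (enc_state (x, \<lambda>_. []))"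
    by (rule exec_app) simp
  have P: "P ^ 1 \<le> P ^ (D + 1)" "P ^ D \<le> P ^ (D + 1)" by (intro power_increasing; simp add: P_def)+
  have "n \<le> C * P ^ (D + 1)" using n(1) mult_le_mono2[OF P(2), of C] unfolding P_def by linarith
  moreover have "length x + 1 \<le> P ^ (D + 1)" using P(1) by (simp add: P_def)
  moreover have "Q = C * P ^ (D + 1) + P ^ (D + 1)" by (simp only: Q_def add_mult_distrib mult_1)
  ultimately have "length x + n + 1 \<le> Q" by linarith
  then have "40 * (length x + n + 1) * (2 * n + 1) \<le> 40 * Q * (2 * Q)"
    by (intro mult_le_mono) auto
  moreover have "1 \<le> Q" "length x \<le> Q" using \<open>length x + n + 1 \<le> Q\<close> by auto
  then have "8 * length x + 5 \<le> 13 * (Q * Q)" using le_square[of Q] by linarith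
  ultimately have "length x * 8 + 1 + (1 + bind_cost 40 (length x) n + 1) + 1 \<le> 100 * (Q * Q)"
    unfolding bind_cost_def by simp
  also have "\<dots> = 100 * (C + 1) ^ 2 * (length x + 1) ^ (2 * D + 2)"
  proof -
    have "(D + 1) * 2 = 2 * D + 2" by simp
    then have "(P ^ (D + 1))\<^sup>2 = P ^ (2 * D + 2)" by (metis power_mult)
    moreover have "Q * Q = (C + 1)\<^sup>2 * (P ^ (D + 1))\<^sup>2"
      by (simp only: Q_def power2_eq_square mult_ac)
    ultimately show ?thesis by (simp only: P_def mult.assoc)
  qed
  also have "\<dots> \<le> (100 * (C + 1) ^ 2) * 2 ^ (2 * D + 2) * length x ^ (2 * D + 2) + (100 * (C + 1) ^ 2) * 2 ^ (2 * D + 2)"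
    by (rule poly_le)
  finally show "\<exists>n s'. n \<le> (100 * (C + 1) ^ 2) * 2 ^ (2 * D + 2) * length x ^ (2 * D + 2) + (100 * (C + 1) ^ 2) * 2 ^ (2 * D + 2) \<and>
      exec appc (with_input (bind impl c)) (init_stacks (Inr False) Some x) n s'"
    unfolding with_input_def using exec_SeqI[OF 1 exec_SeqI[OF 2 3]] by blast
qed

section \<open>Short derivations\<close>

text \<open>Derivation trees reduced to root and yield. In contrast to derivations they admit an
  induction over subtrees.\<close>

inductive yields :: "prod list \<Rightarrow> sym \<Rightarrow> nat list \<Rightarrow> bool" for R where
  yields_Inr: "yields R (Inr a) [a]"
| yields_Inl: "(A, rhs) \<in> set R \<Longrightarrow> list_all2 (yields R) rhs ws \<Longrightarrow> yields R (Inl A) (concat ws)"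

lemma list_all2_append_rhs:
  assumes "list_all2 P (xs @ ys) zs"
  obtains us vs where "zs = us @ vs" "list_all2 P xs us" "list_all2 P ys vs"
  using assms unfolding list_all2_append1 by blast

lemma derives_imp_yields:
  assumes "(cfg_step R)\<^sup>*\<^sup>* \<alpha> (map Inr w)"
  shows "\<exists>ws. list_all2 (yields R) \<alpha> ws \<and> concat ws = w"
  using assms
proof (induction rule: converse_rtranclp_induct)
  case base
  show ?case
    by (rule exI[of _ "map (\<lambda>a. [a]) w"]) (auto simp: list_all2_conv_all_nth intro: yields_Inr)
next
  case (step u v)
  then obtain \<alpha> \<beta> A rhs ws where r: "(A, rhs) \<in> set R" "u = \<alpha> @ [Inl A] @ \<beta>" "v = \<alpha> @ rhs @ \<beta>"
    and ws: "list_all2 (yields R) v ws" "concat ws = w" unfolding cfg_step_def by blast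
  obtain us vs where 1: "ws = us @ vs" "list_all2 (yields R) \<alpha> us" "list_all2 (yields R) (rhs @ \<beta>) vs"
    using ws(1) unfolding r(3) by (rule list_all2_append_rhs)
  obtain xs ys where 2: "vs = xs @ ys" "list_all2 (yields R) rhs xs" "list_all2 (yields R) \<beta> ys"
    using 1(3) by (rule list_all2_append_rhs)
  have "list_all2 (yields R) u (us @ [concat xs] @ ys)"
    unfolding r(2) using 1(2) 2(2,3) yields_Inl[OF r(1)] by (intro list_all2_appendI) auto
  moreover have "concat (us @ [concat xs] @ ys) = w" using ws(2) 1(1) 2(1) by simp
  ultimately show ?case by blast
qed

lemma cfg_step_context: "cfg_step R u v \<Longrightarrow> cfg_step R (\<gamma> @ u @ \<delta>) (\<gamma> @ v @ \<delta>)"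
  unfolding cfg_step_def by (metis append.assoc)

lemma derives_context: "(cfg_step R)\<^sup>*\<^sup>* u v \<Longrightarrow> (cfg_step R)\<^sup>*\<^sup>* (\<gamma> @ u @ \<delta>) (\<gamma> @ v @ \<delta>)"
  by (induction rule: rtranclp_induct) (auto intro: rtranclp.rtrancl_into_rtrancl cfg_step_context)

lemma derives_append:
  assumes "(cfg_step R)\<^sup>*\<^sup>* u u'" "(cfg_step R)\<^sup>*\<^sup>* v v'"
  shows "(cfg_step R)\<^sup>*\<^sup>* (u @ v) (u' @ v')"
  using derives_context[OF assms(1), of "[]" v] derives_context[OF assms(2), of u' "[]"] by simp

lemma derives_production:
  assumes "(A, rhs) \<in> set R" "(cfg_step R)\<^sup>*\<^sup>* (rhs @ \<alpha>) w"
  shows "(cfg_step R)\<^sup>*\<^sup>* (Inl A # \<alpha>) w"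
proof -
  have "cfg_step R ([] @ [Inl A] @ \<alpha>) ([] @ rhs @ \<alpha>)" using assms(1) unfolding cfg_step_def by blast
  then show ?thesis using assms(2) by simp
qed

section \<open>Nullable nonterminals and derivations that drop them\<close>

inductive null_list :: "prod list \<Rightarrow> nat list \<Rightarrow> bool" for R where
  null_list_Nil: "null_list R []"
| null_list_Cons: "null_list R ns \<Longrightarrow> (A, rhs) \<in> set R \<Longrightarrow> set rhs \<subseteq> Inl ` set ns \<Longrightarrow> null_list R (A # ns)"

lemma null_list_subset: "null_list R ns \<Longrightarrow> set ns \<subseteq> fst ` set R"
proof (induction rule: null_list.induct)
  case (null_list_Cons ns A rhs)
  then have "A \<in> fst ` set R" using image_eqI[of A fst "(A, rhs)"] by simp
  with null_list_Cons show ?case by simp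
qed simp

text \<open>A longest list without repetitions is closed, because any production whose right-hand
  side is listed would extend it. This replaces the computation of a least fixed point.\<close>

lemma maximal_null_list:
  obtains ns where "null_list R ns" "length ns \<le> length R"
    "\<And>A rhs. (A, rhs) \<in> set R \<Longrightarrow> set rhs \<subseteq> Inl ` set ns \<Longrightarrow> A \<in> set ns"
proof -
  let ?P = "\<lambda>ns. null_list R ns \<and> distinct ns"
  have le: "length ns \<le> length R" if "?P ns" for ns
  proof -
    have "card (set ns) \<le> card (fst ` set R)"
      using that null_list_subset by (intro card_mono) auto
    also have "\<dots> \<le> length R" by (meson card_image_le card_length finite_set le_trans)
    finally show ?thesis using that by (simp add: distinct_card)
  qed
  have "?P []" by (simp add: null_list_Nil)
  moreover have "\<forall>ns. ?P ns \<longrightarrow> length ns < length R + 1" using le by fastforce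
  ultimately have "\<exists>ns. ?P ns \<and> (\<forall>ms. ?P ms \<longrightarrow> length ms \<le> length ns)"
    by (rule ex_has_greatest_nat)
  then obtain ns where ns: "?P ns" "\<And>ms. ?P ms \<Longrightarrow> length ms \<le> length ns" by blast
  have "A \<in> set ns" if "(A, rhs) \<in> set R" "set rhs \<subseteq> Inl ` set ns" for A rhs
    using ns(2)[of "A # ns"] null_list_Cons[OF _ that] ns(1) by auto
  then show thesis using that ns(1) le by blast
qed

text \<open>The derivation that the program simulates, with its number of steps:
  \<open>\<alpha>\<close> is the content of the derivation stack and \<open>w\<close> is the word
  still to be produced.\<close>

inductive dder :: "prod list \<Rightarrow> nat set \<Rightarrow> nat \<Rightarrow> sym list \<Rightarrow> nat list \<Rightarrow> bool" for R N where
  dder_Nil: "dder R N 0 [] []"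
| dder_letter: "dder R N n \<alpha> w \<Longrightarrow> dder R N (Suc n) (Inr a # \<alpha>) (a # w)"
| dder_null: "A \<in> N \<Longrightarrow> dder R N n \<alpha> w \<Longrightarrow> dder R N (Suc n) (Inl A # \<alpha>) w"
| dder_expand: "(A, rhs) \<in> set R \<Longrightarrow> dder R N n (rhs @ \<alpha>) w \<Longrightarrow> dder R N (Suc n) (Inl A # \<alpha>) w"

lemma dder_append: "dder R N n \<alpha> u \<Longrightarrow> dder R N m \<beta> v \<Longrightarrow> dder R N (n + m) (\<alpha> @ \<beta>) (u @ v)"
proof (induction rule: dder.induct)
  case (dder_expand A rhs n \<alpha> w)
  then show ?case using dder.dder_expand[of A rhs R N "n + m" "\<alpha> @ \<beta>"] by simp
qed (simp_all add: dder_letter dder_null)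

lemma dder_nulls: "set \<alpha> \<subseteq> Inl ` N \<Longrightarrow> dder R N (length \<alpha>) \<alpha> []"
proof (induction \<alpha>)
  case (Cons X \<alpha>)
  then obtain A where "X = Inl A" "A \<in> N" by auto
  with Cons show ?case by (simp add: dder_null)
qed (simp add: dder_Nil)

text \<open>Closure puts every nonterminal that derives the empty word into \<open>N\<close>
  (\<open>yields_empty\<close>); this is what lets a subtree with empty yield vanish in one
  step.\<close>

locale bounded_cfg =
  fixes R :: "prod list" and N :: "nat set" and P :: nat
  assumes rhs_le: "(A, rhs) \<in> set R \<Longrightarrow> length rhs \<le> P"
    and R_le: "length R \<le> P"
    and closed: "(A, rhs) \<in> set R \<Longrightarrow> set rhs \<subseteq> Inl ` N \<Longrightarrow> A \<in> N"
begin

lemma yields_empty: "yields R X w \<Longrightarrow> w = [] \<Longrightarrow> X \<in> Inl ` N"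
proof (induction rule: yields.induct)
  case (yields_Inl A rhs ws)
  have "set rhs \<subseteq> Inl ` N"
  proof
    fix X assume "X \<in> set rhs"
    then obtain j where j: "j < length rhs" "X = rhs ! j" by (metis in_set_conv_nth)
    have "ws ! j \<in> set ws" using j(1) list_all2_lengthD[OF yields_Inl(2)] by simp
    then have "ws ! j = []" using yields_Inl(3) by simp
    with list_all2_nthD[OF yields_Inl(2) j(1)] show "X \<in> Inl ` N" unfolding j(2) by (rule conjunct2[THEN mp])
  qed
  from closed[OF yields_Inl(1) this] show ?case by (rule imageI)
qed simp

text \<open>Unit productions up to droppable siblings: the edges along which a whole yield can be
  handed to one child.\<close>

definition unit_rel :: "(nat \<times> nat) set" where
  "unit_rel = {(A, B). \<exists>\<alpha> \<beta>. (A, \<alpha> @ [Inl B] @ \<beta>) \<in> set R \<and> set \<alpha> \<union> set \<beta> \<subseteq> Inl ` N}"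

text \<open>A pair is determined by a production and a position in its right-hand side.\<close>

lemma unit_rel_card: "finite unit_rel" "card unit_rel \<le> P * P"
proof -
  let ?f = "\<lambda>(p, j). (fst p, projl (snd p ! j))"
  have sub: "unit_rel \<subseteq> ?f ` (set R \<times> {..<P})"
  proof (clarify)
    fix A B assume "(A, B) \<in> unit_rel"
    then obtain \<alpha> \<beta> where r: "(A, \<alpha> @ [Inl B] @ \<beta>) \<in> set R" unfolding unit_rel_def by blast
    then have "length \<alpha> < P" using rhs_le[OF r] by simp
    with r show "(A, B) \<in> ?f ` (set R \<times> {..<P})"
      by (intro image_eqI[of _ _ "((A, \<alpha> @ [Inl B] @ \<beta>), length \<alpha>)"]) auto
  qed
  then show "finite unit_rel" by (rule finite_subset) simp
  have "card unit_rel \<le> card (?f ` (set R \<times> {..<P}))" using sub by (intro card_mono) auto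
  also have "\<dots> \<le> card (set R \<times> {..<P})" by (intro card_image_le) simp
  also have "\<dots> = card (set R) * P" by (simp add: card_cartesian_product)
  also have "\<dots> \<le> P * P" by (rule mult_le_mono1[OF le_trans[OF card_length R_le]])
  finally show "card unit_rel \<le> P * P" .
qed

text \<open>A link costs the expansion and one step for each dropped sibling, together the length of
  the right-hand side.\<close>

lemma dder_unit: "(A, B) \<in> unit_rel ^^ j \<Longrightarrow> dder R N n [Inl B] w \<Longrightarrow> \<exists>m \<le> j * P + n. dder R N m [Inl A] w"
proof (induction j arbitrary: A)
  case 0
  then show ?case by auto
next
  case (Suc j)
  from Suc.prems(1) obtain C where C: "(A, C) \<in> unit_rel" "(C, B) \<in> unit_rel ^^ j"
    by (meson relpow_Suc_D2)
  from Suc.IH[OF C(2) Suc.prems(2)] obtain m where m: "m \<le> j * P + n" "dder R N m [Inl C] w" by blast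
  from C(1) obtain \<alpha> \<beta> where r: "(A, \<alpha> @ [Inl C] @ \<beta>) \<in> set R" and N: "set \<alpha> \<subseteq> Inl ` N" "set \<beta> \<subseteq> Inl ` N"
    unfolding unit_rel_def by blast
  from dder_append[OF dder_nulls[OF N(1)] dder_append[OF m(2) dder_nulls[OF N(2)]]]
  have "dder R N (Suc (length \<alpha> + (m + length \<beta>))) [Inl A] w"
    by (intro dder_expand[OF r]) simp
  moreover have "Suc (length \<alpha> + (m + length \<beta>)) \<le> Suc j * P + n" using rhs_le[OF r] m(1) by simp
  ultimately show ?case by blast
qed

text \<open>Following the child that keeps the whole yield leads to a node all of whose children have a
  shorter yield or are letters.\<close>

lemma yields_branching:
  assumes "yields R X w"
  shows "X = Inl A \<Longrightarrow> w \<noteq> [] \<Longrightarrow> \<exists>B rhs ws. (A, B) \<in> unit_rel\<^sup>* \<and> (B, rhs) \<in> set R \<and> concat ws = w \<and>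
    list_all2 (\<lambda>X v. yields R X v \<and> ((\<exists>a. X = Inr a) \<or> length v < length w)) rhs ws"
  using assms
proof (induction arbitrary: A rule: yields.induct)
  case (yields_Inl A' rhs ws)
  then have A: "A' = A" by simp
  have all: "list_all2 (yields R) rhs ws"
    using yields_Inl(2) by (rule list_all2_mono) simp
  have len: "length v \<le> length (concat ws)" if "v \<in> set ws" for v
    using that by (induction ws) auto
  show ?case
  proof (cases "list_all2 (\<lambda>X v. (\<exists>a. X = Inr a) \<or> length v < length (concat ws)) rhs ws")
    case True
    with all have "list_all2 (\<lambda>X v. yields R X v \<and> ((\<exists>a. X = Inr a) \<or> length v < length (concat ws))) rhs ws"
      by (simp add: list_all2_conv_all_nth)
    with yields_Inl(1) A show ?thesis by blast
  next
    case False
    then obtain j where j: "j < length rhs" "\<nexists>a. rhs ! j = Inr a" "\<not> length (ws ! j) < length (concat ws)"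
      using list_all2_lengthD[OF all] by (auto simp: list_all2_conv_all_nth)
    then obtain B where B: "rhs ! j = Inl B" by (metis sum.exhaust)
    have jw: "j < length ws" using j(1) list_all2_lengthD[OF all] by simp
    define \<alpha> \<beta> us vs where "\<alpha> = take j rhs" "\<beta> = drop (Suc j) rhs" "us = take j ws" "vs = drop (Suc j) ws"
    have rhs: "rhs = \<alpha> @ [Inl B] @ \<beta>" and ws: "ws = us @ [ws ! j] @ vs"
      using id_take_nth_drop[OF j(1)] id_take_nth_drop[OF jw] B unfolding \<alpha>_\<beta>_us_vs_def by simp_all
    have "length (concat ws) = length (concat us) + length (ws ! j) + length (concat vs)"
      by (subst ws) simp
    \<comment> \<open>Child \<open>j\<close> has the whole yield, so its siblings have empty yields
      and lie in \<open>N\<close>.\<close>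
    with j(3) have e: "concat us = []" "concat vs = []" by auto
    have "concat ws = concat us @ ws ! j @ concat vs" by (subst ws) simp
    then have cw: "concat ws = ws ! j" by (simp only: e append_Nil append_Nil2)
    have null: "set \<gamma> \<subseteq> Inl ` N" if "list_all2 (yields R) \<gamma> xs" "concat xs = []" for \<gamma> xs
    proof
      fix Y assume "Y \<in> set \<gamma>"
      then obtain l where "l < length \<gamma>" "Y = \<gamma> ! l" by (metis in_set_conv_nth)
      moreover from this that have "yields R (\<gamma> ! l) (xs ! l)" "xs ! l \<in> set xs"
        by (auto simp: list_all2_conv_all_nth)
      ultimately show "Y \<in> Inl ` N" using yields_empty that(2) by auto
    qed
    have "list_all2 (yields R) \<alpha> us" "list_all2 (yields R) \<beta> vs"
      unfolding \<alpha>_\<beta>_us_vs_def using all by (auto intro: list_all2_takeI list_all2_dropI)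
    with e null have N: "set \<alpha> \<union> set \<beta> \<subseteq> Inl ` N" by (intro Un_least)
    have u: "(A, B) \<in> unit_rel"
      using yields_Inl(1) N unfolding rhs A unit_rel_def by (intro CollectI case_prodI exI conjI)
    have "ws ! j \<noteq> []" using yields_Inl(4) cw by simp
    with list_all2_nthD[OF yields_Inl(2) j(1)] B
    have "\<exists>B' rhs' ws'. (B, B') \<in> unit_rel\<^sup>* \<and> (B', rhs') \<in> set R \<and> concat ws' = ws ! j \<and>
      list_all2 (\<lambda>X v. yields R X v \<and> ((\<exists>a. X = Inr a) \<or> length v < length (ws ! j))) rhs' ws'"
      by simp
    then obtain B' rhs' ws' where b: "(B, B') \<in> unit_rel\<^sup>*" "(B', rhs') \<in> set R" "concat ws' = ws ! j"
      "list_all2 (\<lambda>X v. yields R X v \<and> ((\<exists>a. X = Inr a) \<or> length v < length (ws ! j))) rhs' ws'"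
      by (elim exE conjE)
    from converse_rtrancl_into_rtrancl[OF u b(1)] b(2-4) show ?thesis
      unfolding cw by (intro exI conjI)
  qed
qed simp

text \<open>A child with shorter yield v costs at most 1 + K |v|^2 \<le> 1 + K (|w| - 1) |v|. Summed
  over the children this is |rhs| + K (|w| - 1) |w|. The saved K |w| covers the chain above them, at
  most P^2 links of cost P, and the P for |rhs|.\<close>

lemma yields_dder:
  defines "K \<equiv> P * P * P + P"
  shows "yields R X w \<Longrightarrow> \<exists>n \<le> 1 + K * length w * length w. dder R N n [X] w"
proof (induction "length w" arbitrary: X w rule: less_induct)
  case less
  show ?case
  proof (cases X)
    case (Inr a)
    with less.prems have "w = [a]" by (auto elim: yields.cases)
    then show ?thesis using Inr by (intro exI[of _ "Suc 0"]) (simp add: dder_Nil dder_letter dder_null)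
  next
    case (Inl A)
    show ?thesis
    proof (cases "w = []")
      case True
      with yields_empty[OF less.prems] Inl have "A \<in> N" by auto
      then show ?thesis using Inl True by (intro exI[of _ "Suc 0"]) (simp add: dder_Nil dder_letter dder_null)
    next
      case False
      let ?l = "length w - 1"
      from yields_branching[OF less.prems Inl False] obtain B rhs ws where
        B: "(A, B) \<in> unit_rel\<^sup>*" "(B, rhs) \<in> set R" "concat ws = w"
        and ch: "list_all2 (\<lambda>X v. yields R X v \<and> ((\<exists>a. X = Inr a) \<or> length v < length w)) rhs ws" by blast
      \<comment> \<open>A letter may be as long as \<open>w\<close> itself, but it costs a single
        step.\<close>
      have child: "\<exists>n \<le> 1 + K * ?l * length v. dder R N n [Y] v"
        if "yields R Y v" "(\<exists>a. Y = Inr a) \<or> length v < length w" for Y v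
        using that(2)
      proof
        assume "\<exists>a. Y = Inr a"
        then obtain a where "Y = Inr a" by blast
        moreover from this that(1) have "v = [a]" by (auto elim: yields.cases)
        ultimately show ?thesis by (intro exI[of _ "Suc 0"]) (simp add: dder_Nil dder_letter dder_null)
      next
        assume v: "length v < length w"
        from less.hyps[OF this that(1)] obtain n where n: "n \<le> 1 + K * length v * length v" "dder R N n [Y] v" by blast
        have "K * length v * length v \<le> K * ?l * length v"
          using v by (intro mult_le_mono) auto
        then have "n \<le> 1 + K * ?l * length v" using n(1) by linarith
        with n(2) show ?thesis by blast
      qed
      have "\<exists>n \<le> length rhs + K * ?l * length (concat ws). dder R N n rhs (concat ws)"
        using ch
      proof (induction rule: list_all2_induct)
        case Nil
        then show ?case by (auto intro: dder_Nil)
      next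
        case (Cons Y \<gamma> v vs)
        from child Cons(1) obtain n where n: "n \<le> 1 + K * ?l * length v" "dder R N n [Y] v" by blast
        from Cons obtain m where m: "m \<le> length \<gamma> + K * ?l * length (concat vs)" "dder R N m \<gamma> (concat vs)" by blast
        from dder_append[OF n(2) m(2)] n(1) m(1) show ?case
          by (intro exI[of _ "n + m"]) (simp add: algebra_simps)
      qed
      then obtain n where n: "n \<le> P + K * ?l * length w" "dder R N n rhs w"
        using B(3) rhs_le[OF B(2)] by (meson add_le_mono1 le_trans)
      have "dder R N (Suc n) [Inl B] w" using n(2) by (intro dder_expand[OF B(2)]) simp
      \<comment> \<open>Reachability in a finite relation needs at most as many links as the
        relation has pairs.\<close>
      moreover obtain j where j: "j \<le> P * P" "(A, B) \<in> unit_rel ^^ j"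
      proof -
        obtain j where "j \<le> card unit_rel" "(A, B) \<in> unit_rel ^^ j"
          using B(1) unfolding rtrancl_finite_eq_relpow[OF unit_rel_card(1)] by blast
        then show ?thesis using that unit_rel_card(2) by (meson le_trans)
      qed
      ultimately obtain m where m: "m \<le> j * P + Suc n" "dder R N m [Inl A] w" using dder_unit by blast
      have "j * P + Suc n \<le> P * P * P + P + 1 + K * ?l * length w"
        using n(1) mult_le_mono1[OF j(1), of P] by linarith
      also have "\<dots> = 1 + (K + K * ?l * length w)" by (simp add: K_def)
      also have "K + K * ?l * length w \<le> K * length w * length w"
      proof -
        obtain l where "length w = Suc l" using False by (cases w) auto
        then show ?thesis by (simp add: algebra_simps)
      qed
      finally show ?thesis using m Inl by (intro exI[of _ m]) simp
    qed
  qed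
qed

end

lemma distinct_count_list: "distinct xs \<Longrightarrow> count_list xs a = (if a \<in> set xs then 1 else 0)"
  by (induction xs) auto

text \<open>This makes the order of the letters irrelevant: they can be crossed off a list in
  whatever order the derivation produces them.\<close>

lemma perfect_pangram_iff_mset: "w \<in> perfect_pangrams s \<longleftrightarrow> mset w = mset [0..<s]"
proof
  assume w: "w \<in> perfect_pangrams s"
  have "count (mset w) a = count (mset [0..<s]) a" for a
    using w distinct_count_list[of "[0..<s]" a] count_list_0_iff[of w a]
    by (cases "a < s") (auto simp: perfect_pangrams_def count_mset subset_iff)
  then show "mset w = mset [0..<s]" by (rule multiset_eqI)
next
  assume m: "mset w = mset [0..<s]"
  have "set w = set [0..<s]" using mset_eq_setD[OF m] .
  moreover have "distinct w" using mset_eq_imp_distinct_iff[OF m] by simp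
  ultimately show "w \<in> perfect_pangrams s"
    by (simp add: perfect_pangrams_def distinct_count_list)
qed

section \<open>The pangram program\<close>

text \<open>SC counts letters, SL holds the letters still to be produced, SG the grammar, SN the
  nonterminals known to be nullable, SD the rest of the sentential form, SK a name to be compared.
  SR and SQ keep what a search has passed over.\<close>

datatype stk = SC | SL | SG | SN | SD | SK | SR | SQ

instance stk :: finite
proof
  have "(UNIV :: stk set) = {SC, SL, SG, SN, SD, SK, SR, SQ}"
    using stk.exhaust by auto
  then show "finite (UNIV :: stk set)" by (metis finite.intros)
qed

definition st :: "bool list list \<Rightarrow> bool list list \<Rightarrow> bool list list \<Rightarrow> bool list list \<Rightarrow> bool list list \<Rightarrow>
    bool list list \<Rightarrow> bool list list \<Rightarrow> bool list list \<Rightarrow> stk \<Rightarrow> bool list list" where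
  "st c l g n d k r q = (\<lambda>s. case s of SC \<Rightarrow> c | SL \<Rightarrow> l | SG \<Rightarrow> g | SN \<Rightarrow> n | SD \<Rightarrow> d | SK \<Rightarrow> k | SR \<Rightarrow> r | SQ \<Rightarrow> q)"

lemma st_simps [simp]:
  "st c l g n d k r q SC = c" "st c l g n d k r q SL = l" "st c l g n d k r q SG = g" "st c l g n d k r q SN = n"
  "st c l g n d k r q SD = d" "st c l g n d k r q SK = k" "st c l g n d k r q SR = r" "st c l g n d k r q SQ = q"
  by (simp_all add: st_def)

lemma st_upd [simp]:
  "(st c l g n d k r q)(SC := x) = st x l g n d k r q" "(st c l g n d k r q)(SL := x) = st c x g n d k r q"
  "(st c l g n d k r q)(SG := x) = st c l x n d k r q" "(st c l g n d k r q)(SN := x) = st c l g x d k r q"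
  "(st c l g n d k r q)(SD := x) = st c l g n x k r q" "(st c l g n d k r q)(SK := x) = st c l g n d x r q"
  "(st c l g n d k r q)(SR := x) = st c l g n d k x q" "(st c l g n d k r q)(SQ := x) = st c l g n d k r x"
  by (auto simp: st_def fun_eq_iff split: stk.splits)

lemma st_empty: "(\<lambda>_. []) = st [] [] [] [] [] [] [] []"
  by (auto simp: st_def fun_eq_iff split: stk.splits)

lemma popped_pushed_Nil [simp]: "popped [] t = t" "pushed x [] t = t"
  by (simp_all add: popped_def pushed_def)

declare popped_Cons [simp] pushed_Cons [simp]

text \<open>Guesses how many names to pass over, which brings any chosen name to the top of
  \<open>a\<close>. Rotating back and testing \<open>b\<close> for emptiness restores the
  stack.\<close>

definition rot :: "'k \<Rightarrow> 'k \<Rightarrow> 'k name_act cmd" where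
  "rot a b = Star (Act (Names [a] [b]))"

lemma den_rot:
  assumes "a \<noteq> b"
  shows "den sem (rot a b) (i, t) s' \<longleftrightarrow> (\<exists>p q. t a = p @ q \<and> s' = (i, t(a := q, b := rev p @ t b)))"
proof
  have "(sem (Names [a] [b]))\<^sup>*\<^sup>* s s' \<Longrightarrow>
      \<exists>p q. snd s a = p @ q \<and> s' = (fst s, (snd s)(a := q, b := rev p @ snd s b))" for s
  proof (induction rule: converse_rtranclp_induct)
    case base
    show ?case by (intro exI[of _ "[]"] exI[of _ "snd s' a"]) (simp add: prod_eq_iff fun_upd_idem)
  next
    case (step u v)
    obtain j r where u: "u = (j, r)" by (cases u)
    from step(1) obtain n ns where 1: "r a = n # ns" "v = (j, r(a := ns, b := n # r b))"
      using assms by (auto simp: u)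
    from step(3) obtain p q where "snd v a = p @ q" "s' = (fst v, (snd v)(a := q, b := rev p @ snd v b))" by blast
    with 1 assms u show ?case by (intro exI[of _ "n # p"] exI[of _ q]) (auto simp: fun_eq_iff)
  qed
  then show "den sem (rot a b) (i, t) s' \<Longrightarrow> \<exists>p q. t a = p @ q \<and> s' = (i, t(a := q, b := rev p @ t b))"
    unfolding rot_def by fastforce
next
  have "(sem (Names [a] [b]))\<^sup>*\<^sup>* (i, t) (i, t(a := q, b := rev p @ t b))" if "t a = p @ q" for p q t
    using that
  proof (induction p arbitrary: t)
    case (Cons n p)
    have "sem (Names [a] [b]) (i, t) (i, t(a := p @ q, b := n # t b))"
      using Cons.prems assms by simp
    moreover have "(sem (Names [a] [b]))\<^sup>*\<^sup>* (i, t(a := p @ q, b := n # t b)) (i, t(a := q, b := rev (n # p) @ t b))"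
    proof -
      let ?u = "t(a := p @ q, b := n # t b)"
      have "?u(a := q, b := rev p @ ?u b) = t(a := q, b := rev (n # p) @ t b)"
        using assms by (simp add: fun_eq_iff)
      then show ?thesis using Cons.IH[of ?u] assms by (metis fun_upd_same fun_upd_other)
    qed
    ultimately show ?case by (rule converse_rtranclp_into_rtranclp)
  qed (auto simp: fun_upd_idem)
  then show "\<exists>p q. t a = p @ q \<and> s' = (i, t(a := q, b := rev p @ t b)) \<Longrightarrow> den sem (rot a b) (i, t) s'"
    unfolding rot_def by auto
qed

definition letter_cmd :: "stk name_act cmd" where
  "letter_cmd = seqs [rot SL SR, Act (Names [SD, SL] []), rot SR SL, Act (IsEmp SR)]"

definition null_cmd :: "stk name_act cmd" where
  "null_cmd = seqs [rot SN SR, Act (Names [SD, SN] [SN]), rot SR SN, Act (IsEmp SR)]"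

definition copy_cmd :: "stk name_act cmd" where
  "copy_cmd = Star (Act (Names [SG] [SR, SD]))"

text \<open>Guesses a separator of the grammar stack and stops just below it, where a production
  begins.\<close>

definition enter_cmd :: "stk name_act cmd" where
  "enter_cmd = seqs [rot SG SR, Act (PopE SG), Act (PushE SR)]"

text \<open>Popping and pushing the empty name tests that a separator comes next, so that the name
  just consumed was the last of its block, which is the left-hand side.\<close>

definition leave_cmd :: "stk name_act cmd" where
  "leave_cmd = seqs [Act (PopE SG), Act (PushE SG), rot SR SG, Act (IsEmp SR)]"

text \<open>Right-hand sides are stored in reverse; copying reverses them again, so the first symbol
  ends on top of SD. The copy may run across a separator, but then an empty name is left on SD and
  the run cannot accept.\<close>

definition expand_cmd :: "stk name_act cmd" where
  "expand_cmd = seqs [Act (Names [SD] [SK]), enter_cmd, copy_cmd, Act (Names [SK, SG] [SR]), leave_cmd]"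

definition derive_cmd :: "stk name_act cmd" where
  "derive_cmd = Star (Alt letter_cmd (Alt null_cmd expand_cmd))"

text \<open>SQ serves the search in SN because SR already holds the part of the grammar that
  \<open>enter_cmd\<close> has passed.\<close>

definition member_cmd :: "stk name_act cmd" where
  "member_cmd = seqs [rot SN SQ, Act (Names [SG, SN] [SR, SN]), rot SQ SN, Act (IsEmp SQ)]"

definition nullable_cmd :: "stk name_act cmd" where
  "nullable_cmd = seqs [enter_cmd, Star member_cmd, Act (Names [SG] [SR, SN]), leave_cmd]"

text \<open>Each True of the unary alphabet size stores the current counter in SL before
  incrementing it, so SL collects the codes of all letters.\<close>

definition unary_cmd :: "stk name_act cmd" where
  "unary_cmd = seqs [Act (PushZ SC),
     Star (seqs [Act (Rd True), Act (Names [SC] [SC, SL]), Act (Inc SC)]), Act (Rd False)]"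

text \<open>While the grammar is read, SL still lists the whole alphabet; finding a terminal there
  is the check behind \<open>cfg_over\<close>.\<close>

definition symbol_cmd :: "stk name_act cmd" where
  "symbol_cmd = Alt (seqs [Act (Rd False), Act (RdName False SG)])
     (seqs [Act (Rd True), Act (RdName True SK), rot SL SR, Act (Names [SK, SL] [SG, SL]), rot SR SL, Act (IsEmp SR)])"

definition production_cmd :: "stk name_act cmd" where
  "production_cmd = seqs [Act (Rd True), Act (RdName False SG), Star (seqs [Act (Rd True), symbol_cmd]),
     Act (Rd False), Act (PushE SG)]"

definition grammar_cmd :: "stk name_act cmd" where
  "grammar_cmd = seqs [Act (PushE SG), Star production_cmd, Act (Rd False), Act RdEnd]"

definition pangram_cmd :: "stk name_act cmd" where
  "pangram_cmd = seqs [unary_cmd, Act (RdName False SD), grammar_cmd, Star nullable_cmd, derive_cmd,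
     Act (IsEmp SD), Act (IsEmp SL)]"

section \<open>Effects of the subprograms\<close>

lemma den_letter:
  "den sem letter_cmd (i, st c l g n d k [] q) s' \<Longrightarrow>
    \<exists>p a l' d'. l = p @ a # l' \<and> d = a # d' \<and> s' = (i, st c (p @ l') g n d' k [] q)"
  unfolding letter_cmd_def seqs.simps den_Seq_iff by (auto simp: den_rot) blast

lemma den_null:
  "den sem null_cmd (i, st c l g n d k [] q) s' \<Longrightarrow>
    \<exists>a d'. a \<in> set n \<and> d = a # d' \<and> s' = (i, st c l g n d' k [] q)"
  unfolding null_cmd_def seqs.simps den_Seq_iff by (auto simp: den_rot)

lemma den_copy:
  "den sem copy_cmd (i, st c l g n d k r q) s' \<Longrightarrow>
    \<exists>p g'. g = p @ g' \<and> s' = (i, st c l g' n (rev p @ d) k (rev p @ r) q)"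
  unfolding copy_cmd_def den.simps
proof (induction "(i, st c l g n d k r q)" arbitrary: g d r rule: converse_rtranclp_induct)
  case base
  then have "g = [] @ g \<and> s' = (i, st c l g n (rev [] @ d) k (rev [] @ r) q)" by simp
  then show ?case by blast
next
  case (step v)
  then obtain a g1 where 1: "g = a # g1" "v = (i, st c l g1 n (a # d) k (a # r) q)" by auto
  from step(3)[OF this(2)] obtain p g' where "g1 = p @ g'"
    "s' = (i, st c l g' n (rev p @ a # d) k (rev p @ a # r) q)" by auto
  with 1 have "g = (a # p) @ g' \<and> s' = (i, st c l g' n (rev (a # p) @ d) k (rev (a # p) @ r) q)" by simp
  then show ?case by blast
qed

lemma den_expand:
  assumes "den sem expand_cmd (i, st c l g n d [] [] q) s'"
  shows "\<exists>p xs a g' d'. g = p @ [] # xs @ a # [] # g' \<and> d = a # d' \<and> s' = (i, st c l g n (rev xs @ d') [] [] q)"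
proof -
  obtain s1 s2 where 1: "den sem (Seq (Act (Names [SD] [SK])) enter_cmd) (i, st c l g n d [] [] q) s1"
    and 2: "den sem copy_cmd s1 s2"
    and 3: "den sem (Seq (Act (Names [SK, SG] [SR])) leave_cmd) s2 s'"
    using assms unfolding expand_cmd_def seqs.simps den_Seq_iff den.simps(1) by blast
  from 1 obtain p a g1 d' where s1: "g = p @ [] # g1" "d = a # d'" "s1 = (i, st c l g1 n d' [a] ([] # rev p) q)"
    unfolding enter_cmd_def leave_cmd_def seqs.simps den_Seq_iff by (auto simp: den_rot)
  from den_copy[OF 2[unfolded s1(3)]] obtain xs g2 where
    s2: "g1 = xs @ g2" "s2 = (i, st c l g2 n (rev xs @ d') [a] (rev xs @ [] # rev p) q)" by blast
  from 3[unfolded s2(2)] obtain g' where "g2 = a # [] # g'" "s' = (i, st c l (p @ [] # xs @ a # [] # g') n (rev xs @ d') [] [] q)"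
    unfolding enter_cmd_def leave_cmd_def seqs.simps den_Seq_iff by (auto simp: den_rot)
  then show ?thesis using s1 s2 by blast
qed

lemma den_members:
  "den sem (Star member_cmd) (i, st c l g n d k r []) s' \<Longrightarrow>
    \<exists>xs g'. g = xs @ g' \<and> set xs \<subseteq> set n \<and> s' = (i, st c l g' n d k (rev xs @ r) [])"
  unfolding den.simps
proof (induction "(i, st c l g n d k r [])" arbitrary: g r rule: converse_rtranclp_induct)
  case base
  then have "g = [] @ g \<and> set [] \<subseteq> set n \<and> s' = (i, st c l g n d k (rev [] @ r) [])" by simp
  then show ?case by blast
next
  case (step v)
  from step(1) obtain a g1 where 1: "g = a # g1" "a \<in> set n" "v = (i, st c l g1 n d k (a # r) [])"
    unfolding member_cmd_def seqs.simps den_Seq_iff by (auto simp: den_rot)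
  from step(3)[OF this(3)] obtain xs g' where "g1 = xs @ g'" "set xs \<subseteq> set n"
    "s' = (i, st c l g' n d k (rev xs @ a # r) [])" by auto
  with 1 have "g = (a # xs) @ g' \<and> set (a # xs) \<subseteq> set n \<and> s' = (i, st c l g' n d k (rev (a # xs) @ r) [])"
    by simp
  then show ?case by blast
qed

lemma den_nullable:
  assumes "den sem nullable_cmd (i, st c l g n d k [] []) s'"
  shows "\<exists>p xs a g'. g = p @ [] # xs @ a # [] # g' \<and> set xs \<subseteq> set n \<and> s' = (i, st c l g (a # n) d k [] [])"
proof -
  obtain s1 s2 where 1: "den sem enter_cmd (i, st c l g n d k [] []) s1"
    and 2: "den sem (Star member_cmd) s1 s2"
    and 3: "den sem (Seq (Act (Names [SG] [SR, SN])) leave_cmd) s2 s'"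
    using assms unfolding nullable_cmd_def seqs.simps den_Seq_iff den.simps(1) by blast
  from 1 obtain p g1 where s1: "g = p @ [] # g1" "s1 = (i, st c l g1 n d k ([] # rev p) [])"
    unfolding enter_cmd_def leave_cmd_def seqs.simps den_Seq_iff by (auto simp: den_rot)
  from den_members[OF 2[unfolded s1(2)]] obtain xs g2 where
    s2: "g1 = xs @ g2" "set xs \<subseteq> set n" "s2 = (i, st c l g2 n d k (rev xs @ [] # rev p) [])" by blast
  from 3[unfolded s2(3)] obtain a g' where "g2 = a # [] # g'" "s' = (i, st c l (p @ [] # xs @ a # [] # g') (a # n) d k [] [])"
    unfolding enter_cmd_def leave_cmd_def seqs.simps den_Seq_iff by (auto simp: den_rot)
  then show ?thesis using s1 s2 by blast
qed

section \<open>Codes of symbols and the layout of the grammar stack\<close>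

fun code :: "sym \<Rightarrow> bool list" where
  "code (Inl A) = False # bin A"
| "code (Inr a) = True # bin a"

fun bin_value :: "bool list \<Rightarrow> nat" where
  "bin_value [] = 0"
| "bin_value (b # bs) = 2 * bin_value bs + of_bool b"

lemma bin_value_bin: "bin_value (bin n) = n"
proof (induction n rule: less_induct)
  case (less n)
  consider "n = 0" | m where "n = 2 * m" "m \<noteq> 0" | m where "n = 2 * m + 1"
    by (metis oddE evenE mult_0_right)
  then show ?case
  proof cases
    case 1
    then show ?thesis by (simp add: bin_0)
  next
    case 2
    then show ?thesis using less[of m] by (simp add: bin_double(1))
  next
    case 3
    then show ?thesis using less[of m] bin_double(2)[of m] by simp
  qed
qed

lemma bin_inject: "bin m = bin n \<longleftrightarrow> m = n"
  by (metis bin_value_bin)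

lemma code_inject: "code X = code Y \<longleftrightarrow> X = Y"
  by (cases X; cases Y) (auto simp: bin_inject)

lemma code_not_Nil: "code X \<noteq> []"
  by (cases X) auto

lemma inj_code: "inj code"
  by (simp add: inj_def code_inject)

text \<open>This order results from pushing the left-hand side, then the right-hand side symbol by
  symbol, then a separator. The tag makes every \<open>code\<close> nonempty, so the empty name is
  free to separate.\<close>

definition gsep :: "prod \<Rightarrow> bool list list" where
  "gsep p = [] # map code (rev (snd p)) @ [code (Inl (fst p))]"

text \<open>The additional separator closes the last block, so that \<open>leave_cmd\<close> works
  there as well.\<close>

definition gst :: "prod list \<Rightarrow> bool list list" where
  "gst ps = concat (map gsep ps) @ [[]]"

lemma gst_simps: "gst [] = [[]]" "gst (p # ps) = [] # map code (rev (snd p)) @ code (Inl (fst p)) # gst ps"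
  by (simp_all add: gst_def gsep_def)

text \<open>Every block contains at least its left-hand side, so two separators are never adjacent.
  In \<open>gst_parse\<close> this excludes that the name \<open>a\<close> is itself a
  separator.\<close>

lemma gst_head: "\<exists>r. gst ps = [] # r \<and> (\<forall>r'. r \<noteq> [] # r')"
proof (cases ps)
  case (Cons p ps)
  then show ?thesis using code_not_Nil by (cases "rev (snd p)") (auto simp: gst_simps)
qed (simp add: gst_simps)

lemma split_at_separator:
  "a @ x # r = b @ x # q \<Longrightarrow> x \<notin> set a \<Longrightarrow> x \<notin> set b \<Longrightarrow> a = b \<and> r = q"
  by (induction a arbitrary: b) (auto simp: Cons_eq_append_conv append_eq_Cons_conv)

lemma gst_parse:
  assumes "gst ps = p @ [] # xs @ a # [] # g'" "[] \<notin> set xs"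
  shows "\<exists>A rhs. (A, rhs) \<in> set ps \<and> a = code (Inl A) \<and> xs = map code (rev rhs)"
  using assms(1)
proof (induction ps arbitrary: p)
  case Nil
  then show ?case by (cases p) (auto simp: gst_simps)
next
  case (Cons pr ps)
  obtain A rhs where pr: "pr = (A, rhs)" by (cases pr)
  let ?ys = "map code (rev rhs) @ [code (Inl A)]"
  obtain r where r: "gst ps = [] # r" "\<forall>r'. r \<noteq> [] # r'" using gst_head by blast
  have nn: "[] \<notin> set ?ys" using code_not_Nil by (auto simp del: code.simps) (metis code_not_Nil)+
  from Cons.prems have e: "[] # ?ys @ [] # r = p @ [] # xs @ a # [] # g'" by (simp add: gst_simps pr r(1))
  show ?case
  proof (cases p)
    case Nil
    with e have e': "?ys @ [] # r = xs @ a # [] # g'" by simp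
    show ?thesis
    proof (cases "a = []")
      case True
      with e' have "?ys @ [] # r = xs @ [] # [] # g'" by simp
      from split_at_separator[OF this nn assms(2)] r(2) show ?thesis by blast
    next
      case False
      from e' have "?ys @ [] # r = (xs @ [a]) @ [] # g'" by simp
      from split_at_separator[OF this nn] False assms(2) have "?ys = xs @ [a]" by auto
      then show ?thesis using pr by auto
    qed
  next
    case (Cons z p')
    with e have z: "z = []" and e': "?ys @ [] # r = p' @ [] # xs @ a # [] # g'" by auto
    have "\<exists>p''. p' @ [] # xs @ a # [] # g' = ?ys @ (p'' @ [] # xs @ a # [] # g')"
    proof -
      \<comment> \<open>The separator behind \<open>p'\<close> cannot lie inside the first block,
        all of whose names are nonempty; hence the match belongs to a later block.\<close>
      have "length ?ys \<le> length p'"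
      proof (rule ccontr)
        assume "\<not> length ?ys \<le> length p'"
        then have "length p' < length ?ys" by simp
        then have "?ys ! length p' = []" by (metis e' nth_append nth_append_length)
        then show False using nn \<open>length p' < length ?ys\<close> by (metis nth_mem)
      qed
      then have "take (length ?ys) p' = ?ys"
        using arg_cong[OF e', of "take (length ?ys)"] by simp
      then have "p' = ?ys @ drop (length ?ys) p'" by (metis append_take_drop_id)
      then show ?thesis by (metis append.assoc)
    qed
    then obtain p'' where "gst ps = p'' @ [] # xs @ a # [] # g'" using e' r(1) by auto
    from Cons.IH[OF this] show ?thesis by auto
  qed
qed


section \<open>Soundness of the pangram program\<close>

definition letters :: "nat list \<Rightarrow> bool list list" where
  "letters ls = map (\<lambda>a. code (Inr a)) ls"

definition nonterms :: "nat list \<Rightarrow> bool list list" where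
  "nonterms ns = map (\<lambda>A. code (Inl A)) ns"

lemma map_code_eq_append:
  "map code \<alpha> = map code \<beta> @ ds \<Longrightarrow> \<exists>\<gamma>. \<alpha> = \<beta> @ \<gamma> \<and> ds = map code \<gamma>"
  by (auto simp: map_eq_append_conv inj_map_eq_map[OF inj_code])

context
  fixes i :: "bool list" and c q :: "bool list list" and ps :: "prod list" and ns :: "nat list"
begin

abbreviation dstate :: "nat list \<Rightarrow> bool list list \<Rightarrow> stk name_state" where
  "dstate ls d \<equiv> (i, st c (letters ls) (gst ps) (nonterms ns) d [] [] q)"

text \<open>The expansion case is conditional, because a single step cannot tell whether the copied
  names contain a separator.\<close>

lemma derive_sound_step:
  assumes "den sem (Alt letter_cmd (Alt null_cmd expand_cmd)) (dstate ls d) s'"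
  shows "\<exists>ls' d'. s' = dstate ls' d' \<and>
    ((\<exists>a. d = code (Inr a) # d' \<and> mset ls = add_mset a (mset ls')) \<or>
     (ls' = ls \<and> (\<exists>A \<in> set ns. d = code (Inl A) # d')) \<or>
     (ls' = ls \<and> (\<exists>a xs ds. d = a # ds \<and> d' = rev xs @ ds \<and>
       ([] \<notin> set xs \<longrightarrow> (\<exists>A rhs. (A, rhs) \<in> set ps \<and> a = code (Inl A) \<and> xs = map code (rev rhs))))))"
  using assms unfolding den_Alt_iff
proof (elim disjE)
  assume "den sem letter_cmd (dstate ls d) s'"
  from den_letter[OF this] obtain p a l' d' where 1: "letters ls = p @ a # l'" "d = a # d'"
    "s' = (i, st c (p @ l') (gst ps) (nonterms ns) d' [] [] q)" by blast
  then obtain us b vs where "ls = us @ b # vs" "p = letters us" "a = code (Inr b)" "l' = letters vs"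
    unfolding letters_def by (auto simp: map_eq_append_conv map_eq_Cons_conv simp del: code.simps)
  moreover from this have "s' = dstate (us @ vs) d'"
    using 1(3) by (simp add: letters_def)
  ultimately show ?thesis using 1(2) by (intro exI[of _ "us @ vs"] exI[of _ d']) auto
next
  assume "den sem null_cmd (dstate ls d) s'"
  from den_null[OF this] show ?thesis by (force simp: nonterms_def simp del: code.simps)
next
  assume "den sem expand_cmd (dstate ls d) s'"
  from den_expand[OF this] obtain p xs a g' d' where 1: "gst ps = p @ [] # xs @ a # [] # g'" "d = a # d'"
    "s' = dstate ls (rev xs @ d')" by blast
  with gst_parse[OF 1(1)] show ?thesis by blast
qed

text \<open>The induction runs backwards from the empty derivation stack. The later content
  \<open>d'\<close> is then already known to consist of codes, so the names copied to it contain no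
  separator and \<open>gst_parse\<close> yields a production.\<close>

lemma derive_sound:
  assumes "den sem derive_cmd (dstate ls d) s'"
    and "snd s' SD = []" "snd s' SL = []"
    and null: "\<And>A. A \<in> set ns \<Longrightarrow> (cfg_step R)\<^sup>*\<^sup>* [Inl A] []" and R: "set ps = set R"
  shows "\<exists>\<alpha> w. d = map code \<alpha> \<and> (cfg_step R)\<^sup>*\<^sup>* \<alpha> (map Inr w) \<and> mset w = mset ls"
  using assms(1) unfolding derive_cmd_def den.simps(5)
proof (induction "dstate ls d" arbitrary: ls d rule: converse_rtranclp_induct)
  case base
  then have "d = map code []" "mset [] = mset ls" using assms(2,3) by (auto simp: letters_def)
  moreover have "(cfg_step R)\<^sup>*\<^sup>* [] (map Inr [])" by simp
  ultimately show ?case by blast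
next
  case (step v)
  from derive_sound_step[OF step(1)] obtain ls' d' where
    v: "v = dstate ls' d'" and
    cs: "(\<exists>a. d = code (Inr a) # d' \<and> mset ls = add_mset a (mset ls')) \<or>
     (ls' = ls \<and> (\<exists>A \<in> set ns. d = code (Inl A) # d')) \<or>
     (ls' = ls \<and> (\<exists>a xs ds. d = a # ds \<and> d' = rev xs @ ds \<and>
       ([] \<notin> set xs \<longrightarrow> (\<exists>A rhs. (A, rhs) \<in> set ps \<and> a = code (Inl A) \<and> xs = map code (rev rhs)))))" by blast
  from step(3)[OF v] obtain \<alpha> w where IH: "d' = map code \<alpha>" "(cfg_step R)\<^sup>*\<^sup>* \<alpha> (map Inr w)" "mset w = mset ls'" by blast
  from cs show ?case
  proof (elim disjE exE conjE bexE)
    fix a assume a: "d = code (Inr a) # d'" "mset ls = add_mset a (mset ls')"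
    have "d = map code (Inr a # \<alpha>)" "mset (a # w) = mset ls" using a IH by simp_all
    moreover have "(cfg_step R)\<^sup>*\<^sup>* (Inr a # \<alpha>) (map Inr (a # w))"
      using derives_context[OF IH(2), of "[Inr a]" "[]"] by simp
    ultimately show ?thesis by blast
  next
    fix A assume A: "ls' = ls" "A \<in> set ns" "d = code (Inl A) # d'"
    have "d = map code (Inl A # \<alpha>)" "mset w = mset ls" using A IH by simp_all
    moreover have "(cfg_step R)\<^sup>*\<^sup>* (Inl A # \<alpha>) (map Inr w)"
      using derives_append[OF null[OF A(2)] IH(2)] by simp
    ultimately show ?thesis by blast
  next
    fix a xs ds assume a: "ls' = ls" "d = a # ds" "d' = rev xs @ ds"
      "[] \<notin> set xs \<longrightarrow> (\<exists>A rhs. (A, rhs) \<in> set ps \<and> a = code (Inl A) \<and> xs = map code (rev rhs))"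
    have "set xs \<subseteq> set d'" using a(3) by auto
    then have "[] \<notin> set xs" using IH(1) code_not_Nil by (metis (no_types, lifting) ex_map_conv in_mono)
    with a(4) obtain A rhs where A: "(A, rhs) \<in> set ps" "a = code (Inl A)" "xs = map code (rev rhs)" by blast
    have "map code \<alpha> = map code rhs @ ds" using IH(1) a(3) A(3) by (simp add: rev_map[symmetric])
    from map_code_eq_append[OF this] obtain \<gamma> where g: "\<alpha> = rhs @ \<gamma>" "ds = map code \<gamma>" by blast
    have "d = map code (Inl A # \<gamma>)" using a(2) A(2) g(2) by simp
    moreover have "(cfg_step R)\<^sup>*\<^sup>* (Inl A # \<gamma>) (map Inr w)"
      using derives_production[of A rhs R \<gamma>] A(1) R IH(2) g(1) by simp
    ultimately show ?thesis using IH(3) a(1) by blast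
  qed
qed

end

text \<open>Here a forward induction works: each skipped name occurs in SN, so no separator can be
  crossed.\<close>

lemma nullable_sound:
  assumes "den sem (Star nullable_cmd) (i, st c l (gst ps) [] d k [] []) s'" and R: "set ps = set R"
  shows "\<exists>ns. s' = (i, st c l (gst ps) (nonterms ns) d k [] []) \<and> (\<forall>A \<in> set ns. (cfg_step R)\<^sup>*\<^sup>* [Inl A] [])"
  using assms(1) unfolding den.simps(5)
proof (induction rule: rtranclp_induct)
  case base
  then show ?case by (intro exI[of _ "[]"]) (simp add: nonterms_def)
next
  case (step u v)
  then obtain ns where ns: "u = (i, st c l (gst ps) (nonterms ns) d k [] [])"
    "\<And>A. A \<in> set ns \<Longrightarrow> (cfg_step R)\<^sup>*\<^sup>* [Inl A] []" by blast
  from den_nullable[OF step(2)[unfolded ns(1)]] obtain p xs a g' where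
    1: "gst ps = p @ [] # xs @ a # [] # g'" "set xs \<subseteq> set (nonterms ns)"
    "v = (i, st c l (gst ps) (a # nonterms ns) d k [] [])" by blast
  have "[] \<notin> set xs" using 1(2) by (auto simp: nonterms_def)
  from gst_parse[OF 1(1) this] obtain A rhs where A: "(A, rhs) \<in> set ps" "a = code (Inl A)" "xs = map code (rev rhs)" by blast
  have rhs: "\<exists>B \<in> set ns. X = Inl B" if "X \<in> set rhs" for X
  proof -
    have "code X \<in> set (nonterms ns)" using that 1(2) A(3) by auto
    then show ?thesis unfolding nonterms_def by (auto simp: code_inject simp del: code.simps)
  qed
  have "(cfg_step R)\<^sup>*\<^sup>* \<alpha> []" if "set \<alpha> \<subseteq> set rhs" for \<alpha>
    using that
  proof (induction \<alpha>)
    case (Cons X \<alpha>)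
    then obtain B where "B \<in> set ns" "X = Inl B" using rhs by auto
    then show ?case using derives_append[OF ns(2), of B \<alpha> "[]"] Cons by simp
  qed simp
  from derives_production[of A rhs R "[]"] this[of rhs] A(1) R have "(cfg_step R)\<^sup>*\<^sup>* [Inl A] []" by simp
  then show ?case using ns(2) 1(3) A(2)
    by (intro exI[of _ "A # ns"]) (auto simp: nonterms_def)
qed

lemma unary_sound:
  assumes "den sem unary_cmd (i, st [] [] [] [] [] [] [] []) s'"
  shows "\<exists>s i'. i = enc_unary s @ i' \<and> s' = (i', st [code (Inr s)] (letters (rev [0..<s])) [] [] [] [] [] [])"
proof -
  obtain s1 s2 where 1: "den sem (Act (PushZ SC)) (i, st [] [] [] [] [] [] [] []) s1"
    and 2: "den sem (Star (seqs [Act (Rd True), Act (Names [SC] [SC, SL]), Act (Inc SC)])) s1 s2"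
    and 3: "den sem (Act (Rd False)) s2 s'"
    using assms unfolding unary_cmd_def seqs.simps den_Seq_iff den.simps(1) by blast
  have s1: "s1 = (i, st [code (Inr 0)] (letters (rev [0..<0])) [] [] [] [] [] [])"
    using 1 by (simp add: bin_0 letters_def)
  have "\<exists>s i'. i = replicate s True @ i' \<and> s2 = (i', st [code (Inr s)] (letters (rev [0..<s])) [] [] [] [] [] [])"
    using 2 unfolding den.simps(5) s1
  proof (induction rule: rtranclp_induct)
    case base
    show ?case by (intro exI[of _ 0] exI[of _ i]) simp
  next
    case (step u v)
    then obtain s i' where u: "i = replicate s True @ i'" "u = (i', st [code (Inr s)] (letters (rev [0..<s])) [] [] [] [] [] [])" by blast
    from step(2) obtain i'' where "i' = True # i''" "v = (i'', st [code (Inr (Suc s))] (letters (rev [0..<Suc s])) [] [] [] [] [] [])"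
      unfolding u seqs.simps den_Seq_iff by (auto simp: bin_bsucc letters_def)
    then show ?case using u by (intro exI[of _ "Suc s"] exI[of _ i'']) (simp add: replicate_app_Cons_same)
  qed
  then obtain s i' where "i = replicate s True @ i'" "s2 = (i', st [code (Inr s)] (letters (rev [0..<s])) [] [] [] [] [] [])" by blast
  then show ?thesis using 3 by (auto simp: enc_unary_def)
qed

definition sym_ok :: "nat list \<Rightarrow> sym \<Rightarrow> bool" where
  "sym_ok ls X \<longleftrightarrow> (\<forall>a. X = Inr a \<longrightarrow> a \<in> set ls)"

lemma symbol_sound:
  assumes "den sem symbol_cmd (i, st c (letters ls) g n d [] [] q) s'"
  shows "\<exists>X i'. i = enc_sym X @ i' \<and> sym_ok ls X \<and> s' = (i', st c (letters ls) (code X # g) n d [] [] q)"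
  using assms unfolding symbol_cmd_def den_Alt_iff
proof
  assume "den sem (seqs [Act (Rd False), Act (RdName False SG)]) (i, st c (letters ls) g n d [] [] q) s'"
  then obtain A i' where "i = False # enc_nat A @ i'" "s' = (i', st c (letters ls) (code (Inl A) # g) n d [] [] q)"
    unfolding seqs.simps den_Seq_iff by auto
  then show ?thesis by (intro exI[of _ "Inl A"] exI[of _ i']) (simp add: sym_ok_def)
next
  assume "den sem (seqs [Act (Rd True), Act (RdName True SK), rot SL SR, Act (Names [SK, SL] [SG, SL]), rot SR SL, Act (IsEmp SR)])
    (i, st c (letters ls) g n d [] [] q) s'"
  then obtain a i' where a: "i = True # enc_nat a @ i'" "code (Inr a) \<in> set (letters ls)"
    "s' = (i', st c (letters ls) (code (Inr a) # g) n d [] [] q)"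
    unfolding seqs.simps den_Seq_iff by (auto simp: den_rot)
  have "sym_ok ls (Inr a)" using a(2) by (auto simp: letters_def sym_ok_def bin_inject)
  with a show ?thesis by (intro exI[of _ "Inr a"] exI[of _ i']) simp
qed

lemma symbols_sound:
  assumes "den sem (Star (seqs [Act (Rd True), symbol_cmd])) (i, st c (letters ls) g n d [] [] q) s'"
  shows "\<exists>\<alpha> i'. i = concat (map (\<lambda>X. True # enc_sym X) \<alpha>) @ i' \<and> (\<forall>X \<in> set \<alpha>. sym_ok ls X) \<and>
    s' = (i', st c (letters ls) (map code (rev \<alpha>) @ g) n d [] [] q)"
  using assms unfolding den.simps(5)
proof (induction rule: rtranclp_induct)
  case base
  show ?case by (intro exI[of _ "[]"] exI[of _ i]) simp
next
  case (step u v)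
  then obtain \<alpha> i' where 1: "i = concat (map (\<lambda>X. True # enc_sym X) \<alpha>) @ i'" "\<forall>X \<in> set \<alpha>. sym_ok ls X"
    "u = (i', st c (letters ls) (map code (rev \<alpha>) @ g) n d [] [] q)" by blast
  from step(2) obtain i1 where 2: "i' = True # i1" "den sem symbol_cmd (i1, st c (letters ls) (map code (rev \<alpha>) @ g) n d [] [] q) v"
    unfolding 1(3) seqs.simps den_Seq_iff by auto
  from symbol_sound[OF 2(2)] obtain X i2 where "i1 = enc_sym X @ i2" "sym_ok ls X"
    "v = (i2, st c (letters ls) (code X # map code (rev \<alpha>) @ g) n d [] [] q)" by blast
  then show ?case using 1 2(1) by (intro exI[of _ "\<alpha> @ [X]"] exI[of _ i2]) auto
qed

lemma production_sound:
  assumes "den sem production_cmd (i, st c (letters ls) ([] # g) n d [] [] q) s'"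
  shows "\<exists>A \<alpha> i'. i = True # enc_prod (A, \<alpha>) @ i' \<and> (\<forall>X \<in> set \<alpha>. sym_ok ls X) \<and>
    s' = (i', st c (letters ls) ([] # map code (rev \<alpha>) @ code (Inl A) # [] # g) n d [] [] q)"
proof -
  obtain s1 s2 where 1: "den sem (seqs [Act (Rd True), Act (RdName False SG)]) (i, st c (letters ls) ([] # g) n d [] [] q) s1"
    and 2: "den sem (Star (seqs [Act (Rd True), symbol_cmd])) s1 s2"
    and 3: "den sem (seqs [Act (Rd False), Act (PushE SG)]) s2 s'"
    using assms unfolding production_cmd_def seqs.simps den_Seq_iff den.simps(1) by blast
  from 1 obtain A i1 where s1: "i = True # enc_nat A @ i1" "s1 = (i1, st c (letters ls) (code (Inl A) # [] # g) n d [] [] q)"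
    unfolding seqs.simps den_Seq_iff by auto
  from symbols_sound[OF 2[unfolded s1(2)]] obtain \<alpha> i2 where
    s2: "i1 = concat (map (\<lambda>X. True # enc_sym X) \<alpha>) @ i2" "\<forall>X \<in> set \<alpha>. sym_ok ls X"
      "s2 = (i2, st c (letters ls) (map code (rev \<alpha>) @ code (Inl A) # [] # g) n d [] [] q)" by blast
  from 3 obtain i3 where "i2 = False # i3" "s' = (i3, st c (letters ls) ([] # map code (rev \<alpha>) @ code (Inl A) # [] # g) n d [] [] q)"
    unfolding s2(3) seqs.simps den_Seq_iff by auto
  then show ?thesis using s1 s2
    by (intro exI[of _ A] exI[of _ \<alpha>] exI[of _ i3]) (simp add: enc_list_def)
qed

lemma grammar_sound:
  assumes "den sem grammar_cmd (i, st c (letters ls) [] n d [] [] q) s'"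
  shows "\<exists>R. i = enc_list enc_prod R \<and> (\<forall>(A, \<alpha>) \<in> set R. \<forall>X \<in> set \<alpha>. sym_ok ls X) \<and>
    s' = ([], st c (letters ls) (gst (rev R)) n d [] [] q)"
proof -
  obtain s2 where 2: "den sem (Star production_cmd) (i, st c (letters ls) (gst []) n d [] [] q) s2"
    and 3: "den sem (seqs [Act (Rd False), Act RdEnd]) s2 s'"
    using assms unfolding grammar_cmd_def seqs.simps den_Seq_iff by (auto simp: gst_simps)
  have "\<exists>R i'. i = concat (map (\<lambda>p. True # enc_prod p) R) @ i' \<and> (\<forall>(A, \<alpha>) \<in> set R. \<forall>X \<in> set \<alpha>. sym_ok ls X) \<and>
    s2 = (i', st c (letters ls) (gst (rev R)) n d [] [] q)"
    using 2 unfolding den.simps(5)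
  proof (induction rule: rtranclp_induct)
    case base
    show ?case by (intro exI[of _ "[]"] exI[of _ i]) simp
  next
    case (step u v)
    then obtain R i' where 1: "i = concat (map (\<lambda>p. True # enc_prod p) R) @ i'"
      "\<forall>(A, \<alpha>) \<in> set R. \<forall>X \<in> set \<alpha>. sym_ok ls X" "u = (i', st c (letters ls) (gst (rev R)) n d [] [] q)" by blast
    obtain r where r: "gst (rev R) = [] # r" using gst_head by blast
    from production_sound[OF step(2)[unfolded 1(3) r]] obtain A \<alpha> i2 where
      "i' = True # enc_prod (A, \<alpha>) @ i2" "\<forall>X \<in> set \<alpha>. sym_ok ls X"
      "v = (i2, st c (letters ls) ([] # map code (rev \<alpha>) @ code (Inl A) # [] # r) n d [] [] q)" by blast
    then show ?case using 1 r by (intro exI[of _ "R @ [(A, \<alpha>)]"] exI[of _ i2]) (auto simp: gst_simps)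
  qed
  then obtain R i' where R: "i = concat (map (\<lambda>p. True # enc_prod p) R) @ i'"
      "\<forall>(A, \<alpha>) \<in> set R. \<forall>X \<in> set \<alpha>. sym_ok ls X" "s2 = (i', st c (letters ls) (gst (rev R)) n d [] [] q)" by blast
  from 3 have "i' = [False]" "s' = ([], st c (letters ls) (gst (rev R)) n d [] [] q)"
    unfolding R(3) seqs.simps den_Seq_iff by auto
  then show ?thesis using R by (intro exI[of _ R]) (simp add: enc_list_def)
qed

lemma pangram_sound:
  assumes "den sem pangram_cmd (x, \<lambda>_. []) s'"
  shows "x \<in> PANGRAM_CFG"
proof -
  obtain s1 s2 s3 s4 s5 where 1: "den sem unary_cmd (x, st [] [] [] [] [] [] [] []) s1"
    and 2: "den sem (Act (RdName False SD)) s1 s2" and 3: "den sem grammar_cmd s2 s3"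
    and 4: "den sem (Star nullable_cmd) s3 s4" and 5: "den sem derive_cmd s4 s5"
    and 6: "den sem (seqs [Act (IsEmp SD), Act (IsEmp SL)]) s5 s'"
    using assms unfolding pangram_cmd_def seqs.simps den_Seq_iff st_empty by blast
  from unary_sound[OF 1] obtain s i1 where s1: "x = enc_unary s @ i1"
    "s1 = (i1, st [code (Inr s)] (letters (rev [0..<s])) [] [] [] [] [] [])" by blast
  from 2 obtain S i2 where s2: "i1 = enc_nat S @ i2"
    "s2 = (i2, st [code (Inr s)] (letters (rev [0..<s])) [] [] [code (Inl S)] [] [] [])"
    unfolding s1(2) by auto
  from grammar_sound[OF 3[unfolded s2(2)]] obtain R where R: "i2 = enc_list enc_prod R"
    "\<forall>(A, \<alpha>) \<in> set R. \<forall>X \<in> set \<alpha>. sym_ok (rev [0..<s]) X"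
    "s3 = ([], st [code (Inr s)] (letters (rev [0..<s])) (gst (rev R)) [] [code (Inl S)] [] [] [])" by blast
  from nullable_sound[OF 4[unfolded R(3)], of R] obtain ns where ns:
    "s4 = ([], st [code (Inr s)] (letters (rev [0..<s])) (gst (rev R)) (nonterms ns) [code (Inl S)] [] [] [])"
    "\<And>A. A \<in> set ns \<Longrightarrow> (cfg_step R)\<^sup>*\<^sup>* [Inl A] []" by auto
  have "snd s5 SD = []" "snd s5 SL = []" using 6 unfolding seqs.simps den_Seq_iff by (cases s5; auto)+
  from derive_sound[OF 5[unfolded ns(1)] this ns(2) set_rev]
  have "\<exists>\<alpha> w. [code (Inl S)] = map code \<alpha> \<and> (cfg_step R)\<^sup>*\<^sup>* \<alpha> (map Inr w) \<and> mset w = mset (rev [0..<s])" .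
  then obtain \<alpha> w where
    w: "[code (Inl S)] = map code \<alpha>" "(cfg_step R)\<^sup>*\<^sup>* \<alpha> (map Inr w)" "mset w = mset (rev [0..<s])"
    by (elim exE conjE) (rule that)
  have "\<alpha> = [Inl S]" using w(1) code_inject by (auto simp del: code.simps)
  then have "w \<in> cfg_lang S R \<inter> perfect_pangrams s"
    using w by (simp add: cfg_lang_def perfect_pangram_iff_mset)
  moreover have "cfg_over s R" using R(2) by (auto simp: cfg_over_def sym_ok_def)
  ultimately show ?thesis using s1(1) s2(1) R(1)
    unfolding PANGRAM_CFG_def enc_instance_def by blast
qed

section \<open>Running time of the pangram program\<close>

lemma exec_actI: "sem a s s' \<Longrightarrow> weight a \<le> m \<Longrightarrow> exec semc (Act a) s m s'"
  by (rule exec_Act[of _ _ _ m]) (auto simp: semc_def)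

text \<open>\<open>null_list\<close> has its newest member at the front, so the loop that builds it
  is extended by a last round. The 3 is 2 for that round and 1 for leaving the loop.\<close>

lemma exec_Star_snoc:
  "exec A (Star c) s m s1 \<Longrightarrow> exec A c s1 n s2 \<Longrightarrow> exec A (Star c) s (m + n + 3) s2"
proof (induction "Star c" s m s1 rule: exec.induct)
  case (exec_Star0 k s)
  have "exec A (Star c) s2 1 s2" by (rule exec.exec_Star0) simp
  with exec_Star0(2) show ?case by (rule exec.exec_Star1) simp
next
  case (exec_Star1 s m s' j s'' k)
  have "exec A (Star c) s' (j + n + 3) s2" using exec_Star1 by blast
  with exec_Star1(1) show ?case by (rule exec.exec_Star1) (use exec_Star1.hyps in simp)
qed

text \<open>Five per name: \<open>Names\<close> with one stack on each side weighs 3, and a round of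
  \<open>Star\<close> adds 2.\<close>

lemma exec_rot:
  assumes "a \<noteq> b"
  shows "t a = p @ q \<Longrightarrow> exec semc (rot a b) (i, t) (5 * length p + 1) (i, t(a := q, b := rev p @ t b))"
proof (induction p arbitrary: t)
  case Nil
  then have "t(a := q, b := rev [] @ t b) = t" by (simp add: fun_upd_idem)
  then show ?case unfolding rot_def by (metis exec_Star0 le_add2)
next
  case (Cons n p)
  let ?u = "t(a := p @ q, b := n # t b)"
  have 1: "exec semc (Act (Names [a] [b])) (i, t) 3 (i, ?u)"
    by (rule exec_actI) (use Cons.prems assms in auto)
  have "?u(a := q, b := rev p @ ?u b) = t(a := q, b := rev (n # p) @ t b)"
    using assms by (simp add: fun_eq_iff)
  with Cons.IH[of ?u] assms
  have 2: "exec semc (rot a b) (i, ?u) (5 * length p + 1) (i, t(a := q, b := rev (n # p) @ t b))"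
    by (metis fun_upd_same fun_upd_other)
  show ?case unfolding rot_def by (rule exec_Star1[OF 1 2[unfolded rot_def]]) simp
qed

text \<open>The search pattern shared by \<open>letter_cmd\<close>, \<open>null_cmd\<close>,
  \<open>member_cmd\<close> and the terminal case of \<open>symbol_cmd\<close>: rotate to the place,
  act, rotate back.\<close>

lemma exec_visit:
  assumes "a \<noteq> b" "t a = p @ q" "t b = []"
    and mid: "exec semc mid (i, t(a := q, b := rev p)) m (i, t'(b := rev p))"
    and k: "10 * length p + m + 7 \<le> k"
  shows "exec semc (seqs [rot a b, mid, rot b a, Act (IsEmp b)]) (i, t) k
    (i, t'(a := p @ t' a, b := []))"
proof -
  let ?t = "t'(a := p @ t' a, b := [])"
  have 1: "exec semc (rot a b) (i, t) (5 * length p + 1) (i, t(a := q, b := rev p))"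
    using exec_rot[of a b t p q i] assms by simp
  have "(t'(b := rev p))(b := [], a := p @ t' a) = ?t" using assms(1) by (simp add: fun_eq_iff)
  with exec_rot[of b a "t'(b := rev p)" "rev p" "[]" i] assms(1)
  have 3: "exec semc (rot b a) (i, t'(b := rev p)) (5 * length p + 1) (i, ?t)" by simp
  have 4: "exec semc (Act (IsEmp b)) (i, ?t) 1 (i, ?t)" by (rule exec_actI) auto
  show ?thesis unfolding seqs.simps
    by (rule exec_mono[OF exec_SeqI[OF 1 exec_SeqI[OF mid exec_SeqI[OF 3 exec_SeqI[OF 4 exec_Skip[of _ _ 0]]]]]]) (use k in simp)
qed

lemma exec_letter:
  "exec semc letter_cmd (i, st c (p @ a # l) g n (a # d) k [] q) (10 * length p + 10)
     (i, st c (p @ l) g n d k [] q)"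
proof -
  have "exec semc (Act (Names [SD, SL] [])) (i, st c (a # l) g n (a # d) k (rev p) q) 3
      (i, st c l g n d k (rev p) q)"
    by (rule exec_actI) auto
  then show ?thesis unfolding letter_cmd_def
    using exec_visit[of SL SR "st c (p @ a # l) g n (a # d) k [] q" p "a # l" _ i 3 "st c l g n d k [] q" "10 * length p + 10"] by simp
qed

lemma exec_null:
  "exec semc null_cmd (i, st c l g (p @ a # n) (a # d) k [] q) (10 * length p + 11)
     (i, st c l g (p @ a # n) d k [] q)"
proof -
  have "exec semc (Act (Names [SD, SN] [SN])) (i, st c l g (a # n) (a # d) k (rev p) q) 4
      (i, st c l g (a # n) d k (rev p) q)"
    by (rule exec_actI) auto
  then show ?thesis unfolding null_cmd_def
    using exec_visit[of SN SR "st c l g (p @ a # n) (a # d) k [] q" p "a # n" _ i 4 "st c l g (a # n) d k [] q" "10 * length p + 11"] by simp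
qed

lemma exec_copy:
  "exec semc copy_cmd (i, st c l (xs @ g) n d k r q) (6 * length xs + 1) (i, st c l g n (rev xs @ d) k (rev xs @ r) q)"
proof (induction xs arbitrary: d r)
  case Nil
  show ?case unfolding copy_cmd_def by (simp add: exec_Star0)
next
  case (Cons x xs)
  have 1: "exec semc (Act (Names [SG] [SR, SD])) (i, st c l ((x # xs) @ g) n d k r q) 4
      (i, st c l (xs @ g) n (x # d) k (x # r) q)"
    by (rule exec_actI) auto
  note 2 = exec_Star1[OF 1 Cons.IH[of "x # d" "x # r", unfolded copy_cmd_def]]
  have "exec semc (Star (Act (Names [SG] [SR, SD]))) (i, st c l ((x # xs) @ g) n d k r q) (6 * length (x # xs) + 1)
      (i, st c l g n (rev xs @ x # d) k (rev xs @ x # r) q)"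
    by (rule 2) simp
  then show ?case by (simp add: copy_cmd_def)
qed

lemma exec_enter:
  "exec semc enter_cmd (i, st c l (p @ [] # g) n d k [] q) (5 * length p + 6) (i, st c l g n d k ([] # rev p) q)"
proof -
  have 1: "exec semc (rot SG SR) (i, st c l (p @ [] # g) n d k [] q) (5 * length p + 1) (i, st c l ([] # g) n d k (rev p) q)"
    using exec_rot[of SG SR "st c l (p @ [] # g) n d k [] q" p "[] # g" i] by simp
  have 2: "exec semc (Act (PopE SG)) (i, st c l ([] # g) n d k (rev p) q) 1 (i, st c l g n d k (rev p) q)"
    by (rule exec_actI) auto
  have 3: "exec semc (Act (PushE SR)) (i, st c l g n d k (rev p) q) 1 (i, st c l g n d k ([] # rev p) q)"
    by (rule exec_actI) auto
  show ?thesis unfolding enter_cmd_def seqs.simps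
    by (rule exec_mono[OF exec_SeqI[OF 1 exec_SeqI[OF 2 exec_SeqI[OF 3 exec_Skip[of _ _ 0]]]]]) simp
qed

lemma exec_leave:
  "exec semc leave_cmd (i, st c l ([] # g) n d k r q) (5 * length r + 8) (i, st c l (rev r @ [] # g) n d k [] q)"
proof -
  have 1: "exec semc (Act (PopE SG)) (i, st c l ([] # g) n d k r q) 1 (i, st c l g n d k r q)"
    by (rule exec_actI) auto
  have 2: "exec semc (Act (PushE SG)) (i, st c l g n d k r q) 1 (i, st c l ([] # g) n d k r q)"
    by (rule exec_actI) auto
  have 3: "exec semc (rot SR SG) (i, st c l ([] # g) n d k r q) (5 * length r + 1) (i, st c l (rev r @ [] # g) n d k [] q)"
    using exec_rot[of SR SG "st c l ([] # g) n d k r q" r "[]" i] by simp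
  have 4: "exec semc (Act (IsEmp SR)) (i, st c l (rev r @ [] # g) n d k [] q) 1 (i, st c l (rev r @ [] # g) n d k [] q)"
    by (rule exec_actI) auto
  show ?thesis unfolding leave_cmd_def seqs.simps
    by (rule exec_mono[OF exec_SeqI[OF 1 exec_SeqI[OF 2 exec_SeqI[OF 3 exec_SeqI[OF 4 exec_Skip[of _ _ 0]]]]]]) simp
qed

lemma exec_expand:
  assumes g: "g = p @ [] # xs @ a # [] # g'"
  shows "exec semc expand_cmd (i, st c l g n (a # d) [] [] q) (16 * length g + 40)
     (i, st c l g n (rev xs @ d) [] [] q)"
proof -
  have 1: "exec semc (Act (Names [SD] [SK])) (i, st c l g n (a # d) [] [] q) 3 (i, st c l g n d [a] [] q)"
    by (rule exec_actI) auto
  note 2 = exec_enter[of i c l p "xs @ a # [] # g'" n d "[a]" q, folded g]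
  note 3 = exec_copy[of i c l xs "a # [] # g'" n d "[a]" "[] # rev p" q]
  let ?r = "a # rev xs @ [] # rev p"
  have 4: "exec semc (Act (Names [SK, SG] [SR])) (i, st c l (a # [] # g') n (rev xs @ d) [a] (rev xs @ [] # rev p) q) 4
     (i, st c l ([] # g') n (rev xs @ d) [] ?r q)"
    by (rule exec_actI) auto
  have r: "rev ?r @ [] # g' = g" by (simp add: g)
  note 5 = exec_leave[of i c l g' n "rev xs @ d" "[]" ?r q, unfolded r]
  show ?thesis unfolding expand_cmd_def seqs.simps
    by (rule exec_mono[OF exec_SeqI[OF 1 exec_SeqI[OF 2 exec_SeqI[OF 3 exec_SeqI[OF 4 exec_SeqI[OF 5
      exec_Skip[of _ _ 0]]]]]]]) (simp add: g)
qed

lemma exec_member: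
  "exec semc member_cmd (i, st c l (a # g) (p @ a # n) d k r []) (10 * length p + 12) (i, st c l g (p @ a # n) d k (a # r) [])"
proof -
  have "exec semc (Act (Names [SG, SN] [SR, SN])) (i, st c l (a # g) (a # n) d k r (rev p)) 5
      (i, st c l g (a # n) d k (a # r) (rev p))"
    by (rule exec_actI) auto
  then show ?thesis unfolding member_cmd_def
    using exec_visit[of SN SQ "st c l (a # g) (p @ a # n) d k r []" p "a # n" _ i 5 "st c l g (a # n) d k (a # r) []" "10 * length p + 12"] by simp
qed

lemma exec_members:
  "set xs \<subseteq> set n \<Longrightarrow> exec semc (Star member_cmd) (i, st c l (xs @ g) n d k r []) (length xs * (10 * length n + 14) + 1)
     (i, st c l g n d k (rev xs @ r) [])"
proof (induction xs arbitrary: r)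
  case Nil
  show ?case by (simp add: exec_Star0)
next
  case (Cons x xs)
  then obtain p n' where n: "n = p @ x # n'" by (metis in_set_conv_decomp insert_subset list.simps(15))
  have 1: "exec semc member_cmd (i, st c l ((x # xs) @ g) n d k r []) (10 * length p + 12) (i, st c l (xs @ g) n d k (x # r) [])"
    using exec_member[of i c l x "xs @ g" p n' d k r] by (simp add: n)
  have 2: "exec semc (Star member_cmd) (i, st c l (xs @ g) n d k (x # r) []) (length xs * (10 * length n + 14) + 1)
     (i, st c l g n d k (rev (x # xs) @ r) [])" using Cons.IH[of "x # r"] Cons.prems by simp
  show ?case by (rule exec_Star1[OF 1 2]) (simp add: n)
qed

lemma exec_nullable:
  assumes g: "g = p @ [] # xs @ a # [] # g'" and n: "set xs \<subseteq> set n"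
  shows "exec semc nullable_cmd (i, st c l g n d k [] []) (16 * length g + length g * (10 * length n + 14) + 40)
     (i, st c l g (a # n) d k [] [])"
proof -
  note 1 = exec_enter[of i c l p "xs @ a # [] # g'" n d k "[]", folded g]
  note 2 = exec_members[OF n, of i c l "a # [] # g'" d k "[] # rev p"]
  let ?r = "a # rev xs @ [] # rev p"
  have 3: "exec semc (Act (Names [SG] [SR, SN])) (i, st c l (a # [] # g') n d k (rev xs @ [] # rev p) []) 4
     (i, st c l ([] # g') (a # n) d k ?r [])"
    by (rule exec_actI) auto
  have r: "rev ?r @ [] # g' = g" by (simp add: g)
  note 4 = exec_leave[of i c l g' "a # n" d k ?r "[]", unfolded r]
  have "length xs * (10 * length n + 14) \<le> length g * (10 * length n + 14)"
    by (rule mult_le_mono1) (simp add: g)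
  moreover have "length g = length p + length xs + length g' + 3" by (simp add: g)
  moreover have "length ?r = length xs + length p + 2" by simp
  ultimately have "5 * length p + 6 + (length xs * (10 * length n + 14) + 1 + (4 + (5 * length ?r + 8 + 0 + 1) + 1) + 1) + 1
    \<le> 16 * length g + length g * (10 * length n + 14) + 40"
    by linarith
  then show ?thesis unfolding nullable_cmd_def seqs.simps
    by (rule exec_mono[rotated, OF _ exec_SeqI[OF 1 exec_SeqI[OF 2 exec_SeqI[OF 3 exec_SeqI[OF 4 exec_Skip[of _ _ 0]]]]]])
qed

lemma gst_contains:
  "(A, rhs) \<in> set ps \<Longrightarrow> \<exists>p g'. gst ps = p @ [] # map code (rev rhs) @ code (Inl A) # [] # g'"
proof (induction ps)
  case (Cons pr ps)
  show ?case
  proof (cases "pr = (A, rhs)")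
    case True
    obtain r where "gst ps = [] # r" using gst_head by blast
    with True show ?thesis by (intro exI[of _ "[]"] exI[of _ r]) (simp add: gst_simps)
  next
    case False
    with Cons obtain p g' where "gst ps = p @ [] # map code (rev rhs) @ code (Inl A) # [] # g'" by auto
    then show ?thesis
      by (intro exI[of _ "gsep pr @ p"] exI[of _ g']) (simp add: gst_simps gsep_def)
  qed
qed simp

text \<open>The coefficient is 16 * 3P + 3P (10 P + 14) + 40 from \<open>exec_nullable\<close>, plus
  3 for a further round.\<close>

lemma exec_nullables:
  assumes "null_list R ns" "length ns \<le> P" "length (gst ps) \<le> 3 * P" and R: "set ps = set R"
  shows "exec semc (Star nullable_cmd) (i, st c l (gst ps) [] d k [] []) (length ns * (30 * P * P + 90 * P + 43) + 1)
     (i, st c l (gst ps) (nonterms ns) d k [] [])"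
  using assms(1,2)
proof (induction rule: null_list.induct)
  case null_list_Nil
  show ?case by (simp add: nonterms_def exec_Star0)
next
  case (null_list_Cons ns A rhs)
  have "(A, rhs) \<in> set ps" using null_list_Cons R by simp
  from gst_contains[OF this] obtain p g' where
    g: "gst ps = p @ [] # map code (rev rhs) @ code (Inl A) # [] # g'" by blast
  have "set (map code (rev rhs)) \<subseteq> set (nonterms ns)"
    using null_list_Cons(3) by (auto simp: nonterms_def simp del: code.simps)
  note 1 = exec_nullable[OF g this, of i c l d k]
  have 2: "exec semc (Star nullable_cmd) (i, st c l (gst ps) [] d k [] []) (length ns * (30 * P * P + 90 * P + 43) + 1)
     (i, st c l (gst ps) (nonterms ns) d k [] [])" using null_list_Cons by simp
  have "length (gst ps) * (10 * length (nonterms ns) + 14) \<le> (3 * P) * (10 * P + 14)"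
    using assms(3) null_list_Cons.prems by (intro mult_le_mono) (auto simp: nonterms_def)
  also have "\<dots> = 30 * P * P + 42 * P" by (simp add: algebra_simps)
  finally have "16 * length (gst ps) + length (gst ps) * (10 * length (nonterms ns) + 14) + 40 + 3 \<le> 30 * P * P + 90 * P + 43"
    using assms(3) by linarith
  then have le: "length ns * (30 * P * P + 90 * P + 43) + 1 +
      (16 * length (gst ps) + length (gst ps) * (10 * length (nonterms ns) + 14) + 40) + 3
    \<le> length (A # ns) * (30 * P * P + 90 * P + 43) + 1"
    by simp
  have e: "nonterms (A # ns) = code (Inl A) # nonterms ns" by (simp add: nonterms_def)
  show ?case unfolding e by (rule exec_mono[OF exec_Star_snoc[OF 2 1] le])
qed

text \<open>48 P + 44 pays for an expansion, which has the largest bound of the three kinds of step: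
  16 * 3P + 40, then 2 for the nested \<open>Alt\<close> and 2 for the round.\<close>

lemma exec_derive:
  assumes "dder R (set ns) n \<alpha> w" "mset w = mset ls"
    and "length ls \<le> P" "length ns \<le> P" "length (gst ps) \<le> 3 * P" and R: "set ps = set R"
  shows "exec semc derive_cmd (dstate i c q ps ns ls (map code \<alpha>)) (n * (48 * P + 44) + 1)
     (i, st c [] (gst ps) (nonterms ns) [] [] [] q)"
  using assms(1-3)
proof (induction arbitrary: ls rule: dder.induct)
  case dder_Nil
  then show ?case by (simp add: letters_def derive_cmd_def exec_Star0)
next
  case (dder_letter n \<alpha> w a)
  have "a \<in> set ls" using dder_letter.prems(1) by (metis list.set_intros(1) set_mset_mset)
  then obtain us vs where ls: "ls = us @ a # vs" by (auto simp: in_set_conv_decomp)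
  have 1: "exec semc letter_cmd (dstate i c q ps ns ls (map code (Inr a # \<alpha>)))
      (10 * length us + 10) (dstate i c q ps ns (us @ vs) (map code \<alpha>))"
    using exec_letter[of i c "letters us" "code (Inr a)" "letters vs" "gst ps" "nonterms ns" "map code \<alpha>" "[]" q]
    by (simp add: ls letters_def)
  have 2: "exec semc derive_cmd (dstate i c q ps ns (us @ vs) (map code \<alpha>)) (n * (48 * P + 44) + 1)
     (i, st c [] (gst ps) (nonterms ns) [] [] [] q)"
    using dder_letter ls by (intro dder_letter.IH) auto
  have "10 * length us + 10 + 1 + (n * (48 * P + 44) + 1) + 2 \<le> Suc n * (48 * P + 44) + 1"
    using dder_letter.prems(2) by (simp add: ls)
  then show ?case unfolding derive_cmd_def
    by (intro exec_Star1[OF exec_Alt1[OF 1 order_refl] 2[unfolded derive_cmd_def]])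
next
  case (dder_null A n \<alpha> w)
  then obtain us vs where ns: "ns = us @ A # vs" by (auto simp: in_set_conv_decomp)
  have 1: "exec semc null_cmd (dstate i c q ps ns ls (map code (Inl A # \<alpha>)))
      (10 * length us + 11) (dstate i c q ps ns ls (map code \<alpha>))"
    using exec_null[of i c "letters ls" "gst ps" "nonterms us" "code (Inl A)" "nonterms vs" "map code \<alpha>" "[]" q]
    by (simp add: ns nonterms_def)
  have 2: "exec semc derive_cmd (dstate i c q ps ns ls (map code \<alpha>)) (n * (48 * P + 44) + 1)
     (i, st c [] (gst ps) (nonterms ns) [] [] [] q)"
    using dder_null by (intro dder_null.IH) auto
  have "10 * length us + 11 + 1 + 1 + (n * (48 * P + 44) + 1) + 2 \<le> Suc n * (48 * P + 44) + 1"
    using assms(4) by (simp add: ns)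
  then show ?case unfolding derive_cmd_def
    by (intro exec_Star1[OF exec_Alt2[OF exec_Alt1[OF 1 order_refl] order_refl] 2[unfolded derive_cmd_def]])
next
  case (dder_expand A rhs n \<alpha> w)
  have "(A, rhs) \<in> set ps" using dder_expand R by simp
  from gst_contains[OF this] obtain p g' where
    g: "gst ps = p @ [] # map code (rev rhs) @ code (Inl A) # [] # g'" by blast
  have 1: "exec semc expand_cmd (dstate i c q ps ns ls (map code (Inl A # \<alpha>)))
      (16 * length (gst ps) + 40) (dstate i c q ps ns ls (map code (rhs @ \<alpha>)))"
    using exec_expand[OF g, of i c "letters ls" "nonterms ns" "map code \<alpha>" q] by (simp add: rev_map)
  have 2: "exec semc derive_cmd (dstate i c q ps ns ls (map code (rhs @ \<alpha>))) (n * (48 * P + 44) + 1)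
     (i, st c [] (gst ps) (nonterms ns) [] [] [] q)"
    using dder_expand by (intro dder_expand.IH) auto
  have "16 * length (gst ps) + 40 + 1 + 1 + (n * (48 * P + 44) + 1) + 2 \<le> Suc n * (48 * P + 44) + 1"
    using assms(5) by simp
  then show ?case unfolding derive_cmd_def
    by (intro exec_Star1[OF exec_Alt2[OF exec_Alt2[OF 1 order_refl] order_refl] 2[unfolded derive_cmd_def]])
qed

lemma exec_unary:
  "exec semc unary_cmd (enc_unary s @ i, st [] [] [] [] [] [] [] []) (11 * s + 6)
     (i, st [code (Inr s)] (letters (rev [0..<s])) [] [] [] [] [] [])"
proof -
  let ?b = "seqs [Act (Rd True), Act (Names [SC] [SC, SL]), Act (Inc SC)]"
  \<comment> \<open>The counter may start at any \<open>m\<close>, so that the induction hypothesis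
    applies after the first increment.\<close>
  have 2: "exec semc (Star ?b) (replicate j True @ r, st [code (Inr m)] (letters (rev [0..<m])) [] [] [] [] [] []) (11 * j + 1)
    (r, st [code (Inr (m + j))] (letters (rev [0..<m + j])) [] [] [] [] [] [])" for j m r
  proof (induction j arbitrary: m)
    case 0
    show ?case by (simp add: exec_Star0)
  next
    case (Suc j)
    let ?r = "replicate j True @ r" and ?l = "letters (rev [0..<m])"
    have 1: "exec semc (Act (Rd True)) (True # ?r, st [code (Inr m)] ?l [] [] [] [] [] []) 1
       (?r, st [code (Inr m)] ?l [] [] [] [] [] [])"
      by (rule exec_actI) auto
    have 2: "exec semc (Act (Names [SC] [SC, SL])) (?r, st [code (Inr m)] ?l [] [] [] [] [] []) 4
       (?r, st [code (Inr m)] (code (Inr m) # ?l) [] [] [] [] [] [])"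
      by (rule exec_actI) auto
    have 3: "exec semc (Act (Inc SC)) (?r, st [code (Inr m)] (code (Inr m) # ?l) [] [] [] [] [] []) 1
       (?r, st [code (Inr (Suc m))] (letters (rev [0..<Suc m])) [] [] [] [] [] [])"
      by (rule exec_actI) (auto simp: bin_bsucc letters_def)
    have 4: "exec semc ?b (replicate (Suc j) True @ r, st [code (Inr m)] ?l [] [] [] [] [] []) 9
       (?r, st [code (Inr (Suc m))] (letters (rev [0..<Suc m])) [] [] [] [] [] [])"
      unfolding seqs.simps replicate_Suc append_Cons
      by (rule exec_mono[OF exec_SeqI[OF 1 exec_SeqI[OF 2 exec_SeqI[OF 3 exec_Skip[of _ _ 0]]]]]) simp
    have 5: "Suc m + j = m + Suc j" by simp
    show ?case by (rule exec_Star1[OF 4 Suc.IH[of "Suc m", unfolded 5]]) simp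
  qed
  have 1: "exec semc (Act (PushZ SC)) (enc_unary s @ i, st [] [] [] [] [] [] [] []) 1
     (replicate s True @ False # i, st [code (Inr 0)] (letters (rev [0..<0])) [] [] [] [] [] [])"
    by (rule exec_actI) (auto simp: enc_unary_def bin_0 letters_def)
  have 3: "exec semc (Act (Rd False)) (False # i, st [code (Inr (0 + s))] (letters (rev [0..<0 + s])) [] [] [] [] [] []) 1
     (i, st [code (Inr s)] (letters (rev [0..<s])) [] [] [] [] [] [])"
    by (rule exec_actI) auto
  show ?thesis unfolding unary_cmd_def
    by (subst (1) seqs.simps, subst (1) seqs.simps(2), subst (1) seqs.simps(2), subst (1) seqs.simps(1))
      (rule exec_mono[OF exec_SeqI[OF 1 exec_SeqI[OF 2 exec_SeqI[OF 3 exec_Skip[of _ _ 0]]]]], simp)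
qed

lemma exec_symbol:
  assumes "sym_ok ls X"
  shows "exec semc symbol_cmd (enc_sym X @ i, st c (letters ls) g n d [] [] q) (10 * length ls + 20)
    (i, st c (letters ls) (code X # g) n d [] [] q)"
proof (cases X)
  case (Inl A)
  have 1: "exec semc (Act (Rd False)) (enc_sym X @ i, st c (letters ls) g n d [] [] q) 1
     (enc_nat A @ i, st c (letters ls) g n d [] [] q)"
    by (rule exec_actI) (auto simp: Inl)
  have 2: "exec semc (Act (RdName False SG)) (enc_nat A @ i, st c (letters ls) g n d [] [] q) 1
     (i, st c (letters ls) (code X # g) n d [] [] q)"
    by (rule exec_actI) (auto simp: Inl)
  have "exec semc (seqs [Act (Rd False), Act (RdName False SG)]) (enc_sym X @ i, st c (letters ls) g n d [] [] q) 4
    (i, st c (letters ls) (code X # g) n d [] [] q)"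
    unfolding seqs.simps by (rule exec_mono[OF exec_SeqI[OF 1 exec_SeqI[OF 2 exec_Skip[of _ _ 0]]]]) simp
  then show ?thesis unfolding symbol_cmd_def by (rule exec_Alt1) simp
next
  case (Inr a)
  then have "a \<in> set ls" using assms by (simp add: sym_ok_def)
  then obtain us vs where ls: "ls = us @ a # vs" by (auto simp: in_set_conv_decomp)
  let ?a = "code (Inr a)" and ?L = "letters ls"
  have 1: "exec semc (Act (Rd True)) (enc_sym X @ i, st c ?L g n d [] [] q) 1 (enc_nat a @ i, st c ?L g n d [] [] q)"
    by (rule exec_actI) (auto simp: Inr)
  have 2: "exec semc (Act (RdName True SK)) (enc_nat a @ i, st c ?L g n d [] [] q) 1 (i, st c ?L g n d [?a] [] q)"
    by (rule exec_actI) auto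
  have "exec semc (Act (Names [SK, SL] [SG, SL])) (i, st c (?a # letters vs) g n d [?a] (rev (letters us)) q) 5
     (i, st c (?a # letters vs) (?a # g) n d [] (rev (letters us)) q)"
    by (rule exec_actI) auto
  then have 3: "exec semc (seqs [rot SL SR, Act (Names [SK, SL] [SG, SL]), rot SR SL, Act (IsEmp SR)])
     (i, st c ?L g n d [?a] [] q) (10 * length us + 12) (i, st c ?L (?a # g) n d [] [] q)"
    using exec_visit[of SL SR "st c ?L g n d [?a] [] q" "letters us" "?a # letters vs" _ i 5
        "st c (?a # letters vs) (?a # g) n d [] [] q" "10 * length us + 12"] by (simp add: ls letters_def)
  show ?thesis unfolding symbol_cmd_def seqs.simps unfolding Inr
    by (rule exec_Alt2[OF exec_SeqI[OF 1[unfolded Inr] exec_SeqI[OF 2 3[unfolded seqs.simps]]]]) (simp add: ls)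
qed

lemma exec_symbols:
  "\<forall>X \<in> set \<alpha>. sym_ok ls X \<Longrightarrow> exec semc (Star (seqs [Act (Rd True), symbol_cmd]))
     (concat (map (\<lambda>X. True # enc_sym X) \<alpha>) @ i, st c (letters ls) g n d [] [] q) (length \<alpha> * (10 * length ls + 25) + 1)
     (i, st c (letters ls) (map code (rev \<alpha>) @ g) n d [] [] q)"
proof (induction \<alpha> arbitrary: g)
  case Nil
  show ?case by (simp add: exec_Star0)
next
  case (Cons X \<alpha>)
  let ?i = "concat (map (\<lambda>X. True # enc_sym X) \<alpha>) @ i"
  have 1: "exec semc (Act (Rd True)) (True # enc_sym X @ ?i, st c (letters ls) g n d [] [] q) 1
     (enc_sym X @ ?i, st c (letters ls) g n d [] [] q)"
    by (rule exec_actI) auto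
  have "sym_ok ls X" using Cons.prems by simp
  note 2 = exec_SeqI[OF 1 exec_SeqI[OF exec_symbol[OF this] exec_Skip[of _ _ 0]]]
  have 3: "exec semc (Star (seqs [Act (Rd True), symbol_cmd])) (?i, st c (letters ls) (code X # g) n d [] [] q)
     (length \<alpha> * (10 * length ls + 25) + 1) (i, st c (letters ls) (map code (rev (X # \<alpha>)) @ g) n d [] [] q)"
    using Cons.IH[of "code X # g"] Cons.prems by simp
  have 4: "concat (map (\<lambda>X. True # enc_sym X) (X # \<alpha>)) @ i = True # enc_sym X @ ?i" by simp
  show ?case unfolding 4 seqs.simps by (rule exec_Star1[OF 2[unfolded seqs.simps] 3[unfolded seqs.simps]]) simp
qed

lemma exec_production:
  assumes "\<forall>X \<in> set \<alpha>. sym_ok ls X"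
  shows "exec semc production_cmd (True # enc_prod (A, \<alpha>) @ i, st c (letters ls) g n d [] [] q)
     (length \<alpha> * (10 * length ls + 25) + 10)
     (i, st c (letters ls) ([] # map code (rev \<alpha>) @ code (Inl A) # g) n d [] [] q)"
proof -
  let ?i = "concat (map (\<lambda>X. True # enc_sym X) \<alpha>) @ False # i"
  have 1: "exec semc (Act (Rd True)) (True # enc_prod (A, \<alpha>) @ i, st c (letters ls) g n d [] [] q) 1
     (enc_nat A @ ?i, st c (letters ls) g n d [] [] q)"
    by (rule exec_actI) (auto simp: enc_list_def)
  have 2: "exec semc (Act (RdName False SG)) (enc_nat A @ ?i, st c (letters ls) g n d [] [] q) 1
     (?i, st c (letters ls) (code (Inl A) # g) n d [] [] q)"
    by (rule exec_actI) auto
  note 3 = exec_symbols[OF assms, of "False # i" c "code (Inl A) # g" n d q]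
  let ?g = "map code (rev \<alpha>) @ code (Inl A) # g"
  have 4: "exec semc (Act (Rd False)) (False # i, st c (letters ls) ?g n d [] [] q) 1 (i, st c (letters ls) ?g n d [] [] q)"
    by (rule exec_actI) auto
  have 5: "exec semc (Act (PushE SG)) (i, st c (letters ls) ?g n d [] [] q) 1 (i, st c (letters ls) ([] # ?g) n d [] [] q)"
    by (rule exec_actI) auto
  show ?thesis unfolding production_cmd_def seqs.simps
    by (rule exec_mono[OF exec_SeqI[OF 1 exec_SeqI[OF 2 exec_SeqI[OF 3[unfolded seqs.simps] exec_SeqI[OF 4 exec_SeqI[OF 5 exec_Skip[of _ _ 0]]]]]]]) simp
qed

text \<open>The summand 1 makes this a bound on the number of productions as well as on their
  lengths.\<close>

definition grammar_size :: "prod list \<Rightarrow> nat" where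
  "grammar_size R = sum_list (map (\<lambda>p. length (snd p) + 1) R)"

lemma exec_grammar:
  assumes "\<forall>(A, \<alpha>) \<in> set R. \<forall>X \<in> set \<alpha>. sym_ok ls X"
  shows "exec semc grammar_cmd (enc_list enc_prod R, st c (letters ls) [] n d [] [] q)
     (grammar_size R * (10 * length ls + 25) + 10) ([], st c (letters ls) (gst (rev R)) n d [] [] q)"
proof -
  \<comment> \<open>\<open>R0\<close> stands for the productions already read; they lie below the
    new ones, hence the \<open>rev\<close>.\<close>
  have 2: "exec semc (Star production_cmd) (concat (map (\<lambda>p. True # enc_prod p) R) @ i, st c (letters ls) (gst (rev R0)) n d [] [] q)
     (grammar_size R * (10 * length ls + 25) + 1) (i, st c (letters ls) (gst (rev (R0 @ R))) n d [] [] q)" for R0 i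
    using assms
  proof (induction R arbitrary: R0)
    case Nil
    show ?case by (simp add: exec_Star0)
  next
    case (Cons p R)
    obtain A \<alpha> where p: "p = (A, \<alpha>)" by (cases p)
    let ?i = "concat (map (\<lambda>p. True # enc_prod p) R) @ i"
    have "\<forall>X \<in> set \<alpha>. sym_ok ls X" using Cons.prems p by auto
    note 1 = exec_production[OF this, of A ?i c "gst (rev R0)" n d q]
    have g: "[] # map code (rev \<alpha>) @ code (Inl A) # gst (rev R0) = gst (rev (R0 @ [p]))"
      by (simp add: gst_simps p)
    have 2: "exec semc (Star production_cmd) (?i, st c (letters ls) (gst (rev (R0 @ [p]))) n d [] [] q)
      (grammar_size R * (10 * length ls + 25) + 1) (i, st c (letters ls) (gst (rev (R0 @ p # R))) n d [] [] q)"
      using Cons.IH[of "R0 @ [p]"] Cons.prems by simp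
    have 4: "concat (map (\<lambda>p. True # enc_prod p) (p # R)) @ i = True # enc_prod (A, \<alpha>) @ ?i" by (simp add: p)
    show ?case unfolding 4
      by (rule exec_Star1[OF 1[unfolded g] 2]) (simp add: grammar_size_def p algebra_simps)
  qed
  have 1: "exec semc (Act (PushE SG)) (enc_list enc_prod R, st c (letters ls) [] n d [] [] q) 1
     (concat (map (\<lambda>p. True # enc_prod p) R) @ [False], st c (letters ls) (gst (rev [])) n d [] [] q)"
    by (rule exec_actI) (auto simp: enc_list_def gst_simps)
  let ?t = "st c (letters ls) (gst (rev ([] @ R))) n d [] [] q"
  have 3: "exec semc (Act (Rd False)) ([False], ?t) 1 ([], ?t)"
    by (rule exec_actI) auto
  have 4: "exec semc (Act RdEnd) ([], ?t) 1 ([], st c (letters ls) (gst (rev R)) n d [] [] q)"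
    by (rule exec_actI) auto
  show ?thesis unfolding grammar_cmd_def seqs.simps
    by (rule exec_mono[OF exec_SeqI[OF 1 exec_SeqI[OF 2 exec_SeqI[OF 3 exec_SeqI[OF 4 exec_Skip[of _ _ 0]]]]]]) simp
qed

text \<open>In \<open>enc_list\<close> every entry is preceded by a continuation bit, so each symbol
  and each production contributes at least one bit.\<close>

lemma grammar_size_le: "grammar_size R \<le> length (enc_list enc_prod R)"
proof -
  have *: "length (enc_list f xs) = sum_list (map (\<lambda>x. length (f x) + 1) xs) + 1" for f :: "'a \<Rightarrow> bool list" and xs
    by (induction xs) (auto simp: enc_list_def)
  have "length (snd p) \<le> length (enc_prod p)" for p
    using sum_list_mono[of "snd p" "\<lambda>_. 1" "\<lambda>X. length (enc_sym X) + 1"]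
    by (cases p) (simp add: * sum_list_triv)
  then have "(\<Sum>p\<leftarrow>R. length (snd p) + 1) \<le> (\<Sum>p\<leftarrow>R. length (enc_prod p) + 1)"
    by (intro sum_list_mono add_right_mono)
  then show ?thesis unfolding * grammar_size_def by (rule trans_le_add1)
qed

lemma length_gst: "length (gst ps) \<le> 2 * grammar_size ps + 1"
  by (induction ps) (auto simp: gst_simps grammar_size_def)

lemma grammar_size_bounds:
  "length R \<le> grammar_size R" "(A, rhs) \<in> set R \<Longrightarrow> length rhs \<le> grammar_size R"
  "grammar_size (rev R) = grammar_size R"
proof -
  show "length R \<le> grammar_size R" by (induction R) (auto simp: grammar_size_def)
  show "(A, rhs) \<in> set R \<Longrightarrow> length rhs \<le> grammar_size R"
    by (induction R) (auto simp: grammar_size_def)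
  show "grammar_size (rev R) = grammar_size R" by (simp only: grammar_size_def rev_map[symmetric] sum_list_rev)
qed

text \<open>The derivation dominates and sets the degree: at most 3 P^5 steps of cost at most 92 P.
  The factor 2000 leaves ample room for the remaining phases.\<close>

lemma pangram_complete:
  assumes "x \<in> PANGRAM_CFG"
  shows "\<exists>n s'. n \<le> 2000 * (length x + 1) ^ 6 \<and> exec semc pangram_cmd (x, \<lambda>_. []) n s'"
proof -
  obtain s S R w where x: "x = enc_instance s S R" and over: "cfg_over s R"
    and w: "w \<in> cfg_lang S R" "w \<in> perfect_pangrams s"
    using assms unfolding PANGRAM_CFG_def by blast
  define P where "P = length x + 1"
  have len: "s \<le> P" "grammar_size R \<le> P" "1 \<le> P" "2 * grammar_size R + 1 \<le> 3 * P"
    using grammar_size_le[of R] by (auto simp: P_def x enc_instance_def enc_unary_def)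
  obtain ns where ns: "null_list R ns" "length ns \<le> length R"
    "\<And>A rhs. (A, rhs) \<in> set R \<Longrightarrow> set rhs \<subseteq> Inl ` set ns \<Longrightarrow> A \<in> set ns"
    using maximal_null_list by blast
  interpret bounded_cfg R "set ns" P
  proof
    show "length rhs \<le> P" if "(A, rhs) \<in> set R" for A rhs
      using grammar_size_bounds(2)[OF that] len(2) by simp
    show "length R \<le> P" using grammar_size_bounds(1)[of R] len(2) by simp
  qed (rule ns(3))
  have ms: "mset w = mset (rev [0..<s])" using w(2) by (simp add: perfect_pangram_iff_mset)
  \<comment> \<open>The word to be derived has length \<open>s\<close>, which is at most
    \<open>P\<close> because of the unary encoding; this makes the bound of
    \<open>yields_dder\<close> polynomial in the input.\<close>
  then have "length w = s" by (metis length_rev length_upt minus_nat.diff_0 size_mset)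
  have "\<exists>ws. list_all2 (yields R) [Inl S] ws \<and> concat ws = w"
    using w(1) by (intro derives_imp_yields) (simp add: cfg_lang_def)
  then have "yields R (Inl S) w" by (auto simp: list_all2_Cons1)
  from yields_dder[OF this] obtain n where n: "n \<le> 1 + (P * P * P + P) * s * s" "dder R (set ns) n [Inl S] w"
    unfolding \<open>length w = s\<close> by blast
  let ?c = "[code (Inr s)]" and ?l = "letters (rev [0..<s])" and ?g = "gst (rev R)" and ?n = "nonterms ns"
  have g3: "length ?g \<le> 3 * P" using length_gst[of "rev R"] len by (simp add: grammar_size_bounds(3))
  have nsP: "length ns \<le> P" using ns(2) R_le by simp
  have 1: "exec semc unary_cmd (x, \<lambda>_. []) (11 * s + 6) (enc_nat S @ enc_list enc_prod R, st ?c ?l [] [] [] [] [] [])"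
    unfolding x enc_instance_def st_empty by (rule exec_unary)
  have 2: "exec semc (Act (RdName False SD)) (enc_nat S @ enc_list enc_prod R, st ?c ?l [] [] [] [] [] []) 1
     (enc_list enc_prod R, st ?c ?l [] [] [code (Inl S)] [] [] [])"
    by (rule exec_actI) auto
  have "\<forall>(A, \<alpha>) \<in> set R. \<forall>X \<in> set \<alpha>. sym_ok (rev [0..<s]) X"
    using over by (auto simp: cfg_over_def sym_ok_def)
  note 3 = exec_grammar[OF this, of ?c "[]" "[code (Inl S)]" "[]"]
  note 4 = exec_nullables[OF ns(1) nsP g3 set_rev, of "[]" ?c ?l "[code (Inl S)]" "[]"]
  have 5: "exec semc derive_cmd ([], st ?c ?l ?g ?n [code (Inl S)] [] [] []) (n * (48 * P + 44) + 1)
     ([], st ?c [] ?g ?n [] [] [] [])"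
    using exec_derive[OF n(2) ms _ nsP g3 set_rev, of "[]" ?c "[]"] len(1) by simp
  have 6: "exec semc (Act (IsEmp SD)) ([], st ?c [] ?g ?n [] [] [] []) 1 ([], st ?c [] ?g ?n [] [] [] [])"
    by (rule exec_actI) auto
  have 7: "exec semc (Act (IsEmp SL)) ([], st ?c [] ?g ?n [] [] [] []) 1 ([], st ?c [] ?g ?n [] [] [] [])"
    by (rule exec_actI) auto
  note all = exec_SeqI[OF 1 exec_SeqI[OF 2 exec_SeqI[OF 3 exec_SeqI[OF 4 exec_SeqI[OF 5 exec_SeqI[OF 6
     exec_SeqI[OF 7 exec_Skip[of _ _ 0]]]]]]]]
  have pw: "P ^ a \<le> P ^ 6" if "a \<le> 6" for a using that len(3) by (intro power_increasing) auto
  have p1: "P \<le> P ^ 6" "1 \<le> P ^ 6" and p2: "P * P \<le> P ^ 6" and p3: "P * P * P \<le> P ^ 6"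
    using pw[of 1] pw[of 0] pw[of 2] pw[of 3] by (simp_all add: power2_eq_square power3_eq_cube)
  have c3: "grammar_size R * (10 * length (rev [0..<s]) + 25) \<le> 10 * (P * P) + 25 * P"
  proof -
    have "grammar_size R * (10 * length (rev [0..<s]) + 25) \<le> P * (10 * P + 25)"
      using len by (intro mult_le_mono) auto
    then show ?thesis by (simp add: algebra_simps)
  qed
  have c4: "length ns * (30 * P * P + 90 * P + 43) \<le> 30 * (P * P * P) + 90 * (P * P) + 43 * P"
  proof -
    have "length ns * (30 * P * P + 90 * P + 43) \<le> P * (30 * P * P + 90 * P + 43)"
      using nsP by (rule mult_le_mono1)
    then show ?thesis by (simp add: algebra_simps)
  qed
  have c5: "n * (48 * P + 44) \<le> 276 * P ^ 6"
  proof -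
    have "(P * P * P + P) * s * s \<le> (P * P * P + P * P * P) * P * P"
      using len by (intro mult_le_mono add_mono) auto
    also have "\<dots> = 2 * P ^ 5" by (simp add: eval_nat_numeral algebra_simps)
    finally have "n \<le> 3 * P ^ 5" using n(1) one_le_power[OF len(3), of 5] by linarith
    then have "n * (48 * P + 44) \<le> (3 * P ^ 5) * (92 * P)"
      using len(3) by (intro mult_le_mono) auto
    also have "\<dots> = 276 * P ^ 6" by (simp add: eval_nat_numeral algebra_simps)
    finally show ?thesis .
  qed
  show ?thesis
    unfolding pangram_cmd_def seqs.simps P_def[symmetric]
  proof (intro exI conjI)
    show "11 * s + 6 + (1 + (grammar_size R * (10 * length (rev [0..<s]) + 25) + 10 +
       (length ns * (30 * P * P + 90 * P + 43) + 1 + (n * (48 * P + 44) + 1 + (1 + (1 + 0 + 1) + 1) + 1) + 1) + 1) + 1) + 1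
       \<le> 2000 * P ^ 6"
      using c3 c4 c5 p1 p2 p3 len(1) by linarith
  qed (rule all)
qed

theorem mainTheorem7:
  shows "in_NP PANGRAM_CFG"
proof (rule in_NP_name_program[where c = pangram_cmd])
  show "\<forall>a \<in> set_cmd pangram_cmd. name_act_wf a"
    by (simp add: pangram_cmd_def unary_cmd_def grammar_cmd_def production_cmd_def symbol_cmd_def nullable_cmd_def
        member_cmd_def derive_cmd_def expand_cmd_def enter_cmd_def leave_cmd_def copy_cmd_def null_cmd_def letter_cmd_def rot_def)
qed (use pangram_sound pangram_complete in blast)+

end
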